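(* Consider the coupled lattice dynamical system $$\mathbf y'(t)=\mathbf f(\mathbf y)+\varepsilon\mathbf F_\varepsilon(\mathbf y,\mathbf p),\qquad \mathbf p'(t)=\mathbf g(\mathbf y)+\varepsilon\mathbf G_\varepsilon(\mathbf y,\mathbf p)$$ on $\mathbb Y\times\mathbb P$ satisfying the standing assumptions listed in the context. Then there exist $\alpha>0$ and $\bar\gamma>0$ such that for all sufficiently small $\varepsilon$ and all $\gamma\in(0,\bar\gamma)$, for every two trajectories $\mathbf y^{0,1}$ and $\mathbf y^{0,2}$ from $\Lambda^\infty$ satisfying the condition $$\sup_{t\ge t_0}\|\mathbf y^{0,1}(t)-\mathbf y^{0,2}(t)\|_{\mathbb Y}\le\gamma,$$ given any solution $(\mathbf y^1(t),\mathbf p^1(t))$ from the invariant manifold $\mathbb W_{\mathbf y^{0,1},\varepsilon}$, there exists a unique solution $(\mathbf y^2(t),\mathbf p^2(t))$ from the invariant manifold $\mathbb W_{\mathbf y^{0,2},\varepsilon}$ such that $$\|\mathbf y^1(t)-\mathbf y^2(t)\|_{\mathbb Y}+\|\mathbf p^1(t)-\mathbf p^2(t)\|_{\mathbb P}\le C(\gamma)e^{-\alpha(t-t_0)},\qquad t\ge t_0 .$$ The factor $C(\gamma)$ tends to zero as $\gamma\to0$.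
   Context: Let $Y=\mathbb R^n$, $P=\mathbb R^m$, $r\ge1$. For $k\in\mathbb Z$ let $f_k:Y\to Y$, $g_k:Y\to P$ be $C^r$, with derivatives up to order $r$ uniformly continuous and bounded, uniformly in $k$. For each $k$ the equation $y'=f_k(y)$ has a bounded uniformly hyperbolic invariant set $\Lambda_k$; all these sets are uniformly bounded and uniformly hyperbolic for all $k$. Hyperbolicity of an invariant set $\Lambda$ of $y'=f(y)$: for each $y\in\Lambda$ there are subspaces $N^s(y),N^u(y)$ depending continuously on $y\in\Lambda$ with $N^s(y)\oplus N^u(y)\oplus\operatorname{Span}(f(y))=\mathbb R^n$ (with $f(y)\ne0$); for every orbit $y(t)$ in $\Lambda$ the families $N^s(y(t))$, $N^u(y(t))$ are invariant under the linearized flow $v'=f'(y(t))v$, which is exponentially contracting on $N^s(y(t))$ as $t\to+\infty$ and on $N^u(y(t))$ as $t\to-\infty$. For such an orbit let $y^*(t)$ be the uniformly bounded solution of $v'=-f'(y(t))^\top v$ with $\langle y^*(t)\cdot\dot y(t)\rangle\equiv1$. Then for any bounded continuous $h$ the equation $v'-f'(y(t))v+\langle y^*(t)\cdot v\rangle\dot y(t)=h(t)$ has a unique uniformly bounded solution $v$, and $\|v\|_{C^0}\le C_\Lambda\|h\|_{C^0}$; uniform hyperbolicity means that $C_\Lambda$ can be taken the same for all orbits and all $k$. $\mathbb Y:=l_\infty(Y)$, $\mathbb P:=l_\infty(P)$ (bounded sequences indexed by $k\in\mathbb Z$, sup norms); $\mathbf f(\mathbf y)=\{f_k(y_k)\}$,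 $\mathbf g(\mathbf y)=\{g_k(y_k)\}$. $\mathbf F_\varepsilon:\mathbb Y\times\mathbb P\to\mathbb Y$, $\mathbf G_\varepsilon:\mathbb Y\times\mathbb P\to\mathbb P$ are $C^r$ (all derivatives up to order $r$ exist, are uniformly continuous and uniformly bounded), depend continuously (in $C^r$) on the small parameter $\varepsilon$, and $\|\mathbf F_\varepsilon\|_{C^r}+\|\mathbf G_\varepsilon\|_{C^r}\le C$ independently of $\varepsilon$. A trajectory (orbit) $\mathbf y^0\in\Lambda^\infty$ is a sequence $\{y^0_k(t)\}_{k\in\mathbb Z}$ of arbitrary orbits $y^0_k$ of $y'=f_k(y)$ lying in $\Lambda_k$. $\Psi$ is the Banach space of bounded real sequences $\Phi=\{\phi_k\}_{k\in\mathbb Z}$ with sup norm. $\mathbb W^0_{\mathbf y^0}$ is the set of $(\mathbf y,\mathbf p)$ with $y_k=y^0_k(\phi_k)$, $\Phi\in\Psi$, $\mathbf p\in\mathbb P$. For all small $\varepsilon$ the invariant manifold $\mathbb W_{\mathbf y^0,\varepsilon}$ is the set of all solutions of the coupled system staying for all $t\in\mathbb R$ uniformly close (within a sufficiently small fixed distance) to $\mathbb W^0_{\mathbf y^0}$; it is a $C^r$-manifold given by $y_k=y^0_k(\phi_k)+\mathbb V_k(\Phi,\mathbf p,\varepsilon)$, $\Phi\in\Psi$, $\mathbf p\in\mathbb P$, with $\|\mathbb V_k\|_{C^{r-1}}=O(\varepsilon)$, $\|\mathbb V_k\|_{C^r}=o(1)_{\varepsilon\to0}$ uniformly in $k$ and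 $\mathbf y^0$.
   Formalization: C(γ) may also depend on a bound K on how far the given solution's phases lag behind t0 at time t0; uniqueness is only among solutions with phases eventually ρ-close to the given ones; y* is bounded uniformly over orbits and k; solutions in W follow continuous phases. *)

theory Defs
  imports "HOL-Analysis.Analysis"
begin

section \<open>Uniformly smooth families\<close>

text \<open>Where all the derivatives below exist, \<open>frechet_iter f [v1, ..., vj] x\<close> is the value
  \<open>D^j f(x)[v1, ..., vj]\<close> of the \<open>j\<close>-th Frechet derivative; the list avoids nested operator types,
  so that the order \<open>r\<close> can be an ordinary natural number.\<close>

primrec frechet_iter ::
  "('a::real_normed_vector \<Rightarrow> 'b::real_normed_vector) \<Rightarrow> 'a list \<Rightarrow> 'a \<Rightarrow> 'b" where
  "frechet_iter f [] = f"
| "frechet_iter f (v # vs) = (\<lambda>x. frechet_derivative (frechet_iter f vs) (at x) v)"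

text \<open>All derivatives of order \<open>0, ..., r\<close> are bounded by \<open>B\<close> in the norm of multilinear maps.\<close>

definition Cr_norm_le ::
  "nat \<Rightarrow> real \<Rightarrow> ('a::real_normed_vector \<Rightarrow> 'b::real_normed_vector) \<Rightarrow> bool" where
  "Cr_norm_le r B f \<longleftrightarrow>
     (\<forall>vs x. length vs \<le> r \<longrightarrow> norm (frechet_iter f vs x) \<le> B * prod_list (map norm vs))"

text \<open>The family \<open>f i\<close>, \<open>i \<in> I\<close>, is of class \<open>C^r\<close> with derivatives of order \<open>0, ..., r\<close> bounded
  and uniformly continuous, with a bound and a modulus of continuity common to all \<open>i \<in> I\<close>.
  Differentiability is asked for with the direction vectors held fixed. Together with the
  uniform continuity in the norm of multilinear maps this gives Frechet differentiability
  of \<open>D^j f\<close> (\<open>j < r\<close>) as a map into the multilinear maps, by the mean value theorem.\<close>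

definition uniformly_Cr ::
  "nat \<Rightarrow> 'i set \<Rightarrow> ('i \<Rightarrow> 'a::real_normed_vector \<Rightarrow> 'b::real_normed_vector) \<Rightarrow> bool" where
  "uniformly_Cr r I f \<longleftrightarrow>
     (\<forall>i\<in>I. \<forall>vs x. length vs < r \<longrightarrow> frechet_iter (f i) vs differentiable (at x)) \<and>
     (\<exists>B. \<forall>i\<in>I. Cr_norm_le r B (f i)) \<and>
     (\<forall>e>0. \<exists>d>0. \<forall>i\<in>I. \<forall>x y. dist x y < d \<longrightarrow>
        (\<forall>vs. length vs \<le> r \<longrightarrow>
           norm (frechet_iter (f i) vs x - frechet_iter (f i) vs y) \<le> e * prod_list (map norm vs)))"

text \<open>A family depending on the small parameter \<open>\<epsilon>\<close>, \<open>\<bar>\<epsilon>\<bar> < \<epsilon>1\<close>: every member is \<open>C^r\<close>, the \<open>C^r\<close>-norms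
  are bounded independently of \<open>\<epsilon>\<close>, and the dependence on \<open>\<epsilon>\<close> is continuous in the \<open>C^r\<close>-norm.\<close>

definition Cr_perturbation ::
  "nat \<Rightarrow> real \<Rightarrow> (real \<Rightarrow> 'a::real_normed_vector \<Rightarrow> 'b::real_normed_vector) \<Rightarrow> bool" where
  "Cr_perturbation r \<epsilon>1 F \<longleftrightarrow>
     (\<forall>\<epsilon>. \<bar>\<epsilon>\<bar> < \<epsilon>1 \<longrightarrow> uniformly_Cr r {\<epsilon>} F) \<and>
     (\<exists>C. \<forall>\<epsilon>. \<bar>\<epsilon>\<bar> < \<epsilon>1 \<longrightarrow> Cr_norm_le r C (F \<epsilon>)) \<and>
     (\<forall>\<epsilon>. \<bar>\<epsilon>\<bar> < \<epsilon>1 \<longrightarrow> (\<forall>e>0. \<exists>d>0. \<forall>\<epsilon>'. \<bar>\<epsilon>'\<bar> < \<epsilon>1 \<and> \<bar>\<epsilon>' - \<epsilon>\<bar> < d \<longrightarrow>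
        Cr_norm_le r e (\<lambda>z. F \<epsilon>' z - F \<epsilon> z)))"


section \<open>Hyperbolic invariant sets\<close>

definition orbit_in ::
  "('a::real_normed_vector \<Rightarrow> 'a) \<Rightarrow> 'a set \<Rightarrow> (real \<Rightarrow> 'a) \<Rightarrow> bool" where
  "orbit_in f L x \<longleftrightarrow> (\<forall>t. (x has_vector_derivative f (x t)) (at t) \<and> x t \<in> L)"

definition invariant_set :: "('a::real_normed_vector \<Rightarrow> 'a) \<Rightarrow> 'a set \<Rightarrow> bool" where
  "invariant_set f L \<longleftrightarrow> (\<forall>a\<in>L. \<exists>x. orbit_in f L x \<and> x 0 = a)"

definition linearized_solution ::
  "('a::real_normed_vector \<Rightarrow> 'a) \<Rightarrow> (real \<Rightarrow> 'a) \<Rightarrow> (real \<Rightarrow> 'a) \<Rightarrow> bool" where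
  "linearized_solution f x v \<longleftrightarrow>
     (\<forall>t. (v has_vector_derivative frechet_derivative f (at (x t)) (v t)) (at t))"

text \<open>Continuous dependence of the subspace \<open>N y\<close> on \<open>y\<close>, in the gap metric.\<close>

definition subspaces_continuous_on ::
  "'a::real_normed_vector set \<Rightarrow> ('a \<Rightarrow> 'a set) \<Rightarrow> bool" where
  "subspaces_continuous_on L N \<longleftrightarrow>
     (\<forall>y\<in>L. \<forall>e>0. \<exists>d>0. \<forall>z\<in>L. dist z y < d \<longrightarrow>
        (\<forall>v\<in>N y. norm v \<le> 1 \<longrightarrow> infdist v (N z) \<le> e) \<and>
        (\<forall>v\<in>N z. norm v \<le> 1 \<longrightarrow> infdist v (N y) \<le> e))"

definition hyperbolic_set :: "('a::euclidean_space \<Rightarrow> 'a) \<Rightarrow> 'a set \<Rightarrow> bool" where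
  "hyperbolic_set f L \<longleftrightarrow>
     invariant_set f L \<and>
     (\<exists>Ns Nu.
        (\<forall>y\<in>L. subspace (Ns y) \<and> subspace (Nu y) \<and> f y \<noteq> 0 \<and>
           (\<forall>v. \<exists>a\<in>Ns y. \<exists>b\<in>Nu y. \<exists>c. v = a + b + c *\<^sub>R f y) \<and>
           (\<forall>a\<in>Ns y. \<forall>b\<in>Nu y. \<forall>c. a + b + c *\<^sub>R f y = 0 \<longrightarrow> a = 0 \<and> b = 0 \<and> c = 0)) \<and>
        subspaces_continuous_on L Ns \<and> subspaces_continuous_on L Nu \<and>
        (\<exists>K>0. \<exists>\<nu>>0. \<forall>x v s. orbit_in f L x \<and> linearized_solution f x v \<longrightarrow>
           (v s \<in> Ns (x s) \<longrightarrow>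
              (\<forall>t. v t \<in> Ns (x t)) \<and>
              (\<forall>t\<ge>s. norm (v t) \<le> K * exp (- \<nu> * (t - s)) * norm (v s))) \<and>
           (v s \<in> Nu (x s) \<longrightarrow>
              (\<forall>t. v t \<in> Nu (x t)) \<and>
              (\<forall>t\<le>s. norm (v t) \<le> K * exp (- \<nu> * (s - t)) * norm (v s)))))"

text \<open>The solvability property of the linearization along an orbit \<open>x\<close>: \<open>ys\<close> is the bounded
  solution of the adjoint equation normalized by \<open>\<langle>ys, x'\<rangle> = 1\<close>, and \<open>C\<close> is the constant
  bounding \<open>v\<close> by \<open>h\<close>. Elements of \<open>real \<Rightarrow>\<^sub>C 'a\<close> are the bounded continuous functions on the line,
  with the sup norm.\<close>

definition linearization_bounds ::
  "('a::euclidean_space \<Rightarrow> 'a) \<Rightarrow> (real \<Rightarrow> 'a) \<Rightarrow> real \<Rightarrow> real \<Rightarrow> bool" where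
  "linearization_bounds f x M C \<longleftrightarrow>
     (\<exists>ys :: real \<Rightarrow>\<^sub>C 'a.
        norm ys \<le> M \<and>
        (\<forall>t. (apply_bcontfun ys has_vector_derivative
                - adjoint (frechet_derivative f (at (x t))) (apply_bcontfun ys t)) (at t)) \<and>
        (\<forall>t. apply_bcontfun ys t \<bullet> f (x t) = 1) \<and>
        (\<forall>h :: real \<Rightarrow>\<^sub>C 'a.
           let solves = (\<lambda>v :: real \<Rightarrow>\<^sub>C 'a. \<forall>t. (apply_bcontfun v has_vector_derivative
                 frechet_derivative f (at (x t)) (apply_bcontfun v t)
                 - (apply_bcontfun ys t \<bullet> apply_bcontfun v t) *\<^sub>R f (x t)
                 + apply_bcontfun h t) (at t))
           in (\<exists>!v. solves v) \<and> (\<forall>v. solves v \<longrightarrow> norm v \<le> C * norm h)))"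

definition uniformly_hyperbolic ::
  "(int \<Rightarrow> 'a::euclidean_space \<Rightarrow> 'a) \<Rightarrow> (int \<Rightarrow> 'a set) \<Rightarrow> bool" where
  "uniformly_hyperbolic f L \<longleftrightarrow>
     (\<exists>R. \<forall>k. \<forall>y\<in>L k. norm y \<le> R) \<and>
     (\<forall>k. hyperbolic_set (f k) (L k)) \<and>
     (\<exists>M C. \<forall>k x. orbit_in (f k) (L k) x \<longrightarrow> linearization_bounds (f k) x M C)"


section \<open>The lattice system\<close>

text \<open>Bounded sequences with the sup norm: \<open>int\<close> carries the discrete topology, so
  \<open>int \<Rightarrow>\<^sub>C 'a\<close> is the space of bounded sequences indexed by the integers.\<close>

type_synonym 'a linf = "int \<Rightarrow>\<^sub>C 'a"

text \<open>The sequence \<open>h k (u k)\<close>. It is used for the sitewise maps \<open>f\<close> and \<open>g\<close>, and for the orbits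
  \<open>y0 k\<close> evaluated at a sequence of phases \<open>u k\<close>. It is meaningful when the sequence is bounded.\<close>

definition sitewise ::
  "(int \<Rightarrow> 'a::metric_space \<Rightarrow> 'b::metric_space) \<Rightarrow> 'a linf \<Rightarrow> 'b linf" where
  "sitewise h u = Bcontfun (\<lambda>k. h k (apply_bcontfun u k))"

lemma apply_sitewise:
  assumes "bounded (range (\<lambda>k. h k (apply_bcontfun u k)))"
  shows "apply_bcontfun (sitewise h u) k = h k (apply_bcontfun u k)"
  unfolding sitewise_def
  by (subst Bcontfun_inverse) (auto simp: bcontfun_def assms)

definition trajectories ::
  "(int \<Rightarrow> 'a::real_normed_vector \<Rightarrow> 'a) \<Rightarrow> (int \<Rightarrow> 'a set) \<Rightarrow> (int \<Rightarrow> real \<Rightarrow> 'a) set" where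
  "trajectories f L = {y0. \<forall>k. orbit_in (f k) (L k) (y0 k)}"

abbreviation traj_at :: "(int \<Rightarrow> real \<Rightarrow> 'a::metric_space) \<Rightarrow> real \<Rightarrow> 'a linf" where
  "traj_at y0 t \<equiv> sitewise y0 (const_bcontfun t)"

definition coupled_solution ::
  "(int \<Rightarrow> 'a \<Rightarrow> 'a) \<Rightarrow> (int \<Rightarrow> 'a \<Rightarrow> 'b) \<Rightarrow>
   (real \<Rightarrow> 'a linf \<times> 'b linf \<Rightarrow> 'a linf) \<Rightarrow> (real \<Rightarrow> 'a linf \<times> 'b linf \<Rightarrow> 'b linf) \<Rightarrow>
   real \<Rightarrow> (real \<Rightarrow> 'a::real_normed_vector linf \<times> 'b::real_normed_vector linf) \<Rightarrow> bool" where
  "coupled_solution f g F G \<epsilon> u \<longleftrightarrow>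
     (\<forall>t. (u has_vector_derivative
             (sitewise f (fst (u t)) + \<epsilon> *\<^sub>R F \<epsilon> (u t),
              sitewise g (fst (u t)) + \<epsilon> *\<^sub>R G \<epsilon> (u t))) (at t))"

text \<open>A solution \<open>u = (y, p)\<close> of the coupled system from the invariant manifold of \<open>y0\<close>: for all
  times it stays within \<open>\<delta>\<close> of the points \<open>(y0(\<Phi>(t)), p(t))\<close> of the unperturbed manifold, which is
  parametrized by phases and \<open>p\<close>. The phases move continuously. Without this, closeness to the
  unperturbed manifold as a set would not single out the orbit \<open>y0\<close>: if some \<open>y0 k\<close> is dense in
  its hyperbolic set, solutions following any other orbit would qualify.\<close>

definition manifold_solution ::
  "(int \<Rightarrow> 'a \<Rightarrow> 'a) \<Rightarrow> (int \<Rightarrow> 'a \<Rightarrow> 'b) \<Rightarrow>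
   (real \<Rightarrow> 'a linf \<times> 'b linf \<Rightarrow> 'a linf) \<Rightarrow> (real \<Rightarrow> 'a linf \<times> 'b linf \<Rightarrow> 'b linf) \<Rightarrow>
   real \<Rightarrow> real \<Rightarrow> (int \<Rightarrow> real \<Rightarrow> 'a) \<Rightarrow> (real \<Rightarrow> real linf) \<Rightarrow>
   (real \<Rightarrow> 'a::real_normed_vector linf \<times> 'b::real_normed_vector linf) \<Rightarrow> bool" where
  "manifold_solution f g F G \<epsilon> \<delta> y0 \<Phi> u \<longleftrightarrow>
     coupled_solution f g F G \<epsilon> u \<and>
     continuous_on UNIV \<Phi> \<and>
     (\<forall>t. dist (u t) (sitewise y0 (\<Phi> t), snd (u t)) \<le> \<delta>)"

end

theory Submission
  imports Defs
begin

text \<open>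
  Write a solution near an orbit \<open>x\<close> as \<open>y = x \<circ> \<phi> + v\<close>, with the phase driven by
  \<open>\<phi>' = 1 + \<langle>ys \<circ> \<phi>, v\<rangle>\<close>, where \<open>ys\<close> is the normalized bounded solution of the adjoint equation. Then the
  linear part of the equation for \<open>v\<close> is exactly the operator whose solvability is the uniform
  hyperbolicity assumption. The bound on its inverse survives the time change \<open>s = \<phi> t\<close> and conjugation
  by weights \<open>exp (\<alpha> t)\<close> with small \<open>\<alpha>\<close>, so \<open>v\<close> is a Lipschitz function of the phase and of the coupling
  force in exponentially weighted norms. The remaining variables \<open>\<phi>\<close> and \<open>p\<close> are recovered by integration
  from \<open>+\<infinity>\<close>. Hence finding the solution that is asymptotic to \<open>u1\<close> in the future and close to \<open>y02\<close> in the
  past is a contraction problem, posed on the whole time axis.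

  The constant tends to zero with \<open>\<gamma>\<close> because orbits that are \<open>\<gamma>\<close>-close after \<open>t0\<close> are still close to a fixed
  accuracy after \<open>t0 - ln (1/\<gamma>) / const\<close>, so the argument can start that much earlier.
\<close>

section \<open>Calculus on the real line\<close>

text \<open>No transversality condition is imposed on \<open>v\<close>; the phase equation removes
  the redundancy, and it is itself stable. As a function of the phase,
  \<open>\<langle>ys \<phi>, y - x \<phi>\<rangle>\<close> has slope close to -1, because
  \<open>\<langle>ys, x'\<rangle> = 1\<close>. Hence a merely continuous tracking phase can be
  replaced by an exact one, and uniqueness needs only a crude bound on the difference of phases. The
  obstacle is the past, where the two trajectories may be unrelated. The reference curve for the
  contraction agrees with \<open>u1\<close> only from a time \<tau> on. Before \<tau> its defect is
  bounded but not small, which is harmless because the weight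
  \<open>exp (- \<alpha> (t - \<tau>))\<close> is at least 1 there. That weight permits exponential
  growth into the past, so the contraction alone says nothing about closeness to \<open>y02\<close>.
  Closeness comes from hyperbolicity: a displacement that stays in a fixed small ball is bounded by
  its forcing, hence is of order \<epsilon>. With \<open>v\<close> prescribed, \<phi> and
  \<open>p\<close> are merely integrated, at the cost of a factor \<open>1 / \<alpha>\<close>. The
  feedback therefore has to be small against \<alpha>, which fixes the order in which the constants
  are chosen.\<close>

lemma vector_derivative_majorant:
  fixes f :: "real \<Rightarrow> 'a::real_normed_vector"
  assumes "a \<le> b"
    and "\<And>t. (f has_vector_derivative f' t) (at t)"
    and "\<And>t. (h has_real_derivative h' t) (at t)"
    and "\<And>t. a < t \<Longrightarrow> t < b \<Longrightarrow> norm (f' t) \<le> h' t"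
  shows "norm (f b - f a) \<le> h b - h a"
proof (cases "a = b")
  case False
  then have "a < b" using assms(1) by simp
  then show ?thesis
    by (rule differentiable_bound_general[where f' = f' and \<phi>' = h'])
       (use assms in \<open>auto simp: has_real_derivative_iff_has_vector_derivative
          intro!: continuous_at_imp_continuous_on
            has_vector_derivative_continuous\<close>)
qed simp

lemma vector_derivative_Lipschitz:
  fixes f :: "real \<Rightarrow> 'a::real_normed_vector"
  assumes "\<And>t. (f has_vector_derivative f' t) (at t)"
    and "\<And>t. norm (f' t) \<le> D"
  shows "norm (f b - f a) \<le> D * \<bar>b - a\<bar>"
proof -
  have *: "norm (f b - f a) \<le> D * \<bar>b - a\<bar>" if "a \<le> b" for a b
  proof -
    have "((\<lambda>t. D * t) has_real_derivative D) (at t)" for t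
      by (auto intro!: derivative_eq_intros)
    from vector_derivative_majorant[OF that assms(1) this] show ?thesis
      using assms(2) that by (simp add: algebra_simps)
  qed
  show ?thesis
    using *[of a b] *[of b a] by (cases "a \<le> b") (auto simp: norm_minus_commute abs_minus_commute)
qed

lemma Lipschitz_imp_continuous_on:
  fixes f :: "'a::real_normed_vector \<Rightarrow> 'b::real_normed_vector"
  assumes "\<And>s t. norm (f s - f t) \<le> D * norm (s - t)"
  shows "continuous_on S f"
proof -
  have "(max D 0)-lipschitz_on S f"
  proof (rule lipschitz_onI)
    show "dist (f s) (f t) \<le> max D 0 * dist s t" for s t
      using assms[of s t] mult_right_mono[of D "max D 0" "norm (s - t)"]
      by (simp add: dist_norm)
  qed simp
  then show ?thesis by (rule lipschitz_on_continuous_on)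
qed

lemma norm_diff_le_of_has_derivative:
  fixes f :: "'a::real_normed_vector \<Rightarrow> 'b::real_normed_vector"
  assumes "\<And>x. (f has_derivative f' x) (at x)"
    and "\<And>x v. norm (f' x v) \<le> B * norm v" and "B \<ge> 0"
  shows "norm (f x - f y) \<le> B * norm (x - y)"
  by (rule differentiable_bound[of UNIV f f'])
     (use assms in \<open>auto intro!: onorm_bound has_derivative_bounded_linear simp: mult.commute\<close>)

lemma antiderivative_exists:
  fixes w :: "real \<Rightarrow> 'a::banach"
  assumes w: "continuous_on UNIV w"
  shows "\<exists>P. \<forall>t. (P has_vector_derivative w t) (at t)"
proof -
  define P where "P u = (if 0 \<le> u then integral {0..u} w else - integral {u..0} w)" for u
  have int: "w integrable_on {a..b}" for a b
    by (rule integrable_continuous_real) (rule continuous_on_subset[OF w], simp)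
  have "(P has_vector_derivative w t) (at t)" for t
  proof -
    \<comment> \<open>A window with both 0 and \<open>t\<close> in its interior: on it
      \<open>P\<close> differs by a constant from the integral with the fixed lower end
      \<open>a\<close>, whatever the sign of the argument.\<close>
    define a where "a = min t 0 - 1"
    define b where "b = max t 0 + 1"
    have P: "P u = integral {a..u} w - integral {a..0} w" if "u \<in> {a..b}" for u
    proof (cases "0 \<le> u")
      case True
      then show ?thesis
        using Henstock_Kurzweil_Integration.integral_combine[of a 0 u w] int
        by (simp add: P_def a_def algebra_simps)
    next
      case False
      then show ?thesis
        using Henstock_Kurzweil_Integration.integral_combine[of a u 0 w] int that
        by (auto simp: P_def algebra_simps)
    qed
    have "((\<lambda>u. integral {a..u} w) has_vector_derivative w t) (at t within {a..b})"
      by (rule integral_has_vector_derivative)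
         (use w in \<open>auto simp: a_def b_def intro: continuous_on_subset\<close>)
    moreover have "at t within {a..b} = at t"
      by (rule at_within_interior) (auto simp: a_def b_def interior_atLeastAtMost_real)
    ultimately have "((\<lambda>u. integral {a..u} w - integral {a..0} w) has_vector_derivative w t) (at t)"
      using has_vector_derivative_diff_const[of "\<lambda>u. integral {a..u} w" "integral {a..0} w"] by simp
    then show ?thesis
    proof (rule has_vector_derivative_transform_within_open[where S = "{a<..<b}"])
      show "integral {a..x} w - integral {a..0} w = P x" if "x \<in> {a<..<b}" for x
        using P[of x] that by simp
    qed (auto simp: a_def b_def)
  qed
  then show ?thesis by blast
qed

lemma exp_decay_derivative:
  assumes "\<alpha> \<noteq> 0"
  shows "((\<lambda>t. - (c / \<alpha>) * exp (- \<alpha> * (t - \<tau>))) has_real_derivative c * exp (- \<alpha> * (t - \<tau>))) (at t)"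
  using assms by (auto intro!: derivative_eq_intros)

text \<open>The condition at +\<infinity> makes \<open>f t\<close> minus the integral of
  \<open>f'\<close> over [t, \<infinity>). The weight reproduces itself under this integration for
  all real \<open>t\<close>, up to the factor \<open>1 / \<alpha>\<close>.\<close>

lemma decay_from_derivative:
  fixes f :: "real \<Rightarrow> 'a::real_normed_vector"
  assumes "\<alpha> > 0"
    and "\<And>t. (f has_vector_derivative f' t) (at t)"
    and bd: "\<And>t. norm (f' t) \<le> c * exp (- \<alpha> * (t - \<tau>))"
    and lim: "(f \<longlongrightarrow> 0) at_top"
  shows "norm (f t) \<le> c / \<alpha> * exp (- \<alpha> * (t - \<tau>))"
proof (rule tendsto_upperbound)
  show "((\<lambda>s. norm (f s - f t)) \<longlongrightarrow> norm (f t)) at_top"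
    using tendsto_norm[OF tendsto_diff[OF lim tendsto_const[of "f t"]]] by simp
  have "c \<ge> 0" using order_trans[OF norm_ge_zero bd[of \<tau>]] by simp
  have "norm (f s - f t) \<le> c / \<alpha> * exp (- \<alpha> * (t - \<tau>))" if "s \<ge> t" for s
  proof -
    have "norm (f s - f t) \<le> - (c / \<alpha>) * exp (- \<alpha> * (s - \<tau>)) - (- (c / \<alpha>) * exp (- \<alpha> * (t - \<tau>)))"
      by (rule vector_derivative_majorant[OF that assms(2) exp_decay_derivative])
         (use assms bd in auto)
    moreover have "c / \<alpha> * exp (- \<alpha> * (s - \<tau>)) \<ge> 0" using \<open>c \<ge> 0\<close> assms(1) by simp
    ultimately show ?thesis by linarith
  qed
  then show "\<forall>\<^sub>F s in at_top. norm (f s - f t) \<le> c / \<alpha> * exp (- \<alpha> * (t - \<tau>))"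
    by (rule eventually_at_top_linorderI)
qed simp

lemma exp_decay_tendsto_0:
  assumes "\<alpha> > 0"
  shows "((\<lambda>t. c * exp (- \<alpha> * (t - \<tau>))) \<longlongrightarrow> (0::real)) at_top"
proof -
  have "filterlim (\<lambda>t. \<alpha> * (- \<tau> + t)) at_top at_top"
    by (intro filterlim_tendsto_pos_mult_at_top[OF tendsto_const assms]
        filterlim_tendsto_add_at_top[OF tendsto_const filterlim_ident])
  then have "filterlim (\<lambda>t. - \<alpha> * (t - \<tau>)) at_bot at_top"
    by (simp add: filterlim_uminus_at_top algebra_simps)
  then show ?thesis
    using tendsto_mult_right_zero[OF filterlim_compose[OF exp_at_bot]] by blast
qed

lemma exp_decay_imp_tendsto_0:
  fixes f :: "real \<Rightarrow> 'a::real_normed_vector"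
  assumes "\<alpha> > 0" and "\<And>t. t \<ge> T \<Longrightarrow> norm (f t) \<le> c * exp (- \<alpha> * (t - \<tau>))"
  shows "(f \<longlongrightarrow> 0) at_top"
  by (rule Lim_null_comparison[OF _ exp_decay_tendsto_0[OF assms(1), of c \<tau>]])
     (use assms(2) in \<open>auto intro: eventually_at_top_linorderI\<close>)

text \<open>The primitive wanted is minus the integral of \<open>w\<close> over [t, \<infinity>). It
  is any primitive \<open>Q\<close> minus its limit at +\<infinity>, which exists because the
  exponential bound makes the values at the natural numbers a Cauchy sequence.\<close>

lemma decaying_antiderivative:
  fixes w :: "real \<Rightarrow> 'a::banach"
  assumes "\<alpha> > 0" and w: "continuous_on UNIV w"
    and bd: "\<And>t. norm (w t) \<le> c * exp (- \<alpha> * (t - \<tau>))"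
  shows "\<exists>P. (\<forall>t. (P has_vector_derivative w t) (at t)) \<and>
    (\<forall>t. norm (P t) \<le> c / \<alpha> * exp (- \<alpha> * (t - \<tau>)))"
proof -
  obtain Q where Q: "\<And>t. (Q has_vector_derivative w t) (at t)"
    using antiderivative_exists[OF w] by blast
  have "c \<ge> 0" using order_trans[OF norm_ge_zero bd[of \<tau>]] by simp
  have *: "norm (Q s - Q t) \<le> c / \<alpha> * exp (- \<alpha> * (t - \<tau>))" if "s \<ge> t" for s t
  proof -
    have "norm (Q s - Q t) \<le> - (c / \<alpha>) * exp (- \<alpha> * (s - \<tau>)) - (- (c / \<alpha>) * exp (- \<alpha> * (t - \<tau>)))"
      by (rule vector_derivative_majorant[OF that Q exp_decay_derivative])
         (use assms bd in auto)
    moreover have "c / \<alpha> * exp (- \<alpha> * (s - \<tau>)) \<ge> 0" using \<open>c \<ge> 0\<close> assms(1) by simp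
    ultimately show ?thesis by linarith
  qed
  have "Cauchy (\<lambda>n. Q (real n))"
  proof (rule CauchyI')
    fix e :: real assume "e > 0"
    have "(\<lambda>n. c / \<alpha> * exp (- \<alpha> * (real n - \<tau>))) \<longlonglongrightarrow> 0"
      using filterlim_compose[OF exp_decay_tendsto_0[OF assms(1)] filterlim_real_sequentially] .
    then have "\<forall>\<^sub>F n in sequentially. c / \<alpha> * exp (- \<alpha> * (real n - \<tau>)) < e"
      using \<open>e > 0\<close> by (rule order_tendstoD)
    then obtain N where N: "\<And>n. n \<ge> N \<Longrightarrow> c / \<alpha> * exp (- \<alpha> * (real n - \<tau>)) < e"
      by (auto simp: eventually_sequentially)
    show "\<exists>N. \<forall>m\<ge>N. \<forall>n>m. dist (Q (real m)) (Q (real n)) < e"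
    proof (intro exI allI impI)
      fix m n assume "m \<ge> N" "n > m"
      then show "dist (Q (real m)) (Q (real n)) < e"
        using *[of "real m" "real n"] N[of m] by (simp add: dist_norm norm_minus_commute)
    qed
  qed
  then obtain L where L: "(\<lambda>n. Q (real n)) \<longlonglongrightarrow> L"
    by (meson Cauchy_convergent convergent_def)
  have "norm (Q t - L) \<le> c / \<alpha> * exp (- \<alpha> * (t - \<tau>))" for t
  proof (rule tendsto_upperbound)
    show "(\<lambda>n. norm (Q t - Q (real n))) \<longlonglongrightarrow> norm (Q t - L)"
      by (intro tendsto_intros L)
    show "\<forall>\<^sub>F n in sequentially. norm (Q t - Q (real n)) \<le> c / \<alpha> * exp (- \<alpha> * (t - \<tau>))"
      using * by (auto simp: eventually_sequentially norm_minus_commute intro!: exI[of _ "nat \<lceil>t\<rceil>"] )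
  qed simp
  then show ?thesis
    using Q by (intro exI[of _ "\<lambda>t. Q t - L"]) (auto simp: has_vector_derivative_diff_const)
qed

text \<open>Duhamel's formula from -\<infinity>: the solution is the integral of
  \<open>exp (s - t) * r s\<close> over s \<le> t. Reflecting time turns it into a decaying
  primitive with rate 1.\<close>

lemma bounded_solution_of_stable_equation:
  fixes r :: "real \<Rightarrow> real"
  assumes r: "continuous_on UNIV r" and bd: "\<And>t. \<bar>r t\<bar> \<le> c"
  shows "\<exists>\<psi>. (\<forall>t. (\<psi> has_real_derivative - \<psi> t + r t) (at t)) \<and> (\<forall>t. \<bar>\<psi> t\<bar> \<le> c)"
proof -
  have "\<exists>P. (\<forall>t. (P has_vector_derivative exp (- t) * r (- t)) (at t)) \<and>
    (\<forall>t. norm (P t) \<le> c / 1 * exp (- 1 * (t - 0)))"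
    by (rule decaying_antiderivative)
       (use bd in \<open>auto intro!: continuous_intros continuous_on_compose2[OF r] simp: abs_mult mult.commute\<close>)
  then obtain P where P: "\<And>t. (P has_real_derivative exp (- t) * r (- t)) (at t)"
      "\<And>t. \<bar>P t\<bar> \<le> c * exp (- t)"
    by (auto simp: has_real_derivative_iff_has_vector_derivative)
  have "((\<lambda>t. - exp (- t) * P (- t)) has_real_derivative - (- exp (- t) * P (- t)) + r t) (at t)" for t
    by (auto intro!: derivative_eq_intros DERIV_chain2[OF P(1)] simp: exp_minus field_simps)
  moreover have "\<bar>- exp (- t) * P (- t)\<bar> \<le> c" for t
    using mult_left_mono[OF P(2)[of "- t"], of "exp (- t)"]
    by (simp add: abs_mult exp_minus field_simps)
  ultimately show ?thesis by (intro exI[of _ "\<lambda>t. - exp (- t) * P (- t)"]) blast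
qed

text \<open>The norm is not differentiable at zero, so the squared norm plus
  \<open>e\<^sup>2\<close> is used instead. Absorbing the mixed term
  \<open>2 * e * norm (D t)\<close> into squares raises the rate from \<open>B\<close> to
  \<open>B + 1\<close>.\<close>

lemma Gronwall_norm:
  fixes D :: "real \<Rightarrow> 'a::real_inner"
  assumes "a \<le> b" and B: "B \<ge> 0" "e \<ge> 0"
    and "\<And>t. (D has_vector_derivative D' t) (at t)"
    and bd: "\<And>t. norm (D' t) \<le> B * norm (D t) + e"
  shows "norm (D b) \<le> exp ((B + 1) * (b - a)) * (norm (D a) + e)"
proof -
  define c where "c = 2 * B + 1"
  define h where "h t = exp (- c * t) * (D t \<bullet> D t + e\<^sup>2)" for t
  have "c \<ge> 1" using B by (simp add: c_def)
  have inn: "((\<lambda>t. D t \<bullet> D t) has_real_derivative 2 * (D t \<bullet> D' t)) (at t)" for t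
    using bounded_bilinear.has_vector_derivative[OF bounded_bilinear_inner assms(4) assms(4)]
    by (simp add: has_real_derivative_iff_has_vector_derivative inner_commute)
  have h: "(h has_real_derivative exp (- c * t) * (2 * (D t \<bullet> D' t) - c * (D t \<bullet> D t + e\<^sup>2))) (at t)" for t
    unfolding h_def by (auto intro!: derivative_eq_intros inn simp: algebra_simps)
  have "2 * (D t \<bullet> D' t) \<le> c * (D t \<bullet> D t + e\<^sup>2)" for t
  proof -
    have "2 * (D t \<bullet> D' t) \<le> 2 * (norm (D t) * (B * norm (D t) + e))"
      using norm_cauchy_schwarz[of "D t" "D' t"] mult_left_mono[OF bd[of t], of "norm (D t)"] by simp
    also have "\<dots> \<le> c * (D t \<bullet> D t) + e\<^sup>2"
      using sum_squares_bound[of "norm (D t)" e]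
      by (simp add: c_def algebra_simps power2_norm_eq_inner[symmetric] power2_eq_square)
    also have "\<dots> \<le> c * (D t \<bullet> D t + e\<^sup>2)"
      using mult_right_mono[OF \<open>c \<ge> 1\<close>, of "e\<^sup>2"] by (simp add: algebra_simps)
    finally show ?thesis .
  qed
  then have "h b \<le> h a"
    by (intro DERIV_nonpos_imp_nonincreasing[OF assms(1)])
       (use h in \<open>auto intro!: exI mult_nonneg_nonpos\<close>)
  then have "exp (c * b) * h b \<le> exp (c * b) * h a" by simp
  then have "D b \<bullet> D b + e\<^sup>2 \<le> exp (c * (b - a)) * (D a \<bullet> D a + e\<^sup>2)"
    by (simp add: h_def mult.assoc[symmetric] exp_add[symmetric] algebra_simps)
  also have "\<dots> \<le> exp ((2 * B + 2) * (b - a)) * (norm (D a) + e)\<^sup>2"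
  proof (intro mult_mono)
    show "exp (c * (b - a)) \<le> exp ((2 * B + 2) * (b - a))"
      using assms(1) by (auto simp: c_def intro: mult_right_mono)
    show "D a \<bullet> D a + e\<^sup>2 \<le> (norm (D a) + e)\<^sup>2"
      using B by (simp add: power2_sum power2_norm_eq_inner)
  qed auto
  also have "\<dots> = (exp ((B + 1) * (b - a)) * (norm (D a) + e))\<^sup>2"
  proof -
    have "exp ((2 * B + 2) * (b - a)) = (exp ((B + 1) * (b - a)))\<^sup>2"
      using exp_double[of "(B + 1) * (b - a)"] by (simp add: algebra_simps)
    then show ?thesis by (simp add: power_mult_distrib)
  qed
  finally have "(norm (D b))\<^sup>2 \<le> (exp ((B + 1) * (b - a)) * (norm (D a) + e))\<^sup>2"
    unfolding power2_norm_eq_inner using zero_le_power2[of e] by linarith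
  then show ?thesis
    by (rule power2_le_imp_le) (use B in auto)
qed

lemma C1_inverse_function:
  fixes \<phi> a :: "real \<Rightarrow> real"
  assumes \<phi>: "\<And>t. (\<phi> has_real_derivative 1 + a t) (at t)" and a: "\<And>t. \<bar>a t\<bar> \<le> 1/2"
  shows "\<exists>\<theta>. (\<forall>t. \<theta> (\<phi> t) = t) \<and> (\<forall>s. \<phi> (\<theta> s) = s) \<and>
    (\<forall>s. (\<theta> has_real_derivative 1 / (1 + a (\<theta> s))) (at s))"
proof -
  \<comment> \<open>Speed at least 1/2 gives this expansion estimate, from which injectivity,
    surjectivity and the Lipschitz constant 2 of the inverse all follow.\<close>
  have low: "t - s \<le> 2 * \<phi> t - 2 * \<phi> s" if "s \<le> t" for s t
  proof -
    have "\<phi> s - s / 2 \<le> \<phi> t - t / 2"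
    proof (rule DERIV_nonneg_imp_nondecreasing[OF that, where f = "\<lambda>t. \<phi> t - t / 2"])
      fix u
      have "((\<lambda>t. \<phi> t - t / 2) has_real_derivative 1 + a u - 1 / 2) (at u)"
        by (auto intro!: derivative_eq_intros \<phi>)
      moreover have "0 \<le> 1 + a u - 1 / 2" using a[of u] by linarith
      ultimately show "\<exists>y. ((\<lambda>t. \<phi> t - t / 2) has_real_derivative y) (at u) \<and> 0 \<le> y"
        by (rule exI[of _ "1 + a u - 1 / 2", OF conjI])
    qed
    then show ?thesis by simp
  qed
  have cont: "continuous_on UNIV \<phi>"
    by (rule DERIV_continuous_on) (use \<phi> in auto)
  have inj: "inj \<phi>"
  proof (rule injI)
    fix s t assume "\<phi> s = \<phi> t"
    show "s = t"
    proof (cases "s \<le> t")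
      case True
      from low[OF this] \<open>\<phi> s = \<phi> t\<close> have "t - s \<le> 0" by simp
      with True show ?thesis by simp
    next
      case False
      from low[of t s] False \<open>\<phi> s = \<phi> t\<close> have "s - t \<le> 0" by simp
      with False show ?thesis by simp
    qed
  qed
  have surj: "\<exists>t. \<phi> t = s" for s
  proof -
    define t where "t = 2 * \<bar>s - \<phi> 0\<bar>"
    have "0 \<le> t" by (simp add: t_def)
    have "t \<le> 2 * (\<phi> t - \<phi> 0)" "t \<le> 2 * (\<phi> 0 - \<phi> (- t))"
      using low[of 0 t] low[of "- t" 0] \<open>0 \<le> t\<close> by simp_all
    moreover have "2 * (s - \<phi> 0) \<le> t" "2 * (\<phi> 0 - s) \<le> t"
      using abs_ge_self[of "s - \<phi> 0"] abs_ge_minus_self[of "s - \<phi> 0"] unfolding t_def by argo+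
    ultimately have "\<phi> (- t) \<le> s" "s \<le> \<phi> t" by argo+
    moreover have "- t \<le> t" by (simp add: t_def)
    ultimately show ?thesis
      using IVT'[of \<phi> "- t" s t] continuous_on_subset[OF cont] by blast
  qed
  then obtain \<theta> where \<theta>: "\<And>s. \<phi> (\<theta> s) = s" by metis
  then have \<theta>': "\<theta> (\<phi> t) = t" for t using inj by (auto dest: injD)
  have "norm (\<theta> s - \<theta> s') \<le> 2 * norm (s - s')" for s s'
  proof (cases "\<theta> s \<le> \<theta> s'")
    case True
    with low[OF this] show ?thesis unfolding \<theta> real_norm_def by argo
  next
    case False
    with low[of "\<theta> s'" "\<theta> s"] show ?thesis unfolding \<theta> real_norm_def by argo
  qed
  then have "continuous_on UNIV \<theta>" by (rule Lipschitz_imp_continuous_on)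
  then have "isCont \<theta> s" for s by (simp add: continuous_on_eq_continuous_at)
  moreover have "1 + a t \<noteq> 0" for t using a[of t] by auto
  ultimately have "(\<theta> has_real_derivative inverse (1 + a (\<theta> s))) (at s)" for s
    using DERIV_inverse_function[OF \<phi>, of \<theta> s "s - 1" "s + 1"] \<theta> by simp
  then show ?thesis using \<theta> \<theta>' by (auto simp: inverse_eq_divide)
qed

section \<open>Linear estimates along a hyperbolic orbit\<close>

text \<open>Serves to absorb self-referential estimates: the step applied to the supremum bounds it
  by half of itself plus \<open>K\<close>. The bound \<open>N0\<close> only guarantees that the
  supremum is finite; its size does not enter the result.\<close>

lemma bound_by_halving:
  fixes S :: "'i \<Rightarrow> real"
  assumes "\<And>t. S t \<le> N0"
    and step: "\<And>N t. (\<And>t. S t \<le> N) \<Longrightarrow> S t \<le> N / 2 + K"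
  shows "S t \<le> 2 * K"
proof -
  have bdd: "bdd_above (range S)" using assms(1) by (intro bdd_aboveI[of _ N0]) auto
  have up: "S t \<le> (SUP t. S t)" for t by (rule cSUP_upper[OF _ bdd]) simp
  have "(SUP t. S t) \<le> (SUP t. S t) / 2 + K" by (rule cSUP_least) (use step[OF up] in auto)
  then show ?thesis using up[of t] by linarith
qed

text \<open>Solvability is phrased with plain functions and pointwise bounds, so that time-changed
  and weighted forcings need no packaging as bounded continuous functions. Uniqueness of the bounded
  solution is contained in \<open>linear_estimate\<close>, applied to a difference of solutions with
  \<open>c = 0\<close>.\<close>

locale hyperbolic_orbit =
  fixes f :: "'a::euclidean_space \<Rightarrow> 'a" and A :: "'a \<Rightarrow> 'a \<Rightarrow> 'a"
    and x ys :: "real \<Rightarrow> 'a" and B M C :: real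
  assumes B: "B \<ge> 1" and M: "M \<ge> 1" and C: "C \<ge> 1"
    and f_deriv: "\<And>y. (f has_derivative A y) (at y)"
    and f_bound: "\<And>y. norm (f y) \<le> B"
    and A_bound: "\<And>y v. norm (A y v) \<le> B * norm v"
    and A_cont: "\<And>y e. e > 0 \<Longrightarrow> \<exists>d>0. \<forall>z. dist z y < d \<longrightarrow> (\<forall>v. norm (A z v - A y v) \<le> e * norm v)"
    and orbit: "\<And>t. (x has_vector_derivative f (x t)) (at t)"
    and ys_bound: "\<And>t. norm (ys t) \<le> M"
    and ys_Lipschitz: "\<And>s t. norm (ys s - ys t) \<le> M * B * \<bar>s - t\<bar>"
    and ys_normal: "\<And>t. ys t \<bullet> f (x t) = 1"
    and linear_solvable: "\<And>h c. continuous_on UNIV h \<Longrightarrow> (\<And>t. norm (h t) \<le> c) \<Longrightarrow>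
      \<exists>v. bounded (range v) \<and>
        (\<forall>t. (v has_vector_derivative A (x t) (v t) - (ys t \<bullet> v t) *\<^sub>R f (x t) + h t) (at t))"
    and linear_estimate: "\<And>h v c t. continuous_on UNIV h \<Longrightarrow> (\<And>t. norm (h t) \<le> c) \<Longrightarrow>
      bounded (range v) \<Longrightarrow>
      (\<And>t. (v has_vector_derivative A (x t) (v t) - (ys t \<bullet> v t) *\<^sub>R f (x t) + h t) (at t)) \<Longrightarrow>
      norm (v t) \<le> C * c"
begin

definition L where "L s v = A (x s) v - (ys s \<bullet> v) *\<^sub>R f (x s)"

text \<open>For \<open>y = x \<circ> \<phi> + v\<close> solving \<open>y' = f y\<close> with phase
  speed \<open>1 + ys \<bullet> v\<close>, this is \<open>v'\<close>. It vanishes at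
  \<open>v = 0\<close>, and its derivative in \<open>v\<close> there is \<open>L s\<close>.\<close>

definition rhs where "rhs s v = f (x s + v) - (1 + ys s \<bullet> v) *\<^sub>R f (x s)"

lemma A_bounded_linear: "bounded_linear (A y)"
  using f_deriv by (rule has_derivative_bounded_linear)

lemma f_Lipschitz: "norm (f y - f z) \<le> B * norm (y - z)"
  by (rule norm_diff_le_of_has_derivative[OF f_deriv A_bound]) (use B in simp)

lemma x_Lipschitz: "norm (x s - x t) \<le> B * \<bar>s - t\<bar>"
  using vector_derivative_Lipschitz[OF orbit f_bound] by blast

lemma continuous_on_f: "continuous_on S f"
  using f_Lipschitz by (rule Lipschitz_imp_continuous_on)

lemma continuous_on_x: "continuous_on S x"
  using x_Lipschitz by (intro Lipschitz_imp_continuous_on) auto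

lemma continuous_on_ys: "continuous_on S ys"
  using ys_Lipschitz by (intro Lipschitz_imp_continuous_on) auto

lemma continuous_on_A [continuous_intros]:
  fixes u v :: "real \<Rightarrow> 'a"
  assumes "continuous_on UNIV u" "continuous_on UNIV v"
  shows "continuous_on UNIV (\<lambda>s. A (u s) (v s))"
proof -
  have "isCont (\<lambda>s. A (u s) (v s)) s" for s
  proof -
    have u: "(u \<longlongrightarrow> u s) (at s)" and v: "(v \<longlongrightarrow> v s) (at s)"
      using assms by (auto simp: continuous_on_eq_continuous_at isCont_def)
    have "((\<lambda>r. A (u r) (v r) - A (u s) (v r)) \<longlongrightarrow> 0) (at s)"
    proof (rule tendstoI)
      fix e :: real assume "e > 0"
      define e' where "e' = e / (2 * (norm (v s) + 1))"
      have "e' > 0"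
        using \<open>e > 0\<close> unfolding e'_def
        by (intro divide_pos_pos mult_pos_pos add_nonneg_pos) auto
      then obtain \<delta> where \<delta>: "\<delta> > 0"
        "\<And>z w. dist z (u s) < \<delta> \<Longrightarrow> norm (A z w - A (u s) w) \<le> e' * norm w"
        using A_cont[of e' "u s"] by blast
      have "\<forall>\<^sub>F r in at s. dist (u r) (u s) < \<delta>" using tendstoD[OF u \<delta>(1)] .
      moreover have "\<forall>\<^sub>F r in at s. norm (v r) < norm (v s) + 1"
        using order_tendstoD(2)[OF tendsto_norm[OF v]] by simp
      ultimately show "\<forall>\<^sub>F r in at s. dist (A (u r) (v r) - A (u s) (v r)) 0 < e"
      proof eventually_elim
        case (elim r)
        have "norm (A (u r) (v r) - A (u s) (v r)) \<le> e' * norm (v r)" using \<delta>(2) elim by simp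
        also have "\<dots> < e' * (2 * (norm (v s) + 1))"
          using elim \<open>e' > 0\<close> norm_ge_zero[of "v s"] by (intro mult_strict_left_mono) argo+
        also have "\<dots> = e" using norm_ge_zero[of "v s"] by (simp add: e'_def add_nonneg_eq_0_iff)
        finally show ?case by simp
      qed
    qed
    moreover have "((\<lambda>r. A (u s) (v r)) \<longlongrightarrow> A (u s) (v s)) (at s)"
      using bounded_linear.tendsto[OF A_bounded_linear v] .
    ultimately show ?thesis
      using tendsto_add unfolding isCont_def by fastforce
  qed
  then show ?thesis by (simp add: continuous_on_eq_continuous_at)
qed

lemma continuous_on_L [continuous_intros]:
  fixes u :: "real \<Rightarrow> real"
  assumes "continuous_on UNIV u" "continuous_on UNIV v"
  shows "continuous_on UNIV (\<lambda>s. L (u s) (v s))"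
  unfolding L_def using assms
  by (intro continuous_intros continuous_on_compose2[OF continuous_on_f]
        continuous_on_compose2[OF continuous_on_x] continuous_on_compose2[OF continuous_on_ys]) auto

lemma continuous_on_rhs [continuous_intros]:
  fixes u :: "real \<Rightarrow> real"
  assumes "continuous_on UNIV u" "continuous_on UNIV v"
  shows "continuous_on UNIV (\<lambda>s. rhs (u s) (v s))"
  unfolding rhs_def using assms
  by (intro continuous_intros continuous_on_compose2[OF continuous_on_f]
        continuous_on_compose2[OF continuous_on_x] continuous_on_compose2[OF continuous_on_ys]) auto

lemma L_scaleR: "L s (c *\<^sub>R v) = c *\<^sub>R L s v"
  using linear_scale[OF bounded_linear.linear[OF A_bounded_linear]]
  by (simp add: L_def algebra_simps)

lemma L_diff: "L s (u - v) = L s u - L s v"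
  using linear_diff[OF bounded_linear.linear[OF A_bounded_linear]]
  by (simp add: L_def algebra_simps)

lemma L_bound: "norm (L s v) \<le> 2 * M * B * norm v"
proof -
  have "norm (L s v) \<le> B * norm v + (M * norm v) * B"
    unfolding L_def
  proof (intro norm_triangle_le_diff add_mono A_bound)
    show "norm ((ys s \<bullet> v) *\<^sub>R f (x s)) \<le> M * norm v * B"
      using Cauchy_Schwarz_ineq2[of "ys s" v] mult_right_mono[OF ys_bound[of s], of "norm v"] f_bound[of "x s"] M
      by (auto intro!: mult_mono)
  qed
  also have "\<dots> \<le> 2 * M * B * norm v"
    using mult_right_mono[OF M, of "B * norm v"] B by (simp add: algebra_simps)
  finally show ?thesis .
qed

lemma rhs_zero [simp]: "rhs s 0 = 0" by (simp add: rhs_def)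

lemma drift_le_half:
  assumes "\<bar>b\<bar> \<le> 1 / (32 * C * M * B)"
  shows "\<bar>b\<bar> \<le> 1 / 2"
proof -
  have "C * M * B \<ge> 1" using B M C by (simp add: mult_ge1_I)
  then have "1 / (32 * C * M * B) \<le> 1 / 2" by (simp add: field_simps)
  with assms show ?thesis by linarith
qed

text \<open>\<open>1 / (1 + b)\<close> is the speed of the inverse time change. The threshold
  \<open>1 / (32 * C * M * B)\<close> is matched to \<open>L_bound\<close>: twice the threshold
  times \<open>2 * M * B\<close> equals \<open>1 / (8 * C)\<close>, a small fraction of what the
  inverse bound \<open>C\<close> can absorb.\<close>

lemma speed_inverse_bounds:
  assumes b: "\<bar>b\<bar> \<le> 1 / (32 * C * M * B)"
  shows "0 \<le> 1 / (1 + b)" "1 / (1 + b) \<le> 2" "\<bar>1 / (1 + b) - 1\<bar> \<le> 2 * (1 / (32 * C * M * B))"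
proof -
  have half: "\<bar>b\<bar> \<le> 1 / 2" by (rule drift_le_half[OF b])
  then have pos: "1 + b > 0" by linarith
  then show nonneg: "0 \<le> 1 / (1 + b)" by simp
  show le2: "1 / (1 + b) \<le> 2" using pos half by (simp add: field_simps abs_le_iff)
  have "1 / (1 + b) - 1 = 1 / (1 + b) * (- b)" using pos by (simp add: field_simps)
  then have "\<bar>1 / (1 + b) - 1\<bar> = 1 / (1 + b) * \<bar>b\<bar>" using nonneg by (simp only: abs_mult abs_minus_cancel abs_of_nonneg)
  also have "\<dots> \<le> 2 * (1 / (32 * C * M * B))" using le2 b nonneg by (intro mult_mono) auto
  finally show "\<bar>1 / (1 + b) - 1\<bar> \<le> 2 * (1 / (32 * C * M * B))" .
qed

text \<open>The time change \<open>s = \<phi> t\<close> turns the equation along \<open>x \<circ> \<phi>\<close> into one along the orbit itself,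
  and the weight \<open>W\<close> adds \<open>w *\<^sub>R Z\<close>; both are small perturbations of the given linear equation.\<close>

lemma weighted_linear_estimate:
  fixes z r :: "real \<Rightarrow> 'a"
  assumes \<phi>: "\<And>t. (\<phi> has_real_derivative 1 + a t) (at t)"
    and a: "\<And>t. \<bar>a t\<bar> \<le> 1 / (32 * C * M * B)" "continuous_on UNIV a"
    and z: "\<And>t. (z has_vector_derivative L (\<phi> t) (z t) + r t) (at t)"
    and r: "continuous_on UNIV r"
    and W: "\<And>t. (W has_real_derivative w t * W t) (at t)" "\<And>t. W t > 0"
    and w: "\<And>t. \<bar>w t\<bar> \<le> 1 / (16 * C)" "continuous_on UNIV w"
    and N: "\<And>t. W t * norm (z t) \<le> N" and \<rho>: "\<And>t. W t * norm (r t) \<le> \<rho>"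
  shows "W t * norm (z t) \<le> N / 4 + 2 * C * \<rho>"
proof -
  have half: "\<bar>a t\<bar> \<le> 1 / 2" for t by (rule drift_le_half[OF a(1)])
  obtain \<theta> where \<theta>: "\<And>t. \<theta> (\<phi> t) = t" "\<And>s. \<phi> (\<theta> s) = s"
    "\<And>s. (\<theta> has_real_derivative 1 / (1 + a (\<theta> s))) (at s)"
    using C1_inverse_function[OF \<phi> half] by blast
  have cont\<theta>: "continuous_on S \<theta>" for S
    using \<theta>(3) by (auto intro: DERIV_isCont continuous_at_imp_continuous_on)
  have contW: "continuous_on S W" for S
    using W(1) by (auto intro: DERIV_isCont continuous_at_imp_continuous_on)
  have contz: "continuous_on S z" for S
    using z by (auto intro: has_vector_derivative_continuous continuous_at_imp_continuous_on)
  define \<sigma> where "\<sigma> s = 1 / (1 + a (\<theta> s))" for s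
  have pos: "1 + a (\<theta> s) > 0" for s using half[of "\<theta> s"] by linarith
  have cont\<sigma>: "continuous_on UNIV \<sigma>"
    unfolding \<sigma>_def using pos
    by (intro continuous_intros continuous_on_compose2[OF a(2)] cont\<theta>) (auto simp: less_imp_neq[symmetric])
  have \<sigma>: "0 \<le> \<sigma> s" "\<sigma> s \<le> 2" "\<bar>\<sigma> s - 1\<bar> \<le> 2 * (1 / (32 * C * M * B))" for s
    unfolding \<sigma>_def by (rule speed_inverse_bounds[OF a(1)])+
  define Z where "Z s = W (\<theta> s) *\<^sub>R z (\<theta> s)" for s
  define h where "h s = (\<sigma> s - 1) *\<^sub>R L s (Z s) + \<sigma> s *\<^sub>R (w (\<theta> s) *\<^sub>R Z s + W (\<theta> s) *\<^sub>R r (\<theta> s))" for s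
  have contZ: "continuous_on UNIV Z"
    unfolding Z_def by (intro continuous_intros continuous_on_compose2[OF contW]
        continuous_on_compose2[OF contz] cont\<theta>) auto
  have conth: "continuous_on UNIV h"
    unfolding h_def
    by (intro continuous_intros continuous_on_compose2[OF w(2)] continuous_on_compose2[OF contW]
        continuous_on_compose2[OF r] cont\<theta> contZ cont\<sigma>) auto
  have Zb: "norm (Z s) \<le> N" for s using N[of "\<theta> s"] W(2)[of "\<theta> s"] by (simp add: Z_def)
  then have "N \<ge> 0" using norm_ge_zero order_trans by blast
  \<comment> \<open>The time change and the weight contribute \<open>N / (8 * C)\<close> each; the
    final multiplication by \<open>C\<close> leaves \<open>N / 4\<close>. The factor 2 before \<rho>
    is the bound for \<sigma>.\<close>
  have hb: "norm (h s) \<le> N / (4 * C) + 2 * \<rho>" for s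
  proof -
    have "norm ((\<sigma> s - 1) *\<^sub>R L s (Z s)) \<le> (2 * (1 / (32 * C * M * B))) * (2 * M * B * N)"
    proof -
      have "norm (L s (Z s)) \<le> 2 * M * B * N"
        by (rule order_trans[OF L_bound mult_left_mono[OF Zb]]) (use M B in simp)
      then show ?thesis
        unfolding norm_scaleR using \<sigma>(3) C M B by (intro mult_mono) auto
    qed
    also have "\<dots> = N / (8 * C)" using M B C by (simp add: field_simps)
    finally have 1: "norm ((\<sigma> s - 1) *\<^sub>R L s (Z s)) \<le> N / (8 * C)" .
    have "norm (w (\<theta> s) *\<^sub>R Z s) \<le> 1 / (16 * C) * N"
      unfolding norm_scaleR using w(1) Zb C \<open>N \<ge> 0\<close> by (intro mult_mono) auto
    moreover have "norm (W (\<theta> s) *\<^sub>R r (\<theta> s)) \<le> \<rho>"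
      using \<rho>[of "\<theta> s"] W(2)[of "\<theta> s"] by simp
    ultimately have 2: "norm (w (\<theta> s) *\<^sub>R Z s + W (\<theta> s) *\<^sub>R r (\<theta> s)) \<le> 1 / (16 * C) * N + \<rho>"
      by (intro norm_triangle_le) linarith
    have "norm (\<sigma> s *\<^sub>R (w (\<theta> s) *\<^sub>R Z s + W (\<theta> s) *\<^sub>R r (\<theta> s))) \<le> 2 * (1 / (16 * C) * N + \<rho>)"
      unfolding norm_scaleR using \<sigma>(1,2)[of s] 2 by (intro mult_mono) auto
    with 1 have "norm (h s) \<le> N / (8 * C) + 2 * (1 / (16 * C) * N + \<rho>)"
      unfolding h_def by (intro norm_triangle_le) linarith
    then show ?thesis by (simp add: field_simps)
  qed
  have Z': "(Z has_vector_derivative A (x s) (Z s) - (ys s \<bullet> Z s) *\<^sub>R f (x s) + h s) (at s)" for s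
  proof -
    have "((\<lambda>t. W t *\<^sub>R z t) has_vector_derivative
        W (\<theta> s) *\<^sub>R (L (\<phi> (\<theta> s)) (z (\<theta> s)) + r (\<theta> s)) + (w (\<theta> s) * W (\<theta> s)) *\<^sub>R z (\<theta> s)) (at (\<theta> s))"
      by (rule has_vector_derivative_scaleR[OF W(1) z])
    from vector_diff_chain_at[OF \<theta>(3)[unfolded has_real_derivative_iff_has_vector_derivative] this]
    have "(Z has_vector_derivative \<sigma> s *\<^sub>R
        (W (\<theta> s) *\<^sub>R (L (\<phi> (\<theta> s)) (z (\<theta> s)) + r (\<theta> s)) + (w (\<theta> s) * W (\<theta> s)) *\<^sub>R z (\<theta> s))) (at s)"
      unfolding Z_def \<sigma>_def o_def .
    also have "\<sigma> s *\<^sub>R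
        (W (\<theta> s) *\<^sub>R (L (\<phi> (\<theta> s)) (z (\<theta> s)) + r (\<theta> s)) + (w (\<theta> s) * W (\<theta> s)) *\<^sub>R z (\<theta> s))
      = L s (Z s) + h s"
      by (simp add: \<theta>(2) h_def Z_def L_scaleR algebra_simps)
    finally show ?thesis by (simp add: L_def)
  qed
  have "norm (Z s) \<le> C * (N / (4 * C) + 2 * \<rho>)" for s
    by (rule linear_estimate[OF conth hb _ Z']) (use Zb in \<open>auto simp: bounded_iff\<close>)
  from this[of "\<phi> t"] show ?thesis
    using C W(2)[of t] by (simp add: Z_def \<theta>(1) distrib_left)
qed

end

section \<open>The nonlinear equation on a ball where the derivative of \<open>f\<close> varies
  little\<close>

locale hyperbolic_orbit_modulus = hyperbolic_orbit +
  fixes \<kappa> d :: real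
  assumes \<kappa>: "\<kappa> \<ge> 0" "\<kappa> \<le> 1 / (8 * C)" and d: "d > 0"
    and A_modulus: "\<And>y z v. norm (y - z) \<le> d \<Longrightarrow> norm (A y v - A z v) \<le> \<kappa> * norm v"
begin

lemma f_linearization:
  assumes "norm v \<le> d" "norm v' \<le> d"
  shows "norm (f (y + v) - f (y + v') - A y (v - v')) \<le> \<kappa> * norm (v - v')"
proof -
  have sub: "(y + v') + t *\<^sub>R (y + v - (y + v')) \<in> cball y d" if "t \<in> {0..1}" for t
  proof -
    have "(y + v') + t *\<^sub>R (y + v - (y + v')) = (1 - t) *\<^sub>R (y + v') + t *\<^sub>R (y + v)"
      by (simp add: algebra_simps)
    also have "\<dots> \<in> cball y d"
      using that assms by (intro convexD[OF convex_cball]) (auto simp: dist_norm)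
    finally show ?thesis .
  qed
  have "norm (f (y + v) - f (y + v') - A y (y + v - (y + v'))) \<le> norm (y + v - (y + v')) * \<kappa>"
  proof (rule differentiable_bound_linearization[where S = "cball y d" and f' = A and ?x0.0 = y])
    show "onorm (A z - A y) \<le> \<kappa>" if "z \<in> cball y d" for z
      using A_modulus[of z y] that \<kappa>(1)
      by (intro onorm_bound) (auto simp: dist_norm norm_minus_commute mult.commute
          fun_diff_def intro!: bounded_linear_sub A_bounded_linear)
  qed (use sub d in \<open>auto intro: has_derivative_at_withinI f_deriv\<close>)
  then show ?thesis by (simp add: mult.commute)
qed

text \<open>Changing the phase costs little because \<open>rhs\<close> vanishes at zero
  displacement. For the \<open>f\<close> part the phase derivative is
  \<open>A (x t + v') - A (x t)\<close> applied to the orbit velocity, hence of size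
  \<open>\<kappa> * B\<close>; the rank-one part carries the factor
  \<open>norm v' \<le> d\<close>.\<close>

lemma rhs_diff:
  assumes "norm v \<le> d" "norm v' \<le> d"
  shows "norm (rhs s v - rhs s' v' - L s (v - v'))
    \<le> \<kappa> * norm (v - v') + (\<kappa> * B + 2 * M * B\<^sup>2 * d) * \<bar>s - s'\<bar>"
proof -
  have 1: "norm (f (x s + v) - f (x s + v') - A (x s) (v - v')) \<le> \<kappa> * norm (v - v')"
    by (rule f_linearization[OF assms])
  define g where "g = (\<lambda>t. f (x t + v') - f (x t))"
  have "norm (g s - g s') \<le> \<kappa> * B * \<bar>s - s'\<bar>"
  proof (rule vector_derivative_Lipschitz)
    fix t
    have "((\<lambda>t. x t + v') has_vector_derivative f (x t)) (at t)"
      using orbit by (auto intro!: derivative_eq_intros)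
    from vector_derivative_diff_chain_within[OF this has_derivative_at_withinI[OF f_deriv]]
    have d1: "((\<lambda>t. f (x t + v')) has_vector_derivative A (x t + v') (f (x t))) (at t)"
      by (simp add: o_def)
    from vector_derivative_diff_chain_within[OF orbit has_derivative_at_withinI[OF f_deriv]]
    have d2: "((\<lambda>t. f (x t)) has_vector_derivative A (x t) (f (x t))) (at t)"
      by (simp add: o_def)
    show "(g has_vector_derivative A (x t + v') (f (x t)) - A (x t) (f (x t))) (at t)"
      unfolding g_def by (intro has_vector_derivative_diff d1 d2)
    show "norm (A (x t + v') (f (x t)) - A (x t) (f (x t))) \<le> \<kappa> * B"
      using A_modulus[of "x t + v'" "x t" "f (x t)"] assms(2) mult_left_mono[OF f_bound[of "x t"] \<kappa>(1)]
      by simp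
  qed
  then have 2: "norm (g s - g s') \<le> \<kappa> * B * \<bar>s - s'\<bar>" .
  have 3: "norm ((ys s \<bullet> v') *\<^sub>R f (x s) - (ys s' \<bullet> v') *\<^sub>R f (x s')) \<le> 2 * M * B\<^sup>2 * d * \<bar>s - s'\<bar>"
  proof -
    have "(ys s \<bullet> v') *\<^sub>R f (x s) - (ys s' \<bullet> v') *\<^sub>R f (x s')
        = ((ys s - ys s') \<bullet> v') *\<^sub>R f (x s) + (ys s' \<bullet> v') *\<^sub>R (f (x s) - f (x s'))"
      by (simp add: algebra_simps)
    also have "norm \<dots> \<le> (M * B * \<bar>s - s'\<bar> * d) * B + (M * d) * (B * (B * \<bar>s - s'\<bar>))"
      unfolding norm_scaleR
    proof (intro norm_triangle_le add_mono)
      have "\<bar>(ys s - ys s') \<bullet> v'\<bar> \<le> norm (ys s - ys s') * norm v'" by (rule Cauchy_Schwarz_ineq2)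
      also have "\<dots> \<le> (M * B * \<bar>s - s'\<bar>) * d"
        using ys_Lipschitz assms(2) M B by (intro mult_mono) auto
      finally show "norm (((ys s - ys s') \<bullet> v') *\<^sub>R f (x s)) \<le> (M * B * \<bar>s - s'\<bar> * d) * B"
        unfolding norm_scaleR using f_bound M B d by (intro mult_mono) auto
      have "\<bar>ys s' \<bullet> v'\<bar> \<le> norm (ys s') * norm v'" by (rule Cauchy_Schwarz_ineq2)
      also have "\<dots> \<le> M * d" using ys_bound assms(2) M by (intro mult_mono) auto
      finally have a: "\<bar>ys s' \<bullet> v'\<bar> \<le> M * d" .
      have "norm (f (x s) - f (x s')) \<le> B * (B * \<bar>s - s'\<bar>)"
        using order_trans[OF f_Lipschitz mult_left_mono[OF x_Lipschitz]] B by simp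
      with a show "norm ((ys s' \<bullet> v') *\<^sub>R (f (x s) - f (x s'))) \<le> (M * d) * (B * (B * \<bar>s - s'\<bar>))"
        unfolding norm_scaleR using M d by (intro mult_mono) auto
    qed
    finally show ?thesis by (simp add: power2_eq_square algebra_simps)
  qed
  have "rhs s v - rhs s' v' - L s (v - v') =
      (f (x s + v) - f (x s + v') - A (x s) (v - v')) + (g s - g s')
      - ((ys s \<bullet> v') *\<^sub>R f (x s) - (ys s' \<bullet> v') *\<^sub>R f (x s'))"
    by (simp add: rhs_def L_def g_def algebra_simps)
  also have "norm \<dots> \<le> \<kappa> * norm (v - v') + \<kappa> * B * \<bar>s - s'\<bar> + 2 * M * B\<^sup>2 * d * \<bar>s - s'\<bar>"
    by (intro norm_triangle_le_diff norm_triangle_le add_mono 1 2 3)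
  finally show ?thesis by (simp add: algebra_simps)
qed

lemma rhs_Lipschitz:
  assumes "norm v \<le> d" "norm v' \<le> d"
  shows "norm (rhs s v - rhs s v' - L s (v - v')) \<le> \<kappa> * norm (v - v')"
  using rhs_diff[OF assms, of s s] by simp

end

section \<open>Comparison and existence of displacements along a prescribed phase\<close>

context hyperbolic_orbit_modulus
begin

text \<open>The Lipschitz constant of \<open>rhs\<close> in the phase, on displacements of norm at
  most \<open>d\<close>. It tends to zero with \<kappa> and \<open>d\<close>, which makes the
  feedback of the phase on the displacement weak.\<close>

definition \<beta> where "\<beta> = \<kappa> * B + 2 * M * B\<^sup>2 * d"

lemma \<beta>_nonneg: "\<beta> \<ge> 0"
  using \<kappa>(1) B M d by (simp add: \<beta>_def)

text \<open>The difference solves the linear equation along \<phi> with a forcing that contains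
  \<kappa> times the difference itself. The linear estimate returns a quarter of the supremum and
  \<open>2 * C * \<kappa> \<le> 1 / 4\<close> another quarter, so one half is absorbed. The bound
  \<open>Wmax\<close> makes the supremum finite. Only \<phi> has to be a time change, since \<phi>'
  enters through the forcing alone.\<close>

lemma weighted_comparison:
  assumes \<phi>: "\<And>t. (\<phi> has_real_derivative 1 + a t) (at t)"
    and a: "\<And>t. \<bar>a t\<bar> \<le> 1 / (32 * C * M * B)" "continuous_on UNIV a"
    and \<phi>': "continuous_on UNIV \<phi>'"
    and v: "\<And>t. (v has_vector_derivative rhs (\<phi> t) (v t) + e t) (at t)" "\<And>t. norm (v t) \<le> d"
    and v': "\<And>t. (v' has_vector_derivative rhs (\<phi>' t) (v' t) + e' t) (at t)" "\<And>t. norm (v' t) \<le> d"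
    and e: "continuous_on UNIV e" "continuous_on UNIV e'"
    and W: "\<And>t. (W has_real_derivative w t * W t) (at t)" "\<And>t. W t > 0" "\<And>t. W t \<le> Wmax"
    and w: "\<And>t. \<bar>w t\<bar> \<le> 1 / (16 * C)" "continuous_on UNIV w"
    and N\<phi>: "\<And>t. W t * \<bar>\<phi> t - \<phi>' t\<bar> \<le> N\<phi>" and Ne: "\<And>t. W t * norm (e t - e' t) \<le> Ne"
  shows "W t * norm (v t - v' t) \<le> 4 * C * (\<beta> * N\<phi> + Ne)"
proof -
  define r where "r t = rhs (\<phi> t) (v t) - rhs (\<phi>' t) (v' t) - L (\<phi> t) (v t - v' t) + (e t - e' t)" for t
  have cont\<phi>: "continuous_on UNIV \<phi>"
    using \<phi> by (auto intro: DERIV_isCont continuous_at_imp_continuous_on)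
  have contv: "continuous_on UNIV v" "continuous_on UNIV v'"
    using v(1) v'(1) by (auto intro: has_vector_derivative_continuous continuous_at_imp_continuous_on)
  have contr: "continuous_on UNIV r"
    unfolding r_def by (intro continuous_intros cont\<phi> contv \<phi>' e)
  have "W t * norm (v t - v' t) \<le> 2 * (2 * C * (\<beta> * N\<phi> + Ne))"
  proof (rule bound_by_halving[where S = "\<lambda>t. W t * norm (v t - v' t)"])
    show "W t * norm (v t - v' t) \<le> Wmax * (d + d)" for t
      using W(2)[of t] W(3)[of t] norm_triangle_le_diff[OF add_mono[OF v(2)[of t] v'(2)[of t]]]
      by (intro mult_mono) auto
    fix N t assume N: "\<And>t. W t * norm (v t - v' t) \<le> N"
    have "N \<ge> 0" using order_trans[OF _ N[of 0]] W(2)[of 0] by simp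
    have Wr: "W t * norm (r t) \<le> \<kappa> * N + \<beta> * N\<phi> + Ne" for t
    proof -
      have "norm (r t) \<le> \<kappa> * norm (v t - v' t) + \<beta> * \<bar>\<phi> t - \<phi>' t\<bar> + norm (e t - e' t)"
        unfolding r_def \<beta>_def
        by (rule order_trans[OF norm_triangle_ineq]) (intro add_right_mono rhs_diff v v')
      then have "W t * norm (r t) \<le> W t * (\<kappa> * norm (v t - v' t) + \<beta> * \<bar>\<phi> t - \<phi>' t\<bar> + norm (e t - e' t))"
        using W(2)[of t] by (intro mult_left_mono) auto
      also have "\<dots> = \<kappa> * (W t * norm (v t - v' t)) + \<beta> * (W t * \<bar>\<phi> t - \<phi>' t\<bar>) + W t * norm (e t - e' t)"
        by (simp add: algebra_simps)
      also have "\<dots> \<le> \<kappa> * N + \<beta> * N\<phi> + Ne"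
        by (intro add_mono mult_left_mono N N\<phi> Ne \<kappa>(1) \<beta>_nonneg)
      finally show ?thesis .
    qed
    have "W t * norm (v t - v' t) \<le> N / 4 + 2 * C * (\<kappa> * N + \<beta> * N\<phi> + Ne)"
    proof (rule weighted_linear_estimate[OF \<phi> a _ contr W(1,2) w N Wr])
      show "((\<lambda>t. v t - v' t) has_vector_derivative L (\<phi> t) (v t - v' t) + r t) (at t)" for t
        using has_vector_derivative_diff[OF v(1) v'(1)] by (simp add: r_def algebra_simps)
    qed
    also have "\<dots> \<le> N / 2 + 2 * C * (\<beta> * N\<phi> + Ne)"
    proof -
      have "C * \<kappa> \<le> 1 / 8" using \<kappa>(2) C by (simp add: field_simps)
      from mult_right_mono[OF this \<open>N \<ge> 0\<close>] show ?thesis by (simp add: algebra_simps)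
    qed
    finally show "W t * norm (v t - v' t) \<le> N / 2 + 2 * C * (\<beta> * N\<phi> + Ne)" .
  qed
  then show ?thesis by simp
qed

text \<open>Comparison with the zero displacement along the same phase, with constant weight. It
  makes displacements as small as the force for all times, however they were constructed.\<close>

lemma forced_bound:
  assumes "\<And>t. (\<phi> has_real_derivative 1 + a t) (at t)"
    and "\<And>t. \<bar>a t\<bar> \<le> 1 / (32 * C * M * B)" "continuous_on UNIV a"
    and "\<And>t. (v has_vector_derivative rhs (\<phi> t) (v t) + e t) (at t)" "\<And>t. norm (v t) \<le> d"
    and "continuous_on UNIV e" and "\<And>t. norm (e t) \<le> E"
  shows "norm (v t) \<le> 4 * C * E"
proof -
  have "continuous_on UNIV \<phi>"
    using assms(1) by (auto intro: DERIV_isCont continuous_at_imp_continuous_on)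
  then have "1 * norm (v t - 0) \<le> 4 * C * (\<beta> * 0 + E)"
    using assms d C
    by (intro weighted_comparison[where \<phi> = \<phi> and \<phi>' = \<phi> and a = a and e = e and e' = "\<lambda>_. 0"
          and W = "\<lambda>_. 1" and w = "\<lambda>_. 0" and Wmax = 1 and v' = "\<lambda>_. 0"]) auto
  then show ?thesis by simp
qed

text \<open>The weight \<open>exp (\<alpha> (t - \<tau>))\<close> is unbounded; it is approximated by bounded weights
  \<open>1 / (exp (- \<alpha> (t - \<tau>)) + c)\<close>, \<open>c \<rightarrow> 0\<close>, which makes the comparison applicable.\<close>

lemma exponential_comparison:
  assumes \<phi>: "\<And>t. (\<phi> has_real_derivative 1 + a t) (at t)"
    and a: "\<And>t. \<bar>a t\<bar> \<le> 1 / (32 * C * M * B)" "continuous_on UNIV a"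
    and \<phi>': "continuous_on UNIV \<phi>'"
    and v: "\<And>t. (v has_vector_derivative rhs (\<phi> t) (v t) + e t) (at t)" "\<And>t. norm (v t) \<le> d"
    and v': "\<And>t. (v' has_vector_derivative rhs (\<phi>' t) (v' t) + e' t) (at t)" "\<And>t. norm (v' t) \<le> d"
    and e: "continuous_on UNIV e" "continuous_on UNIV e'"
    and \<alpha>: "0 < \<alpha>" "\<alpha> \<le> 1 / (16 * C)"
    and N\<phi>: "\<And>t. \<bar>\<phi> t - \<phi>' t\<bar> \<le> N\<phi> * exp (- \<alpha> * (t - \<tau>))"
    and Ne: "\<And>t. norm (e t - e' t) \<le> Ne * exp (- \<alpha> * (t - \<tau>))"
  shows "norm (v t - v' t) \<le> 4 * C * (\<beta> * N\<phi> + Ne) * exp (- \<alpha> * (t - \<tau>))"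
proof -
  define E where "E t = exp (- \<alpha> * (t - \<tau>))" for t
  define K where "K = 4 * C * (\<beta> * N\<phi> + Ne)"
  have E: "(E has_real_derivative - \<alpha> * E t) (at t)" "E t > 0" for t
    unfolding E_def by (auto intro!: derivative_eq_intros)
  have N0: "N\<phi> \<ge> 0" "Ne \<ge> 0"
    using order_trans[OF abs_ge_zero N\<phi>[of \<tau>]] order_trans[OF norm_ge_zero Ne[of \<tau>]] by auto
  have contE: "continuous_on UNIV E" unfolding E_def by (intro continuous_intros)
  have *: "norm (v t - v' t) \<le> K * (E t + c)" if "c > 0" for c
  proof -
    define W where "W t = 1 / (E t + c)" for t
    \<comment> \<open>The logarithmic derivative of \<open>W\<close>. It lies between 0 and \<alpha>
      for every \<open>c > 0\<close>, so neither the hypotheses nor the bound deteriorate as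
      \<open>c\<close> tends to zero.\<close>
    define w where "w t = \<alpha> * E t / (E t + c)" for t
    have pos: "E t + c > 0" for t using E(2)[of t] that by simp
    have "W t * norm (v t - v' t) \<le> K"
      unfolding K_def
    proof (rule weighted_comparison[OF \<phi> a \<phi>' v v' e])
      show "(W has_real_derivative w t * W t) (at t)" for t
        unfolding W_def w_def using pos[of t]
        by (auto intro!: derivative_eq_intros E(1) simp: power2_eq_square field_simps)
      show "W t > 0" for t using pos[of t] by (simp add: W_def)
      show "W t \<le> 1 / c" for t using that E(2)[of t] by (auto simp: W_def intro!: divide_left_mono mult_pos_pos)
      show "\<bar>w t\<bar> \<le> 1 / (16 * C)" for t
      proof -
        have "\<bar>w t\<bar> = \<alpha> * (E t / (E t + c))" using pos[of t] E(2)[of t] \<alpha>(1) by (simp add: w_def abs_mult)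
        also have "\<dots> \<le> \<alpha> * 1" using pos[of t] that \<alpha>(1) by (intro mult_left_mono) auto
        finally show ?thesis using \<alpha>(2) by simp
      qed
      show "continuous_on UNIV w"
        unfolding w_def using pos by (intro continuous_intros contE) (auto simp: less_imp_neq[symmetric])
      have WE: "W t * (N * E t) \<le> N" if "N \<ge> 0" for N t
      proof -
        have "W t * (N * E t) = N * (E t / (E t + c))" by (simp add: W_def)
        also have "\<dots> \<le> N * 1" using pos[of t] \<open>c > 0\<close> that by (intro mult_left_mono) auto
        finally show ?thesis by simp
      qed
      have Wpos: "W t \<ge> 0" for t using pos[of t] by (simp add: W_def)
      show "W t * \<bar>\<phi> t - \<phi>' t\<bar> \<le> N\<phi>" for t
        by (rule order_trans[OF mult_left_mono[OF N\<phi>[folded E_def] Wpos] WE[OF N0(1)]])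
      show "W t * norm (e t - e' t) \<le> Ne" for t
        by (rule order_trans[OF mult_left_mono[OF Ne[folded E_def] Wpos] WE[OF N0(2)]])
    qed
    then show ?thesis using pos[of t] by (simp add: W_def field_simps)
  qed
  have "norm (v t - v' t) \<le> K * E t"
  proof (rule tendsto_lowerbound)
    show "((\<lambda>c. K * (E t + c)) \<longlongrightarrow> K * E t) (at_right 0)"
      by (auto intro!: tendsto_eq_intros)
    show "\<forall>\<^sub>F c in at_right 0. norm (v t - v' t) \<le> K * (E t + c)"
      using * by (auto simp: eventually_at_right_field intro!: exI[of _ 1])
  qed simp
  then show ?thesis by (simp add: K_def E_def)
qed

text \<open>In the time \<open>s\<close> of the orbit, the equation is the given linear one with a forcing that is a contraction
  in the solution.\<close>

lemma forced_solution_exists: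
  assumes \<phi>: "\<And>t. (\<phi> has_real_derivative 1 + a t) (at t)"
    and a: "\<And>t. \<bar>a t\<bar> \<le> 1 / (32 * C * M * B)" "continuous_on UNIV a"
    and e: "continuous_on UNIV e" "\<And>t. norm (e t) \<le> E" and E: "4 * C * E \<le> d"
  shows "\<exists>v. (\<forall>t. (v has_vector_derivative rhs (\<phi> t) (v t) + e t) (at t)) \<and> (\<forall>t. norm (v t) \<le> d)"
proof -
  have half: "\<bar>a t\<bar> \<le> 1 / 2" for t by (rule drift_le_half[OF a(1)])
  obtain \<theta> where \<theta>: "\<And>t. \<theta> (\<phi> t) = t" "\<And>s. \<phi> (\<theta> s) = s"
    "\<And>s. (\<theta> has_real_derivative 1 / (1 + a (\<theta> s))) (at s)"
    using C1_inverse_function[OF \<phi> half] by blast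
  have cont\<theta>: "continuous_on S \<theta>" for S
    using \<theta>(3) by (auto intro: DERIV_isCont continuous_at_imp_continuous_on)
  define \<sigma> where "\<sigma> s = 1 / (1 + a (\<theta> s))" for s
  have pos: "1 + a (\<theta> s) > 0" for s using half[of "\<theta> s"] by linarith
  have cont\<sigma>: "continuous_on UNIV \<sigma>"
    unfolding \<sigma>_def using pos
    by (intro continuous_intros continuous_on_compose2[OF a(2)] cont\<theta>) (auto simp: less_imp_neq[symmetric])
  have \<sigma>: "0 \<le> \<sigma> s" "\<sigma> s \<le> 2" "\<bar>\<sigma> s - 1\<bar> \<le> 2 * (1 / (32 * C * M * B))" for s
    unfolding \<sigma>_def by (rule speed_inverse_bounds[OF a(1)])+
  \<comment> \<open>Chosen so that \<open>L s (V s) + h V s\<close> is \<open>\<sigma> s\<close>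
    times the full right-hand side: a fixed point of the linear solution operator solves the
    time-changed nonlinear equation.\<close>
  define h where "h V s = \<sigma> s *\<^sub>R (rhs s (V s) + e (\<theta> s)) - L s (V s)" for V s
  \<comment> \<open>The modulus contributes \<open>2 * \<kappa> \<le> 1 / (4 * C)\<close> and the
    time change \<open>1 / (8 * C)\<close>; after applying the inverse bound \<open>C\<close> the
    contraction factor is 3/8.\<close>
  have h_diff: "norm (h U s - h V s) \<le> 3 / (8 * C) * norm (U s - V s)"
    if "norm (U s) \<le> d" "norm (V s) \<le> d" for U V s
  proof -
    have "h U s - h V s = \<sigma> s *\<^sub>R (rhs s (U s) - rhs s (V s) - L s (U s - V s)) + (\<sigma> s - 1) *\<^sub>R L s (U s - V s)"
      by (simp add: h_def L_diff algebra_simps)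
    also have "norm \<dots> \<le> 2 * (\<kappa> * norm (U s - V s)) + 2 * (1 / (32 * C * M * B)) * (2 * M * B * norm (U s - V s))"
    proof (intro norm_triangle_le add_mono)
      show "norm (\<sigma> s *\<^sub>R (rhs s (U s) - rhs s (V s) - L s (U s - V s))) \<le> 2 * (\<kappa> * norm (U s - V s))"
        unfolding norm_scaleR using \<sigma>(1,2)[of s] rhs_Lipschitz[OF that] by (intro mult_mono) auto
      show "norm ((\<sigma> s - 1) *\<^sub>R L s (U s - V s))
          \<le> 2 * (1 / (32 * C * M * B)) * (2 * M * B * norm (U s - V s))"
        unfolding norm_scaleR by (rule mult_mono[OF \<sigma>(3) L_bound]) (use C M B in auto)
    qed
    also have "\<dots> \<le> 2 * (1 / (8 * C) * norm (U s - V s)) + 2 * (1 / (32 * C * M * B)) * (2 * M * B * norm (U s - V s))"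
      using \<kappa>(2) by (intro add_right_mono mult_left_mono mult_right_mono) auto
    also have "\<dots> = 3 / (8 * C) * norm (U s - V s)" using C M B by (simp add: field_simps)
    finally show ?thesis .
  qed
  have h_bound: "norm (h V s) \<le> 2 * E + 3 / (8 * C) * d" if "norm (V s) \<le> d" for V s
  proof -
    have "h V s = (h V s - h (\<lambda>_. 0) s) + \<sigma> s *\<^sub>R e (\<theta> s)" using L_diff[of s 0 0] by (simp add: h_def)
    also have "norm \<dots> \<le> 3 / (8 * C) * norm (V s - 0) + 2 * E"
      using h_diff[of V s "\<lambda>_. 0"] that d \<sigma>[of s] e(2)[of "\<theta> s"]
      by (intro norm_triangle_le add_mono) (auto simp: norm_scaleR intro!: mult_mono)
    also have "\<dots> \<le> 2 * E + 3 / (8 * C) * d"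
    proof -
      have "3 / (8 * C) * norm (V s - 0) \<le> 3 / (8 * C) * d" using that C by (intro mult_left_mono) auto
      then show ?thesis by linarith
    qed
    finally show ?thesis .
  qed
  have conth: "continuous_on UNIV (h V)" if "continuous_on UNIV V" for V
    unfolding h_def
    by (intro continuous_intros continuous_on_compose2[OF e(1)] cont\<theta> cont\<sigma> that) auto
  define X where "X = {V :: real \<Rightarrow>\<^sub>C 'a. \<forall>s. norm (V s) \<le> d}"
  have "\<exists>U :: real \<Rightarrow>\<^sub>C 'a. \<forall>s. (apply_bcontfun U has_vector_derivative L s (U s) + h V s) (at s)"
    if "V \<in> X" for V :: "real \<Rightarrow>\<^sub>C 'a"
  proof -
    have "\<exists>v. bounded (range v) \<and>
        (\<forall>t. (v has_vector_derivative A (x t) (v t) - (ys t \<bullet> v t) *\<^sub>R f (x t) + h V t) (at t))"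
      using that h_bound by (intro linear_solvable[OF conth]) (auto simp: X_def)
    then obtain v where v: "bounded (range v)" "\<And>t. (v has_vector_derivative L t (v t) + h V t) (at t)"
      by (auto simp: L_def)
    then have "v \<in> bcontfun"
      by (auto simp: bcontfun_def intro: has_vector_derivative_continuous continuous_at_imp_continuous_on)
    then obtain U where "v = apply_bcontfun U" by (rule bcontfunE)
    with v show ?thesis by auto
  qed
  then obtain T :: "(real \<Rightarrow>\<^sub>C 'a) \<Rightarrow> real \<Rightarrow>\<^sub>C 'a" where
    T: "\<And>V s. V \<in> X \<Longrightarrow> (apply_bcontfun (T V) has_vector_derivative L s (T V s) + h V s) (at s)"
    by metis
  have "\<exists>!V\<in>X. T V = V"
  proof (rule Banach_fix)
    have "X = PiC UNIV (\<lambda>_. cball 0 d)" by (auto simp: X_def mem_PiC_iff Pi_iff)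
    then have "closed X" by (auto intro: closed_PiC)
    then show "complete X" by (simp add: complete_eq_closed)
    show "X \<noteq> {}" using d by (auto simp: X_def intro!: exI[of _ 0])
    show "T ` X \<subseteq> X"
    proof safe
      fix V assume V: "V \<in> X"
      have "norm (T V s) \<le> C * (2 * E + 3 / (8 * C) * d)" for s
        by (rule linear_estimate[OF conth[of V] h_bound _ T[OF V, unfolded L_def]])
           (use V in \<open>auto simp: X_def\<close>)
      also have "C * (2 * E + 3 / (8 * C) * d) \<le> d"
        using E C d by (simp add: field_simps)
      finally show "T V \<in> X" by (simp add: X_def)
    qed
    show "dist (T U) (T V) \<le> 3 / 8 * dist U V" if UV: "U \<in> X" "V \<in> X" for U V
    proof (rule dist_bound)
      fix s
      have "norm (T U s - T V s) \<le> C * (3 / (8 * C) * dist U V)"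
      proof (rule linear_estimate[where v = "\<lambda>s. T U s - T V s" and h = "\<lambda>s. h U s - h V s"])
        show "continuous_on UNIV (\<lambda>s. h U s - h V s)" by (intro continuous_intros conth) auto
        show "norm (h U s - h V s) \<le> 3 / (8 * C) * dist U V" for s
          using UV C dist_bounded[of U s V]
          by (intro order_trans[OF h_diff] mult_left_mono) (auto simp: X_def dist_norm)
        show "bounded (range (\<lambda>s. T U s - T V s))"
          using bounded_apply_bcontfun[of "T U - T V"] by simp
        show "((\<lambda>s. T U s - T V s) has_vector_derivative A (x t) (T U t - T V t)
            - (ys t \<bullet> (T U t - T V t)) *\<^sub>R f (x t) + (h U t - h V t)) (at t)" for t
          unfolding L_def[symmetric] L_diff
          by (rule has_vector_derivative_eq_rhs[OF has_vector_derivative_diff[OF T[OF UV(1)] T[OF UV(2)]]]) simp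
      qed
      then show "dist (T U s) (T V s) \<le> 3 / 8 * dist U V" using C by (simp add: dist_norm)
    qed
  qed auto
  then obtain V where V: "V \<in> X" "T V = V" by blast
  have V': "(apply_bcontfun V has_vector_derivative \<sigma> s *\<^sub>R (rhs s (V s) + e (\<theta> s))) (at s)" for s
    using T[OF V(1), of s] by (simp add: V(2) h_def)
  define v where "v t = V (\<phi> t)" for t
  have "(v has_vector_derivative rhs (\<phi> t) (v t) + e t) (at t)" for t
  proof -
    have "(v has_vector_derivative (1 + a t) *\<^sub>R (\<sigma> (\<phi> t) *\<^sub>R (rhs (\<phi> t) (V (\<phi> t)) + e (\<theta> (\<phi> t))))) (at t)"
      using vector_diff_chain_at[OF \<phi>[unfolded has_real_derivative_iff_has_vector_derivative] V']
      unfolding v_def o_def .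
    moreover have "(1 + a t) * \<sigma> (\<phi> t) = 1" using pos[of "\<phi> t"] by (simp add: \<sigma>_def \<theta>(1))
    ultimately show ?thesis by (simp add: \<theta>(1) v_def)
  qed
  moreover have "norm (v t) \<le> d" for t using V(1) by (simp add: X_def v_def)
  ultimately show ?thesis by blast
qed

end

section \<open>Phases along a hyperbolic orbit\<close>

text \<open>Multiplying by \<open>exp t\<close> and integrating from \<open>s\<close> leaves the
  initial contribution \<open>exp (s - t) * K\<close>, which vanishes as \<open>s\<close> tends to
  -\<infinity>. Only the forcing survives.\<close>

lemma bounded_solution_bound:
  fixes u r :: "real \<Rightarrow> real"
  assumes u: "\<And>t. (u has_real_derivative - u t + r t) (at t)" "\<And>t. \<bar>u t\<bar> \<le> K"
    and r: "\<And>t. \<bar>r t\<bar> \<le> c"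
  shows "\<bar>u t\<bar> \<le> c"
proof -
  have *: "\<bar>u t\<bar> \<le> c + exp (s - t) * K" if "s \<le> t" for s
  proof -
    have "norm (exp t * u t - exp s * u s) \<le> c * exp t - c * exp s"
    proof (rule vector_derivative_majorant[OF that])
      show "((\<lambda>t. exp t * u t) has_vector_derivative exp t * r t) (at t)" for t
        unfolding has_real_derivative_iff_has_vector_derivative[symmetric]
        by (auto intro!: derivative_eq_intros u(1) simp: algebra_simps)
      show "((\<lambda>t. c * exp t) has_real_derivative c * exp t) (at t)" for t
        by (auto intro!: derivative_eq_intros)
      show "norm (exp t * r t) \<le> c * exp t" for t
        using r[of t] by (simp add: abs_mult mult.commute)
    qed
    moreover have "\<bar>exp s * u s\<bar> \<le> exp s * K" using u(2)[of s] by (simp add: abs_mult)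
    moreover have "c * exp s \<ge> 0" using order_trans[OF abs_ge_zero r] by simp
    ultimately have "\<bar>exp t * u t\<bar> \<le> c * exp t + exp s * K" unfolding real_norm_def by argo
    moreover have "exp t * exp (s - t) = exp s" by (simp add: exp_add[symmetric])
    then have "c * exp t + exp s * K = exp t * (c + exp (s - t) * K)" by (simp add: algebra_simps)
    ultimately have "exp t * \<bar>u t\<bar> \<le> exp t * (c + exp (s - t) * K)" by (simp add: abs_mult)
    then show ?thesis by simp
  qed
  have "\<bar>u t\<bar> \<le> c + 0 * K"
  proof (rule tendsto_lowerbound)
    have "((\<lambda>s. exp (s - t)) \<longlongrightarrow> 0) at_bot"
      by (rule filterlim_compose[OF exp_at_bot])
         (simp add: filterlim_at_bot eventually_at_bot_linorder, metis diff_le_eq)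
    then show "((\<lambda>s. c + exp (s - t) * K) \<longlongrightarrow> c + 0 * K) at_bot"
      by (intro tendsto_intros)
    show "\<forall>\<^sub>F s in at_bot. \<bar>u t\<bar> \<le> c + exp (s - t) * K"
      using * by (auto simp: eventually_at_bot_linorder)
  qed simp
  then show ?thesis by simp
qed

context hyperbolic_orbit
begin

text \<open>The deviation of the phase speed from 1, written for an arbitrary point \<open>y\<close>
  rather than a displacement, so that the phase equation can be solved along a given curve. For
  \<open>y = x s + v\<close> it is \<open>ys s \<bullet> v\<close>.\<close>

definition H where "H y s = ys s \<bullet> (y - x s)"

text \<open>The product of \<open>2 * exp (B + 1)\<close>, a Gronwall estimate over one time unit
  with tracking errors at both ends, and \<open>2 * M\<close> from
  \<open>orbit_injective\<close>.\<close>

definition speed_const where "speed_const = 4 * M * exp (B + 1)"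

text \<open>If \<open>s\<close> bounds the error of the phase speed, smoothing the phase gives a
  distance at most \<open>2 * B * s\<close>, and the subsequent phase correction, at most
  \<open>6 * M * B * s\<close>, moves the orbit point by at most
  \<open>6 * M * B\<^sup>2 * s\<close>; together at most
  \<open>8 * M * B\<^sup>2 * s\<close>.\<close>

definition tracking_const where "tracking_const = 8 * M * B\<^sup>2 * speed_const"

text \<open>By the normalization, the functional \<open>ys r\<close> reads off time along the orbit
  near \<open>r\<close>: its deviation from time has derivative
  \<open>ys r \<bullet> (f (x u) - f (x r))\<close>.\<close>

lemma phase_projection:
  assumes "\<bar>s - r\<bar> \<le> l" "\<bar>s' - r\<bar> \<le> l"
  shows "\<bar>ys r \<bullet> (x s - x s') - (s - s')\<bar> \<le> M * B\<^sup>2 * l * \<bar>s - s'\<bar>"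
proof -
  have "norm ((ys r \<bullet> x s - s) - (ys r \<bullet> x s' - s')) \<le> M * B\<^sup>2 * l * norm (s - s')"
  proof (rule field_differentiable_bound[OF convex_cball[of r l]])
    fix u assume u: "u \<in> cball r l"
    have "((\<lambda>u. ys r \<bullet> x u) has_real_derivative ys r \<bullet> f (x u)) (at u)"
      unfolding has_real_derivative_iff_has_vector_derivative
      using bounded_linear.has_vector_derivative[OF bounded_linear_inner_right orbit] .
    then show "((\<lambda>u. ys r \<bullet> x u - u) has_real_derivative ys r \<bullet> f (x u) - 1) (at u within cball r l)"
      by (auto intro!: derivative_eq_intros intro: has_field_derivative_at_within)
    have "ys r \<bullet> f (x u) - 1 = ys r \<bullet> (f (x u) - f (x r))"
      using ys_normal[of r] by (simp add: inner_diff_right)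
    also have "norm \<dots> \<le> norm (ys r) * norm (f (x u) - f (x r))"
      using Cauchy_Schwarz_ineq2 by simp
    also have "\<dots> \<le> M * (B * (B * l))"
    proof (rule mult_mono)
      have "norm (f (x u) - f (x r)) \<le> B * norm (x u - x r)" by (rule f_Lipschitz)
      also have "\<dots> \<le> B * (B * l)"
        using u B by (intro mult_left_mono order_trans[OF x_Lipschitz]) (auto simp: dist_real_def abs_minus_commute)
      finally show "norm (f (x u) - f (x r)) \<le> B * (B * l)" .
    qed (use ys_bound M in auto)
    finally show "norm (ys r \<bullet> f (x u) - 1) \<le> M * B\<^sup>2 * l" by (simp add: power2_eq_square mult_ac)
  qed (use assms in \<open>auto simp: dist_real_def abs_minus_commute\<close>)
  then show ?thesis by (simp add: inner_diff_right algebra_simps)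
qed

text \<open>A quantitative local inverse of the orbit map. It is confined to nearby phases because
  an orbit may be periodic or return close to itself.\<close>

lemma orbit_injective:
  assumes "\<bar>s - s'\<bar> \<le> 1 / (2 * M * B\<^sup>2)"
  shows "\<bar>s - s'\<bar> \<le> 2 * M * norm (x s - x s')"
proof -
  have "M * B\<^sup>2 * \<bar>s - s'\<bar> \<le> 1 / 2"
    using assms M B by (simp add: field_simps)
  then have "\<bar>ys s' \<bullet> (x s - x s') - (s - s')\<bar> \<le> 1 / 2 * \<bar>s - s'\<bar>"
    using phase_projection[of s s' "\<bar>s - s'\<bar>" s'] mult_right_mono[of "M * B\<^sup>2 * \<bar>s - s'\<bar>" "1/2" "\<bar>s - s'\<bar>"]
    by simp
  moreover have "\<bar>ys s' \<bullet> (x s - x s')\<bar> \<le> M * norm (x s - x s')"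
    using Cauchy_Schwarz_ineq2[of "ys s'" "x s - x s'"] mult_right_mono[OF ys_bound[of s'], of "norm (x s - x s')"]
    by simp
  ultimately show ?thesis by argo
qed

text \<open>The stability of the phase equation: \<open>H\<close> has slope -1 in the phase up to
  the variation of \<open>ys\<close> against the small vector \<open>y - x s\<close> and the
  curvature of the orbit.\<close>

lemma phase_rate_diff:
  "\<bar>H y s - H y s' + (s - s')\<bar> \<le> (M * B * norm (y - x s) + M * B\<^sup>2 * \<bar>s - s'\<bar>) * \<bar>s - s'\<bar>"
proof -
  have "H y s - H y s' + (s - s')
      = (ys s - ys s') \<bullet> (y - x s) - (ys s' \<bullet> (x s - x s') - (s - s'))"
    by (simp add: H_def inner_diff_left inner_diff_right)
  also have "\<bar>\<dots>\<bar> \<le> (M * B * \<bar>s - s'\<bar>) * norm (y - x s) + M * B\<^sup>2 * \<bar>s - s'\<bar> * \<bar>s - s'\<bar>"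
  proof -
    have "\<bar>(ys s - ys s') \<bullet> (y - x s)\<bar> \<le> (M * B * \<bar>s - s'\<bar>) * norm (y - x s)"
      using Cauchy_Schwarz_ineq2[of "ys s - ys s'" "y - x s"]
        mult_right_mono[OF ys_Lipschitz[of s s'], of "norm (y - x s)"] by simp
    with phase_projection[of s s' "\<bar>s - s'\<bar>" s'] show ?thesis by (simp only: abs_le_iff) argo
  qed
  finally show ?thesis by (simp add: algebra_simps)
qed

lemma H_Lipschitz: "\<bar>H y s - H y' s\<bar> \<le> M * norm (y - y')"
  using Cauchy_Schwarz_ineq2[of "ys s" "y - y'"] mult_right_mono[OF ys_bound[of s], of "norm (y - y')"]
  by (simp add: H_def inner_diff_right)

lemma H_bound: "\<bar>H y s\<bar> \<le> M * norm (y - x s)"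
  using Cauchy_Schwarz_ineq2[of "ys s" "y - x s"] mult_right_mono[OF ys_bound[of s], of "norm (y - x s)"]
  by (simp add: H_def)

lemma continuous_on_H:
  fixes u :: "real \<Rightarrow> real"
  assumes "continuous_on UNIV y" "continuous_on UNIV u"
  shows "continuous_on UNIV (\<lambda>t. H (y t) (u t))"
  unfolding H_def using assms
  by (intro continuous_intros continuous_on_compose2[OF continuous_on_x]
        continuous_on_compose2[OF continuous_on_ys]) auto

lemma speed_const_ge: "speed_const \<ge> 4"
  using mult_mono[of 1 M 1 "exp (B + 1)"] M B by (simp add: speed_const_def)

text \<open>Continuity of \<open>\<Phi>\<close> prevents it from jumping to a distant phase of the same orbit.\<close>

lemma tracking_speed:
  assumes y: "\<And>t. (y has_vector_derivative f (y t) + e t) (at t)" "\<And>t. norm (e t) \<le> \<epsilon>"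
    and \<Phi>: "continuous_on UNIV \<Phi>" "\<And>t. norm (y t - x (\<Phi> t)) \<le> \<delta>"
    and small: "speed_const * (\<delta> + \<epsilon>) < 1 / (2 * M * B\<^sup>2)" and h: "0 \<le> h" "h \<le> 1"
  shows "\<bar>\<Phi> (t + h) - \<Phi> t - h\<bar> \<le> speed_const * (\<delta> + \<epsilon>)"
proof (rule ccontr)
  assume neg: "\<not> \<bar>\<Phi> (t + h) - \<Phi> t - h\<bar> \<le> speed_const * (\<delta> + \<epsilon>)"
  have nonneg: "\<epsilon> \<ge> 0" "\<delta> \<ge> 0"
    using order_trans[OF norm_ge_zero y(2)] order_trans[OF norm_ge_zero \<Phi>(2)] by auto
  \<comment> \<open>\<open>y\<close> is compared with the unperturbed motion started at phase
    \<open>\<Phi> t\<close>; the tracking property at the final time then relates two points of the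
    same orbit.\<close>
  have sep: "norm (x (\<Phi> (t + u)) - x (\<Phi> t + u)) \<le> 2 * exp (B + 1) * (\<delta> + \<epsilon>)"
    if u: "0 \<le> u" "u \<le> 1" for u
  proof -
    have "norm (y (t + u) - x (\<Phi> t + u))
        \<le> exp ((B + 1) * (u - 0)) * (norm (y (t + 0) - x (\<Phi> t + 0)) + \<epsilon>)"
    proof (rule Gronwall_norm[OF u(1) _ nonneg(1)])
      show "((\<lambda>u. y (t + u) - x (\<Phi> t + u)) has_vector_derivative
          (f (y (t + u)) + e (t + u)) - f (x (\<Phi> t + u))) (at u)" for u
      proof (rule has_vector_derivative_diff)
        have d: "((\<lambda>u. c + u) has_vector_derivative 1) (at u)" for c :: real
          by (auto intro!: derivative_eq_intros)
        show "((\<lambda>u. y (t + u)) has_vector_derivative f (y (t + u)) + e (t + u)) (at u)"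
          using vector_diff_chain_at[OF d y(1)] by (simp add: o_def)
        show "((\<lambda>u. x (\<Phi> t + u)) has_vector_derivative f (x (\<Phi> t + u))) (at u)"
          using vector_diff_chain_at[OF d orbit] by (simp add: o_def)
      qed
      show "norm (f (y (t + u)) + e (t + u) - f (x (\<Phi> t + u))) \<le> B * norm (y (t + u) - x (\<Phi> t + u)) + \<epsilon>" for u
        using norm_triangle_le[OF add_mono[OF f_Lipschitz[of "y (t + u)" "x (\<Phi> t + u)"] y(2)[of "t + u"]]]
        by (simp add: algebra_simps)
    qed (use B in simp)
    also have "\<dots> \<le> exp (B + 1) * (\<delta> + \<epsilon>)"
    proof (rule mult_mono)
      show "exp ((B + 1) * (u - 0)) \<le> exp (B + 1)" using u B mult_left_le[of u "B + 1"] by simp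
    qed (use \<Phi>(2)[of t] nonneg in auto)
    finally have "norm (x (\<Phi> (t + u)) - x (\<Phi> t + u)) \<le> \<delta> + exp (B + 1) * (\<delta> + \<epsilon>)"
      by (rule norm_diff_triangle_le[OF \<Phi>(2)[unfolded norm_minus_commute[of "y _"]]])
    moreover have "1 * \<delta> \<le> exp (B + 1) * (\<delta> + \<epsilon>)"
      using B nonneg by (intro mult_mono) auto
    ultimately show ?thesis by argo
  qed
  define g where "g u = \<bar>\<Phi> (t + u) - \<Phi> t - u\<bar>" for u
  \<comment> \<open>The deviation \<open>g\<close> starts at 0 and is continuous, so it takes the
    value \<open>m\<close>. This value exceeds the claimed bound but still lies in the range of
    \<open>orbit_injective\<close>, which yields the contradiction.\<close>
  define m where "m = min (g h) (1 / (2 * M * B\<^sup>2))"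
  have m: "m > speed_const * (\<delta> + \<epsilon>)" using neg small by (simp add: m_def g_def)
  have "speed_const * (\<delta> + \<epsilon>) \<ge> 0" using speed_const_ge nonneg by simp
  with m have "m \<ge> 0" by simp
  have "continuous_on {0..h} g"
    unfolding g_def by (intro continuous_intros continuous_on_compose2[OF \<Phi>(1)]) auto
  moreover have "g 0 \<le> m" using \<open>m \<ge> 0\<close> by (simp add: g_def)
  moreover have "m \<le> g h" by (simp add: m_def)
  ultimately obtain u where u: "0 \<le> u" "u \<le> h" "g u = m" using IVT'[of g 0 m h] h by auto
  then have "\<bar>\<Phi> (t + u) - (\<Phi> t + u)\<bar> \<le> 1 / (2 * M * B\<^sup>2)" by (simp add: g_def m_def algebra_simps)
  from orbit_injective[OF this] have "m \<le> 2 * M * norm (x (\<Phi> (t + u)) - x (\<Phi> t + u))"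
    using u(3) by (simp add: g_def algebra_simps)
  also have "\<dots> \<le> 2 * M * (2 * exp (B + 1) * (\<delta> + \<epsilon>))"
    using sep u h M by (intro mult_left_mono) auto
  also have "\<dots> = speed_const * (\<delta> + \<epsilon>)" by (simp add: speed_const_def)
  finally show False using m by simp
qed

lemma smooth_phase:
  assumes \<Phi>: "continuous_on UNIV \<Phi>" and s: "\<And>t h. 0 \<le> h \<Longrightarrow> h \<le> 1 \<Longrightarrow> \<bar>\<Phi> (t + h) - \<Phi> t - h\<bar> \<le> s"
  shows "\<exists>\<phi> b :: real \<Rightarrow> real. (\<forall>t. (\<phi> has_real_derivative 1 + b t) (at t)) \<and> continuous_on UNIV b \<and>
    (\<forall>t. \<bar>b t\<bar> \<le> s) \<and> (\<forall>t. \<bar>\<phi> t - \<Phi> t\<bar> \<le> s)"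
proof -
  obtain P where P: "\<And>t. (P has_vector_derivative \<Phi> t) (at t)"
    using antiderivative_exists[OF \<Phi>] by blast
  then have P': "(P has_real_derivative \<Phi> t) (at t)" for t
    by (simp add: has_real_derivative_iff_has_vector_derivative)
  \<comment> \<open>The mean of \<Phi> over [t, t + 1]. A phase of unit speed exceeds its initial
    value by 1/2 on average there, hence the correction.\<close>
  define \<phi> where "\<phi> t = P (t + 1) - P t - 1 / 2" for t
  have "(\<phi> has_real_derivative 1 + (\<Phi> (t + 1) - \<Phi> t - 1)) (at t)" for t
    unfolding \<phi>_def by (auto intro!: derivative_eq_intros DERIV_chain2[OF P'] P')
  moreover have "continuous_on UNIV (\<lambda>t. \<Phi> (t + 1) - \<Phi> t - 1)"
    by (intro continuous_intros continuous_on_compose2[OF \<Phi>]) (auto intro: \<Phi>)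
  moreover have "\<bar>\<Phi> (t + 1) - \<Phi> t - 1\<bar> \<le> s" for t using s[of 1 t] by simp
  moreover have "\<bar>\<phi> t - \<Phi> t\<bar> \<le> s" for t
  proof -
    define k where "k u = P u - (u - t)\<^sup>2 / 2 - \<Phi> t * u" for u
    have "norm (k (t + 1) - k t) \<le> s * (t + 1) - s * t"
    proof (rule vector_derivative_majorant)
      show "(k has_vector_derivative \<Phi> u - (u - t) - \<Phi> t) (at u)" for u
        unfolding k_def has_real_derivative_iff_has_vector_derivative[symmetric]
        by (auto intro!: derivative_eq_intros P' simp: field_simps)
      show "((\<lambda>t. s * t) has_real_derivative s) (at u)" for u by (auto intro!: derivative_eq_intros)
      show "norm (\<Phi> u - (u - t) - \<Phi> t) \<le> s" if "t < u" "u < t + 1" for u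
        using s[of "u - t" t] that by (simp add: algebra_simps)
    qed simp
    also have "k (t + 1) - k t = \<phi> t - \<Phi> t" by (simp add: k_def \<phi>_def algebra_simps)
    finally show ?thesis by (simp add: algebra_simps)
  qed
  ultimately show ?thesis
    by (intro exI[of _ \<phi>] exI[of _ "\<lambda>t. \<Phi> (t + 1) - \<Phi> t - 1"]) simp
qed

text \<open>The given phase \<open>\<Phi>\<close> is only continuous. Averaging it over unit intervals gives a smooth phase, and the
  correction satisfies \<open>\<psi>' = - \<psi> + r\<close> with \<open>r\<close> a contraction in \<open>\<psi>\<close>.\<close>

lemma phase_exists:
  assumes y: "\<And>t. (y has_vector_derivative f (y t) + e t) (at t)" "\<And>t. norm (e t) \<le> \<epsilon>"
    and \<Phi>: "continuous_on UNIV \<Phi>" "\<And>t. norm (y t - x (\<Phi> t)) \<le> \<delta>"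
    and small: "tracking_const * (\<delta> + \<epsilon>) \<le> 1 / (12 * M * B\<^sup>2)"
  shows "\<exists>\<phi>. (\<forall>t. (\<phi> has_real_derivative 1 + H (y t) (\<phi> t)) (at t)) \<and>
    (\<forall>t. \<bar>\<phi> t - \<Phi> t\<bar> \<le> tracking_const * (\<delta> + \<epsilon>)) \<and> (\<forall>t. norm (y t - x (\<phi> t)) \<le> tracking_const * (\<delta> + \<epsilon>))"
proof -
  define s where "s = speed_const * (\<delta> + \<epsilon>)"
  define \<delta>' where "\<delta>' = \<delta> + B * s"
  \<comment> \<open>Twice the bound for the inhomogeneity at zero correction: with Lipschitz
    constant 1/2 the ball of radius \<open>c\<close> is mapped into itself.\<close>
  define c where "c = 2 * (s + M * \<delta>')"
  define p where "p = tracking_const * (\<delta> + \<epsilon>)"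
  have nonneg: "\<epsilon> \<ge> 0" "\<delta> \<ge> 0"
    using order_trans[OF norm_ge_zero y(2)] order_trans[OF norm_ge_zero \<Phi>(2)] by auto
  have MB: "M * B \<ge> 1" "B\<^sup>2 \<ge> 1" "M * B\<^sup>2 \<ge> 1" "B \<le> B\<^sup>2" "M \<le> M * B" "B \<le> M * B\<^sup>2" "M * B \<le> M * B\<^sup>2"
  proof -
    show "M * B \<ge> 1" "B\<^sup>2 \<ge> 1" using B M by (simp_all add: mult_ge1_I)
    show "M * B\<^sup>2 \<ge> 1" using B M by (simp add: mult_ge1_I)
    show "B \<le> B\<^sup>2" using B by (simp add: power2_eq_square)
    then show "M * B \<le> M * B\<^sup>2" using M by simp
    show "M \<le> M * B" using M B by simp
    show "B \<le> M * B\<^sup>2" using order_trans[OF \<open>B \<le> B\<^sup>2\<close>, of "M * B\<^sup>2"] mult_right_mono[OF M, of "B\<^sup>2"] by simp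
  qed
  have s: "s \<ge> 0" "\<delta> + \<epsilon> \<le> s" "p = 8 * (M * B\<^sup>2 * s)"
    using speed_const_ge nonneg mult_right_mono[of 1 speed_const "\<delta> + \<epsilon>"] by (auto simp: s_def p_def tracking_const_def)
  have "s \<le> B * s" "B * s \<le> M * B\<^sup>2 * s" "M * B * s \<le> M * B\<^sup>2 * s" "M * s \<le> M * B * s"
    using MB s(1) mult_right_mono[OF B, of s] by (auto intro!: mult_right_mono)
  then have \<delta>': "\<delta>' \<le> 2 * (B * s)" and c: "c \<le> 6 * (M * B * s)" and cs: "c + s \<le> p"
    and \<delta>c: "\<delta>' + B * c \<le> p" and sp: "s \<le> p" and \<delta>'0: "\<delta>' \<ge> 0" and c0: "c \<ge> 0" and cp: "c \<le> p"
  proof -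
    assume *: "s \<le> B * s" "B * s \<le> M * B\<^sup>2 * s" "M * B * s \<le> M * B\<^sup>2 * s" "M * s \<le> M * B * s"
    show 1: "\<delta>' \<le> 2 * (B * s)" using s nonneg * by (simp add: \<delta>'_def)
    then have "M * \<delta>' \<le> M * (2 * (B * s))" using M by (intro mult_left_mono) auto
    moreover have "s \<le> M * B * s" using MB(1) s(1) mult_right_mono[OF MB(1), of s] by simp
    ultimately show 2: "c \<le> 6 * (M * B * s)" by (simp add: c_def algebra_simps)
    show "\<delta>' \<ge> 0" using nonneg s B by (simp add: \<delta>'_def)
    then show "c \<ge> 0" using s M by (simp add: c_def)
    show "c + s \<le> p" "s \<le> p" "c \<le> p" using 2 * s s(1) by auto
    have "B * c \<le> B * (6 * (M * B * s))" using 2 B by (intro mult_left_mono) auto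
    then have "B * c \<le> 6 * (M * B\<^sup>2 * s)" by (simp add: power2_eq_square algebra_simps)
    with 1 * s(3) show "\<delta>' + B * c \<le> p" by linarith
  qed
  have p: "M * B\<^sup>2 * p \<le> 1 / 12" using small MB(3) M B by (simp add: p_def field_simps)
  have "p < 1 / (2 * M * B\<^sup>2)"
  proof -
    have "p \<le> 1 / (12 * M * B\<^sup>2)" using small by (simp add: p_def)
    also have "\<dots> < 1 / (2 * M * B\<^sup>2)" using M B by (intro divide_strict_left_mono) auto
    finally show ?thesis .
  qed
  then have "speed_const * (\<delta> + \<epsilon>) < 1 / (2 * M * B\<^sup>2)" using sp by (simp add: s_def)
  from smooth_phase[OF \<Phi>(1) tracking_speed[OF y \<Phi> this]]
  obtain \<phi>0 b where \<phi>0: "\<And>t. (\<phi>0 has_real_derivative 1 + b t) (at t)" "continuous_on UNIV b"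
    "\<And>t. \<bar>b t\<bar> \<le> s" "\<And>t. \<bar>\<phi>0 t - \<Phi> t\<bar> \<le> s"
    unfolding s_def by blast
  have cont0: "continuous_on S \<phi>0" for S
    using \<phi>0(1) by (auto intro: DERIV_isCont continuous_at_imp_continuous_on)
  have conty: "continuous_on S y" for S
    using y(1) by (auto intro: has_vector_derivative_continuous continuous_at_imp_continuous_on)
  have y0: "norm (y t - x (\<phi>0 t)) \<le> \<delta>'" for t
  proof -
    have "norm (x (\<Phi> t) - x (\<phi>0 t)) \<le> B * s"
      using order_trans[OF x_Lipschitz mult_left_mono[OF \<phi>0(4)[of t]]] B
      by (simp add: abs_minus_commute norm_minus_commute)
    then show ?thesis
      unfolding \<delta>'_def by (rule norm_diff_triangle_le[OF \<Phi>(2)])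
  qed
  have y1: "norm (y t - x (\<phi>0 t + v)) \<le> \<delta>' + B * c" if "\<bar>v\<bar> \<le> c" for t v
  proof -
    have "norm (x (\<phi>0 t) - x (\<phi>0 t + v)) \<le> B * c"
    proof -
      have "B * \<bar>v\<bar> \<le> B * c" using that B by (intro mult_left_mono) auto
      then show ?thesis using x_Lipschitz[of "\<phi>0 t" "\<phi>0 t + v"] by simp
    qed
    then show ?thesis by (rule norm_diff_triangle_le[OF y0])
  qed
  \<comment> \<open>\<open>V' = - V + r V\<close> is the phase equation for
    \<open>\<phi>0 + V\<close>. The summand \<open>v\<close> compensates the slope -1 of
    \<open>H\<close>, which is what leaves \<open>r\<close> with Lipschitz constant 1/2.\<close>
  define r where "r v t = v - b t + H (y t) (\<phi>0 t + v)" for v t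
  have r_diff: "\<bar>r v t - r v' t\<bar> \<le> 1 / 2 * \<bar>v - v'\<bar>" if "\<bar>v\<bar> \<le> c" "\<bar>v'\<bar> \<le> c" for v v' t
  proof -
    have "\<bar>r v t - r v' t\<bar> \<le> (M * B * norm (y t - x (\<phi>0 t + v)) + M * B\<^sup>2 * \<bar>v - v'\<bar>) * \<bar>v - v'\<bar>"
      using phase_rate_diff[of "y t" "\<phi>0 t + v" "\<phi>0 t + v'"] by (simp add: r_def algebra_simps)
    also have "\<dots> \<le> (M * B\<^sup>2 * p + M * B\<^sup>2 * (2 * p)) * \<bar>v - v'\<bar>"
      using y1[OF that(1), of t] \<delta>c MB that cp M
      by (intro mult_right_mono add_mono mult_mono) auto
    also have "\<dots> \<le> 1 / 2 * \<bar>v - v'\<bar>"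
    proof (rule mult_right_mono)
      have "M * B\<^sup>2 * p + M * B\<^sup>2 * (2 * p) = 3 * (M * B\<^sup>2 * p)" by simp
      then show "M * B\<^sup>2 * p + M * B\<^sup>2 * (2 * p) \<le> 1 / 2" using p by linarith
    qed simp
    finally show ?thesis .
  qed
  have r_bound: "\<bar>r v t\<bar> \<le> c" if "\<bar>v\<bar> \<le> c" for v t
  proof -
    have "\<bar>r v t - r 0 t\<bar> \<le> c / 2" using r_diff[OF that, of 0 t] c0 that by simp
    moreover have "\<bar>r 0 t\<bar> \<le> s + M * \<delta>'"
    proof -
      have "M * norm (y t - x (\<phi>0 t)) \<le> M * \<delta>'" using y0[of t] M by (intro mult_left_mono) auto
      then show ?thesis
        using \<phi>0(3)[of t] H_bound[of "y t" "\<phi>0 t"] by (simp add: r_def)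
    qed
    ultimately show ?thesis unfolding c_def by argo
  qed
  define X where "X = {V :: real \<Rightarrow>\<^sub>C real. \<forall>t. \<bar>V t\<bar> \<le> c}"
  have contr: "continuous_on UNIV (\<lambda>t. r (V t) t)" for V :: "real \<Rightarrow>\<^sub>C real"
    unfolding r_def by (intro continuous_intros continuous_on_H conty cont0 \<phi>0(2)) auto
  have "\<exists>U :: real \<Rightarrow>\<^sub>C real. (\<forall>t. (apply_bcontfun U has_real_derivative - U t + r (V t) t) (at t)) \<and> (\<forall>t. \<bar>U t\<bar> \<le> c)"
    if "V \<in> X" for V :: "real \<Rightarrow>\<^sub>C real"
  proof -
    have "\<exists>u. (\<forall>t. (u has_real_derivative - u t + r (V t) t) (at t)) \<and> (\<forall>t. \<bar>u t\<bar> \<le> c)"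
      using that by (intro bounded_solution_of_stable_equation[OF contr] r_bound) (auto simp: X_def)
    then obtain u where u: "\<And>t. (u has_real_derivative - u t + r (V t) t) (at t)" "\<And>t. \<bar>u t\<bar> \<le> c" by blast
    then have "u \<in> bcontfun"
      by (intro bcontfun_normI[of u c]) (auto intro: DERIV_isCont continuous_at_imp_continuous_on)
    then obtain U where "u = apply_bcontfun U" by (rule bcontfunE)
    with u show ?thesis by auto
  qed
  then obtain T :: "(real \<Rightarrow>\<^sub>C real) \<Rightarrow> real \<Rightarrow>\<^sub>C real" where
    T: "\<And>V t. V \<in> X \<Longrightarrow> (apply_bcontfun (T V) has_real_derivative - T V t + r (V t) t) (at t)"
      "\<And>V t. V \<in> X \<Longrightarrow> \<bar>T V t\<bar> \<le> c"
    by metis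
  have "\<exists>!V\<in>X. T V = V"
  proof (rule Banach_fix)
    have "X = PiC UNIV (\<lambda>_. cball 0 c)" by (auto simp: X_def mem_PiC_iff Pi_iff)
    then have "closed X" by (auto intro: closed_PiC)
    then show "complete X" by (simp add: complete_eq_closed)
    show "X \<noteq> {}" using c0 by (auto simp: X_def intro!: exI[of _ 0])
    show "T ` X \<subseteq> X" using T(2) by (auto simp: X_def)
    show "dist (T U) (T V) \<le> 1 / 2 * dist U V" if UV: "U \<in> X" "V \<in> X" for U V
    proof (rule dist_bound)
      fix t
      have "\<bar>T U t - T V t\<bar> \<le> 1 / 2 * dist U V"
      proof (rule bounded_solution_bound[where u = "\<lambda>t. T U t - T V t" and r = "\<lambda>t. r (U t) t - r (V t) t" and K = "c + c"])
        show "((\<lambda>t. T U t - T V t) has_real_derivative - (T U t - T V t) + (r (U t) t - r (V t) t)) (at t)" for t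
          by (rule DERIV_cong[OF DERIV_diff[OF T(1)[OF UV(1)] T(1)[OF UV(2)]]]) simp
        show "\<bar>T U t - T V t\<bar> \<le> c + c" for t
          using T(2)[OF UV(1), of t] T(2)[OF UV(2), of t] by argo
        show "\<bar>r (U t) t - r (V t) t\<bar> \<le> 1 / 2 * dist U V" for t
          using UV dist_bounded[of U t V]
          by (intro order_trans[OF r_diff] mult_left_mono) (auto simp: X_def dist_real_def)
      qed
      then show "dist (T U t) (T V t) \<le> 1 / 2 * dist U V" by (simp add: dist_real_def)
    qed
  qed auto
  then obtain V where V: "V \<in> X" "T V = V" by blast
  define \<phi> where "\<phi> t = \<phi>0 t + V t" for t
  have Vc: "\<bar>V t\<bar> \<le> c" for t using V(1) by (simp add: X_def)
  have "(\<phi> has_real_derivative 1 + H (y t) (\<phi> t)) (at t)" for t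
    unfolding \<phi>_def using DERIV_add[OF \<phi>0(1)[of t] T(1)[OF V(1), of t]] by (simp add: V(2) r_def)
  moreover have "\<bar>\<phi> t - \<Phi> t\<bar> \<le> p" for t
    using Vc[of t] \<phi>0(4)[of t] cs by (simp add: \<phi>_def)
  moreover have "norm (y t - x (\<phi> t)) \<le> p" for t
    using y1[OF Vc] \<delta>c unfolding \<phi>_def by (rule order_trans)
  ultimately show ?thesis unfolding p_def by blast
qed

text \<open>Within the distance \<open>l\<close> the slope of \<open>H\<close> in the phase is at
  most -1/2, so the phase difference is a stable quantity driven by the difference of the two
  curves. It inherits their decay because \<alpha> is well below that rate.\<close>

lemma phase_decay:
  assumes \<phi>: "\<And>t. (\<phi> has_real_derivative 1 + H (y t) (\<phi> t)) (at t)"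
    and \<phi>': "\<And>t. (\<phi>' has_real_derivative 1 + H (y' t) (\<phi>' t)) (at t)"
    and p: "\<And>t. norm (y t - x (\<phi> t)) \<le> p" and l: "\<And>t. t \<ge> T \<Longrightarrow> \<bar>\<phi> t - \<phi>' t\<bar> \<le> l"
    and small: "M * B * p + M * B\<^sup>2 * l \<le> 1 / 2"
    and y: "\<And>t. t \<ge> T \<Longrightarrow> norm (y t - y' t) \<le> c * exp (- \<alpha> * (t - T))"
    and \<alpha>: "\<alpha> \<le> 1 / 16" and "t \<ge> T"
  shows "\<bar>\<phi> t - \<phi>' t\<bar> \<le> (l + 4 * M * c) * exp (- \<alpha> * (t - T))"
proof -
  define D where "D t = \<phi> t - \<phi>' t" for t
  define D' where "D' t = H (y t) (\<phi> t) - H (y' t) (\<phi>' t)" for t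
  have D: "(D has_real_derivative D' t) (at t)" for t
    unfolding D_def D'_def by (rule DERIV_cong[OF DERIV_diff[OF \<phi> \<phi>']]) simp
  define q where "q t = exp (\<alpha> * (t - T)) * D t" for t
  have q: "(q has_real_derivative exp (\<alpha> * (t - T)) * (\<alpha> * D t + D' t)) (at t)" for t
    unfolding q_def by (auto intro!: derivative_eq_intros D simp: algebra_simps)
  \<comment> \<open>From \<open>T\<close> on, the derivative of \<open>(q t)\<^sup>2\<close> is at
    most \<open>- (5 / 8) * (q t)\<^sup>2 + 4 * (M * c)\<^sup>2\<close>. With a quarter of the decay
    used for the exponential, the level \<open>16 * (M * c)\<^sup>2\<close> balances the driving
    term and \<open>k\<close> is nonincreasing.\<close>
  define k where "k t = exp ((t - T) / 4) * ((q t)\<^sup>2 - 16 * (M * c)\<^sup>2)" for t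
  have k: "(k has_real_derivative exp ((t - T) / 4) *
      (2 * q t * (exp (\<alpha> * (t - T)) * (\<alpha> * D t + D' t)) + ((q t)\<^sup>2 - 16 * (M * c)\<^sup>2) / 4)) (at t)" for t
    unfolding k_def by (auto intro!: derivative_eq_intros q simp: field_simps)
  have c0: "c \<ge> 0" using order_trans[OF norm_ge_zero y[of T]] by simp
  have l0: "l \<ge> 0" using order_trans[OF abs_ge_zero l[of T]] by simp
  have "2 * q s * (exp (\<alpha> * (s - T)) * (\<alpha> * D s + D' s)) + ((q s)\<^sup>2 - 16 * (M * c)\<^sup>2) / 4 \<le> 0"
    if "T \<le> s" for s
  proof -
    define w where "w = exp (\<alpha> * (s - T))"
    have "w > 0" by (simp add: w_def)
    define err where "err = D' s + D s"
    have "\<bar>err\<bar> \<le> 1 / 2 * \<bar>D s\<bar> + M * norm (y s - y' s)"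
    proof -
      have "\<bar>H (y s) (\<phi> s) - H (y s) (\<phi>' s) + D s\<bar> \<le> 1 / 2 * \<bar>D s\<bar>"
      proof -
        have "\<bar>H (y s) (\<phi> s) - H (y s) (\<phi>' s) + D s\<bar>
            \<le> (M * B * norm (y s - x (\<phi> s)) + M * B\<^sup>2 * \<bar>D s\<bar>) * \<bar>D s\<bar>"
          using phase_rate_diff unfolding D_def .
        also have "\<dots> \<le> (M * B * p + M * B\<^sup>2 * l) * \<bar>D s\<bar>"
          using p[of s] l[OF that] M B unfolding D_def
          by (intro mult_right_mono add_mono mult_left_mono) auto
        also have "\<dots> \<le> 1 / 2 * \<bar>D s\<bar>" using small by (intro mult_right_mono) auto
        finally show ?thesis .
      qed
      then show ?thesis using H_Lipschitz[of "y s" "\<phi>' s" "y' s"] unfolding err_def D'_def by argo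
    qed
    also have "\<dots> \<le> 1 / 2 * \<bar>D s\<bar> + M * (c * exp (- \<alpha> * (s - T)))"
      using y[OF that] M by (intro add_left_mono mult_left_mono) auto
    finally have "w * \<bar>err\<bar> \<le> w * (1 / 2 * \<bar>D s\<bar> + M * (c * exp (- \<alpha> * (s - T))))"
      using \<open>w > 0\<close> by (intro mult_left_mono) auto
    also have "\<dots> = 1 / 2 * \<bar>q s\<bar> + M * c"
    proof -
      have "w * exp (- \<alpha> * (s - T)) = 1" by (simp add: w_def exp_add[symmetric])
      then have "w * (M * (c * exp (- \<alpha> * (s - T)))) = M * c" by (metis mult.assoc mult.commute mult_1)
      then show ?thesis by (simp add: distrib_left q_def abs_mult w_def)
    qed
    finally have err: "w * \<bar>err\<bar> \<le> 1 / 2 * \<bar>q s\<bar> + M * c" .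
    have "q s * (w * err) \<le> \<bar>q s\<bar> * (1 / 2 * \<bar>q s\<bar> + M * c)"
    proof -
      have "q s * (w * err) \<le> \<bar>q s\<bar> * (w * \<bar>err\<bar>)"
        using abs_ge_self[of "q s * (w * err)"] \<open>w > 0\<close> by (simp add: abs_mult)
      also have "\<dots> \<le> \<bar>q s\<bar> * (1 / 2 * \<bar>q s\<bar> + M * c)" using err by (intro mult_left_mono) auto
      finally show ?thesis .
    qed
    also have "\<dots> = (q s)\<^sup>2 / 2 + \<bar>q s\<bar> * (M * c)" by (simp add: algebra_simps power2_eq_square flip: abs_mult)
    finally have 1: "q s * (w * err) \<le> (q s)\<^sup>2 / 2 + \<bar>q s\<bar> * (M * c)" .
    have 2: "2 * \<bar>q s\<bar> * (M * c) \<le> (q s)\<^sup>2 / 4 + 4 * (M * c)\<^sup>2"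
      using sum_squares_bound[of "\<bar>q s\<bar> / 2" "2 * (M * c)"] by (simp add: power2_eq_square)
    have 3: "\<alpha> * (q s)\<^sup>2 \<le> 1 / 16 * (q s)\<^sup>2" using \<alpha> by (intro mult_right_mono) auto
    have "2 * q s * (w * (\<alpha> * D s + D' s)) = 2 * (\<alpha> * (q s)\<^sup>2) - 2 * (q s)\<^sup>2 + 2 * (q s * (w * err))"
      by (simp add: err_def q_def w_def algebra_simps power2_eq_square)
    moreover have "((q s)\<^sup>2 - 16 * (M * c)\<^sup>2) / 4 = (q s)\<^sup>2 / 4 - 4 * (M * c)\<^sup>2"
      by (simp add: diff_divide_distrib)
    moreover have "2 * \<bar>q s\<bar> * (M * c) = 2 * (\<bar>q s\<bar> * (M * c))" by simp
    ultimately show ?thesis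
      using 1 2 3 zero_le_power2[of "q s"] unfolding w_def[symmetric] by linarith
  qed
  then have neg: "exp ((s - T) / 4) *
      (2 * q s * (exp (\<alpha> * (s - T)) * (\<alpha> * D s + D' s)) + ((q s)\<^sup>2 - 16 * (M * c)\<^sup>2) / 4) \<le> 0"
    if "T \<le> s" for s
    using that by (intro mult_nonneg_nonpos) auto
  have "k t \<le> k T"
    by (rule DERIV_nonpos_imp_nonincreasing[OF \<open>t \<ge> T\<close>]) (use k neg in blast)
  also have "k T = (D T)\<^sup>2 - 16 * (M * c)\<^sup>2" by (simp add: k_def q_def)
  also have "\<dots> \<le> (D T)\<^sup>2" by simp
  also have "(D T)\<^sup>2 \<le> l\<^sup>2"
    using l[of T] l0 by (simp add: D_def abs_le_square_iff[symmetric])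
  finally have "(q t)\<^sup>2 - 16 * (M * c)\<^sup>2 \<le> l\<^sup>2 / exp ((t - T) / 4)"
    by (simp add: k_def field_simps)
  also have "\<dots> \<le> l\<^sup>2" using \<open>t \<ge> T\<close> by (simp add: divide_le_eq mult_le_cancel_left1)
  finally have "(q t)\<^sup>2 \<le> l\<^sup>2 + (4 * M * c)\<^sup>2" by (simp add: power_mult_distrib)
  also have "\<dots> \<le> (l + 4 * M * c)\<^sup>2" using l0 c0 M by (simp add: power2_sum)
  finally have "\<bar>q t\<bar> \<le> l + 4 * M * c"
    using l0 c0 M by (simp add: abs_le_square_iff[symmetric])
  moreover have "D t = q t * exp (- \<alpha> * (t - T))"
    by (simp add: q_def mult.assoc[symmetric] mult.commute[of _ "D t"])
       (simp add: mult.assoc exp_add[symmetric])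
  then have "\<bar>D t\<bar> = \<bar>q t\<bar> * exp (- \<alpha> * (t - T))" by (simp add: abs_mult)
  ultimately show ?thesis by (simp add: D_def[symmetric])
qed

end

section \<open>The lattice of hyperbolic orbits\<close>

lemma apply_Bcontfun_int:
  fixes u :: "int \<Rightarrow> 'a::real_normed_vector"
  assumes "\<And>k. norm (u k) \<le> c"
  shows "apply_bcontfun (Bcontfun u) k = u k"
  by (subst Bcontfun_inverse) (use assms in \<open>auto simp: bcontfun_def bounded_iff\<close>)

lemma bounded_linear_apply_bcontfun:
  "bounded_linear (\<lambda>u :: 'i::topological_space \<Rightarrow>\<^sub>C 'a::real_normed_vector. apply_bcontfun u k)"
  by (rule bounded_linear_intro[of _ 1]) (auto simp: norm_bounded)

lemma continuous_on_apply_linf: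
  "continuous_on S u \<Longrightarrow> continuous_on S (\<lambda>t. apply_bcontfun (u t) (k::'i::topological_space) :: 'a::real_normed_vector)"
  using bounded_linear.continuous_on[OF bounded_linear_apply_bcontfun] .

lemma linf_Lipschitz_continuous_on:
  fixes u :: "real \<Rightarrow> 'a::real_normed_vector linf"
  assumes "\<And>k s t. norm (u s k - u t k) \<le> D * \<bar>s - t\<bar>"
  shows "continuous_on S u"
proof (rule Lipschitz_imp_continuous_on)
  show "norm (u s - u t) \<le> D * norm (s - t)" for s t
    by (rule norm_bound) (use assms in simp)
qed

text \<open>Coordinatewise derivatives alone do not give one in the sup norm. Norm continuity of
  \<open>w\<close> makes the linearization errors uniform in the coordinate, by the mean value
  inequality.\<close>

lemma linf_has_vector_derivative:
  fixes u w :: "real \<Rightarrow> 'a::real_normed_vector linf"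
  assumes u: "\<And>k t. ((\<lambda>t. apply_bcontfun (u t) k) has_vector_derivative apply_bcontfun (w t) k) (at t)"
    and w: "continuous_on UNIV w"
  shows "(u has_vector_derivative w t) (at t)"
  unfolding has_vector_derivative_def has_derivative_at_alt
proof (intro conjI allI impI)
  show "bounded_linear (\<lambda>h. h *\<^sub>R w t)" by (rule bounded_linear_scaleR_left)
  fix e :: real assume "e > 0"
  have "isCont w t" using w by (simp add: continuous_on_eq_continuous_at)
  then obtain \<delta> where \<delta>: "\<delta> > 0" "\<And>s. norm (s - t) < \<delta> \<Longrightarrow> norm (w s - w t) < e"
    using \<open>e > 0\<close> unfolding continuous_at_eps_delta dist_norm by blast
  have "norm (u s - u t - (s - t) *\<^sub>R w t) \<le> e * norm (s - t)" if s: "norm (s - t) < \<delta>" for s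
  proof (rule norm_bound)
    fix k
    have "norm (u s k - u t k - (s - t) *\<^sub>R w t k) \<le> norm (s - t) * e"
    proof (rule vector_differentiable_bound_linearization[where S = "ball t \<delta>"])
      show "((\<lambda>t. apply_bcontfun (u t) k) has_vector_derivative w r k) (at r within ball t \<delta>)" for r
        using u by (rule has_vector_derivative_at_within)
      show "closed_segment t s \<subseteq> ball t \<delta>"
        using s \<delta>(1) by (intro closed_segment_subset) (auto simp: dist_norm norm_minus_commute)
      show "norm (w r k - w t k) \<le> e" if "r \<in> ball t \<delta>" for r
      proof -
        have "norm (w r - w t) < e" using \<delta>(2)[of r] that by (simp add: dist_norm norm_minus_commute)
        then show ?thesis using norm_bounded[of "w r - w t" k] by simp
      qed
    qed (use \<delta>(1) in simp)
    then show "norm (apply_bcontfun (u s - u t - (s - t) *\<^sub>R w t) k) \<le> e * norm (s - t)"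
      by (simp add: mult.commute)
  qed
  then show "\<exists>d>0. \<forall>y. norm (y - t) < d \<longrightarrow> norm (u y - u t - (y - t) *\<^sub>R w t) \<le> e * norm (y - t)"
    using \<delta>(1) by blast
qed

lemma apply_linf_has_vector_derivative:
  assumes "(u has_vector_derivative w) F"
  shows "((\<lambda>t. apply_bcontfun (u t) (k::'i::topological_space) :: 'a::real_normed_vector)
    has_vector_derivative apply_bcontfun w k) F"
  using bounded_linear.has_vector_derivative[OF bounded_linear_apply_bcontfun assms] .

lemma apply_sitewise_bounded:
  fixes h :: "int \<Rightarrow> 'a::metric_space \<Rightarrow> 'b::real_normed_vector"
  assumes "\<And>k y. norm (h k y) \<le> c"
  shows "apply_bcontfun (sitewise h u) k = h k (apply_bcontfun u k)"
  by (rule apply_sitewise) (use assms in \<open>auto simp: bounded_iff\<close>)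

lemma sitewise_Lipschitz:
  fixes h :: "int \<Rightarrow> 'a::real_normed_vector \<Rightarrow> 'b::real_normed_vector"
  assumes "\<And>k y. norm (h k y) \<le> c" and L: "\<And>k y z. norm (h k y - h k z) \<le> L * norm (y - z)" "L \<ge> 0"
  shows "norm (sitewise h u - sitewise h w) \<le> L * norm (u - w)"
proof (rule norm_bound)
  fix k
  have "norm (h k (u k) - h k (w k)) \<le> L * norm (u - w)"
    using norm_bounded[of "u - w" k] by (intro order_trans[OF L(1)] mult_left_mono L(2)) simp
  then show "norm (apply_bcontfun (sitewise h u - sitewise h w) k) \<le> L * norm (u - w)"
    by (simp add: apply_sitewise_bounded[OF assms(1)])
qed

lemma norm_sitewise:
  fixes h :: "int \<Rightarrow> 'a::real_normed_vector \<Rightarrow> 'b::real_normed_vector"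
  assumes "\<And>k y. norm (h k y) \<le> c"
  shows "norm (sitewise h u) \<le> c"
  by (rule norm_bound) (simp add: apply_sitewise_bounded[OF assms] assms)

text \<open>One trajectory and one value of \<epsilon>, with constants common to all sites.
  \<open>small_\<beta>\<close> and \<mu> reduce a displacement difference to
  \<open>\<alpha> / (16 * M)\<close> times the phase difference, and \<open>small_d\<close> lets
  this change the phase speed by at most the factor \<open>\<alpha> / 8\<close>. The equation for
  \<open>p\<close> has the total constant \<open>3 * B\<^sup>2\<close>, and \<nu> is
  \<open>8 / \<alpha>\<close> times that. \<open>small_\<epsilon>\<close> keeps the change of the
  coupling force below \<open>\<mu> / 8\<close>.\<close>

locale coupled_lattice =
  fixes f :: "int \<Rightarrow> 'a::euclidean_space \<Rightarrow> 'a" and A :: "int \<Rightarrow> 'a \<Rightarrow> 'a \<Rightarrow> 'a"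
    and x ys :: "int \<Rightarrow> real \<Rightarrow> 'a" and B M C \<kappa> d :: real
    and g :: "int \<Rightarrow> 'a \<Rightarrow> 'b::banach"
    and F :: "'a linf \<times> 'b linf \<Rightarrow> 'a linf" and G :: "'a linf \<times> 'b linf \<Rightarrow> 'b linf"
    and \<epsilon> R \<alpha> \<mu> \<nu> :: real
  assumes site: "\<And>k. hyperbolic_orbit_modulus (f k) (A k) (x k) (ys k) B M C \<kappa> d"
    and x_bound: "\<And>k t. norm (x k t) \<le> R"
    and g_bound: "\<And>k y. norm (g k y) \<le> B"
    and g_Lipschitz: "\<And>k y z. norm (g k y - g k z) \<le> B * norm (y - z)"
    and F_bound: "\<And>u. norm (F u) \<le> B" and G_bound: "\<And>u. norm (G u) \<le> B"
    and F_Lipschitz: "\<And>u w. norm (F u - F w) \<le> B * norm (u - w)"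
    and G_Lipschitz: "\<And>u w. norm (G u - G w) \<le> B * norm (u - w)"
    and \<alpha>: "\<alpha> > 0" "\<alpha> \<le> 1 / (16 * C)"
    and \<mu>_def: "\<mu> = \<alpha> / (128 * C * M)" and \<nu>_def: "\<nu> = 24 * B\<^sup>2 / \<alpha>"
    and small_\<beta>: "\<kappa> * B + 2 * M * B\<^sup>2 * d \<le> \<alpha> / (128 * C * M)"
    and small_d: "M * B * d \<le> \<alpha> / 16" "M * d \<le> 1 / (32 * C * M * B)"
    and small_\<epsilon>: "\<bar>\<epsilon>\<bar> * (8 * B * (2 * B + \<nu>)) \<le> \<mu>" "\<bar>\<epsilon>\<bar> * (B * (4 * C)) \<le> d"
begin

abbreviation site_rhs where "site_rhs k \<equiv> hyperbolic_orbit.rhs (f k) (x k) (ys k)"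

lemma constants: "B \<ge> 1" "M \<ge> 1" "C \<ge> 1" "\<kappa> \<ge> 0" "d > 0" "\<mu> > 0" "\<nu> > 0" "\<bar>\<epsilon>\<bar> \<le> 1"
proof -
  interpret hyperbolic_orbit_modulus "f 0" "A 0" "x 0" "ys 0" B M C \<kappa> d by (rule site)
  have *: "B \<ge> 1" "M \<ge> 1" "C \<ge> 1" "\<kappa> \<ge> 0" "d > 0" using B M C \<kappa> d by simp_all
  then show "B \<ge> 1" "M \<ge> 1" "C \<ge> 1" "\<kappa> \<ge> 0" "d > 0" by simp_all
  show "\<mu> > 0" "\<nu> > 0" using * \<alpha> by (auto simp: \<mu>_def \<nu>_def)
  have "128 * C * M \<ge> 1" "16 * C \<ge> 1" using * mult_ge1_I[of C M] by auto
  have "\<alpha> \<le> 1"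
    using order_trans[OF \<alpha>(2), of 1] * by simp
  have "\<mu> \<le> \<alpha>"
    using divide_left_mono[OF \<open>128 * C * M \<ge> 1\<close>, of \<alpha>] \<alpha> * by (simp add: \<mu>_def zero_less_mult_iff)
  have "B * (2 * B + \<nu>) \<ge> 1" using * \<open>\<nu> > 0\<close> by (intro mult_ge1_I) auto
  then have "8 * B * (2 * B + \<nu>) \<ge> 1" by simp
  then have "\<bar>\<epsilon>\<bar> * 1 \<le> \<bar>\<epsilon>\<bar> * (8 * B * (2 * B + \<nu>))" by (intro mult_left_mono) auto
  then show "\<bar>\<epsilon>\<bar> \<le> 1" using small_\<epsilon>(1) \<open>\<mu> \<le> \<alpha>\<close> \<open>\<alpha> \<le> 1\<close> by linarith

qed

definition pos :: "real linf \<Rightarrow> 'a linf \<Rightarrow> 'a linf" where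
  "pos \<phi> v = sitewise x \<phi> + v"

definition rate :: "real linf \<Rightarrow> 'a linf \<Rightarrow> real linf" where
  "rate \<phi> v = Bcontfun (\<lambda>k. ys k (\<phi> k) \<bullet> v k)"

definition decay :: "real \<Rightarrow> real \<Rightarrow> real" where
  "decay \<tau> t = exp (- \<alpha> * (t - \<tau>))"

text \<open>Phases \<open>\<phi>\<close> and normal displacements \<open>v\<close> of the curve \<open>pos \<phi> v\<close>, driven by a phase
  drift \<open>a\<close> and a force \<open>e\<close>.\<close>

definition configuration ::
  "(real \<Rightarrow> real linf) \<Rightarrow> (real \<Rightarrow> real linf) \<Rightarrow> (real \<Rightarrow> 'a linf) \<Rightarrow> (real \<Rightarrow> 'a linf) \<Rightarrow> bool" where
  "configuration \<phi> a e v \<longleftrightarrow> continuous_on UNIV a \<and> continuous_on UNIV e \<and>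
    (\<forall>t k. \<bar>a t k\<bar> \<le> 1 / (32 * C * M * B)) \<and> (\<forall>t k. norm (v t k) \<le> d) \<and>
    (\<forall>t k. ((\<lambda>t. apply_bcontfun (\<phi> t) k) has_real_derivative 1 + a t k) (at t)) \<and>
    (\<forall>t k. ((\<lambda>t. apply_bcontfun (v t) k) has_vector_derivative site_rhs k (\<phi> t k) (v t k) + e t k) (at t))"

lemma decay_pos: "decay \<tau> t > 0" by (simp add: decay_def)

lemma decay_ge_1: "t \<le> \<tau> \<Longrightarrow> decay \<tau> t \<ge> 1"
  using \<alpha> by (simp add: decay_def mult_nonneg_nonpos)

lemma continuous_on_decay [continuous_intros]: "continuous_on S (decay \<tau>)"
  unfolding decay_def by (intro continuous_intros)

lemma x_Lipschitz: "norm (x k s - x k t) \<le> B * norm (s - t)"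
proof -
  interpret hyperbolic_orbit_modulus "f k" "A k" "x k" "ys k" B M C \<kappa> d by (rule site)
  show ?thesis using x_Lipschitz by simp
qed

lemma f_bound: "norm (f k y) \<le> B"
proof -
  interpret hyperbolic_orbit_modulus "f k" "A k" "x k" "ys k" B M C \<kappa> d by (rule site)
  show ?thesis by (rule f_bound)
qed

lemma f_Lipschitz: "norm (f k y - f k z) \<le> B * norm (y - z)"
proof -
  interpret hyperbolic_orbit_modulus "f k" "A k" "x k" "ys k" B M C \<kappa> d by (rule site)
  show ?thesis by (rule f_Lipschitz)
qed

lemma ys_bound: "norm (ys k t) \<le> M" and ys_Lipschitz: "norm (ys k s - ys k t) \<le> M * B * \<bar>s - t\<bar>"
proof -
  interpret hyperbolic_orbit_modulus "f k" "A k" "x k" "ys k" B M C \<kappa> d by (rule site)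
  show "norm (ys k t) \<le> M" "norm (ys k s - ys k t) \<le> M * B * \<bar>s - t\<bar>"
    by (rule ys_bound, rule ys_Lipschitz)
qed

lemma apply_pos: "pos \<phi> v k = x k (\<phi> k) + v k"
  by (simp add: pos_def apply_sitewise_bounded[OF x_bound])

lemma rate_component_bound: "\<bar>ys k s \<bullet> w\<bar> \<le> M * norm w"
  using Cauchy_Schwarz_ineq2[of "ys k s" w] mult_right_mono[OF ys_bound[of k s], of "norm w"] by simp

lemma apply_rate: "rate \<phi> v k = ys k (\<phi> k) \<bullet> v k"
  unfolding rate_def
proof (rule apply_Bcontfun_int)
  show "norm (ys k (\<phi> k) \<bullet> v k) \<le> M * norm v" for k
    unfolding real_norm_def
    by (rule order_trans[OF rate_component_bound mult_left_mono[OF norm_bounded]]) (use constants in simp)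
qed

lemma pos_Lipschitz: "norm (pos \<phi> v - pos \<phi>' v') \<le> B * norm (\<phi> - \<phi>') + norm (v - v')"
  unfolding pos_def
  using norm_triangle_ineq[of "sitewise x \<phi> - sitewise x \<phi>'" "v - v'"]
    sitewise_Lipschitz[where h = x and u = \<phi> and w = \<phi>', OF x_bound x_Lipschitz] constants(1)
  by (simp add: algebra_simps)

lemma rate_diff:
  assumes "norm v' \<le> d"
  shows "norm (rate \<phi> v - rate \<phi>' v') \<le> M * norm (v - v') + M * B * d * norm (\<phi> - \<phi>')"
proof (rule norm_bound)
  fix k
  have "ys k (\<phi> k) \<bullet> v k - ys k (\<phi>' k) \<bullet> v' k
      = ys k (\<phi> k) \<bullet> (v k - v' k) + (ys k (\<phi> k) - ys k (\<phi>' k)) \<bullet> v' k"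
    by (simp add: inner_diff_left inner_diff_right)
  also have "norm \<dots> \<le> M * norm (v - v') + M * B * norm (\<phi> - \<phi>') * d"
  proof (rule norm_triangle_le[OF add_mono])
    show "norm (ys k (\<phi> k) \<bullet> (v k - v' k)) \<le> M * norm (v - v')"
      using norm_bounded[of "v - v'" k] constants
      by (auto intro!: order_trans[OF rate_component_bound] mult_left_mono)
    have "norm ((ys k (\<phi> k) - ys k (\<phi>' k)) \<bullet> v' k) \<le> norm (ys k (\<phi> k) - ys k (\<phi>' k)) * norm (v' k)"
      using Cauchy_Schwarz_ineq2 by simp
    also have "\<dots> \<le> M * B * norm (\<phi> - \<phi>') * d"
    proof (rule mult_mono)
      show "norm (ys k (\<phi> k) - ys k (\<phi>' k)) \<le> M * B * norm (\<phi> - \<phi>')"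
        using norm_bounded[of "\<phi> - \<phi>'" k] constants
        by (intro order_trans[OF ys_Lipschitz] mult_left_mono) auto
      show "norm (v' k) \<le> d" using norm_bounded[of v' k] assms by simp
    qed (use constants in auto)
    finally show "norm ((ys k (\<phi> k) - ys k (\<phi>' k)) \<bullet> v' k) \<le> M * B * norm (\<phi> - \<phi>') * d" .
  qed
  finally show "norm (apply_bcontfun (rate \<phi> v - rate \<phi>' v') k) \<le> M * norm (v - v') + M * B * d * norm (\<phi> - \<phi>')"
    by (simp add: apply_rate algebra_simps)
qed

lemma configuration_norm_v: "configuration \<phi> a e v \<Longrightarrow> norm (v t) \<le> d"
  by (rule norm_bound) (simp add: configuration_def)

lemma configuration_comparison:
  assumes c: "configuration \<phi> a e v" and c': "configuration \<phi>' a' e' v'"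
    and N\<phi>: "\<And>t. norm (\<phi> t - \<phi>' t) \<le> N\<phi> * decay \<tau> t"
    and Ne: "\<And>t. norm (e t - e' t) \<le> Ne * decay \<tau> t"
  shows "norm (v t - v' t) \<le> 4 * C * ((\<kappa> * B + 2 * M * B\<^sup>2 * d) * N\<phi> + Ne) * decay \<tau> t"
proof (rule norm_bound)
  fix k
  interpret hyperbolic_orbit_modulus "f k" "A k" "x k" "ys k" B M C \<kappa> d by (rule site)
  have "norm (v t k - v' t k) \<le> 4 * C * (\<beta> * N\<phi> + Ne) * exp (- \<alpha> * (t - \<tau>))"
  proof (rule exponential_comparison[where \<phi> = "\<lambda>t. \<phi> t k" and \<phi>' = "\<lambda>t. \<phi>' t k" and a = "\<lambda>t. a t k"
        and e = "\<lambda>t. e t k" and e' = "\<lambda>t. e' t k" and v = "\<lambda>t. v t k" and v' = "\<lambda>t. v' t k"])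
    show "continuous_on UNIV (\<lambda>t. apply_bcontfun (\<phi>' t) k)"
    proof (rule DERIV_continuous_on)
      show "((\<lambda>t. apply_bcontfun (\<phi>' t) k) has_field_derivative 1 + a' t k) (at t)" for t
        using c' unfolding configuration_def by blast
    qed
    show "\<bar>apply_bcontfun (\<phi> t) k - apply_bcontfun (\<phi>' t) k\<bar> \<le> N\<phi> * exp (- \<alpha> * (t - \<tau>))" for t
      using N\<phi>[of t] norm_bounded[of "\<phi> t - \<phi>' t" k] by (simp add: decay_def)
    show "norm (e t k - e' t k) \<le> Ne * exp (- \<alpha> * (t - \<tau>))" for t
      using Ne[of t] norm_bounded[of "e t - e' t" k] by (simp add: decay_def)
  qed (use c c' \<alpha> in \<open>auto simp: configuration_def intro: continuous_on_apply_linf\<close>)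
  then show "norm (apply_bcontfun (v t - v' t) k) \<le> 4 * C * ((\<kappa> * B + 2 * M * B\<^sup>2 * d) * N\<phi> + Ne) * decay \<tau> t"
    by (simp add: \<beta>_def decay_def)
qed

text \<open>The estimate behind both existence and uniqueness. Differences of phase, force and
  \<open>p\<close> in the proportion 1 : \<mu> : \<nu> yield differences of phase speed, force and
  \<open>p'\<close> in the proportion \<alpha> : \<mu> : \<alpha>\<nu>, reduced by 1/8. Integration
  from +\<infinity> divides the first and the third by \<alpha>, so all three shrink by the same
  factor. The displacement is no independent unknown: it is controlled by phase and force.\<close>

lemma configuration_step:
  assumes c: "configuration \<phi> a e v" and c': "configuration \<phi>' a' e' v'"
    and N: "\<And>t. norm (\<phi> t - \<phi>' t) \<le> N * decay \<tau> t"
      "\<And>t. norm (e t - e' t) \<le> \<mu> * N * decay \<tau> t"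
      "\<And>t. norm (p t - p' t) \<le> \<nu> * N * decay \<tau> t"
  defines "y \<equiv> \<lambda>t. pos (\<phi> t) (v t)" and "y' \<equiv> \<lambda>t. pos (\<phi>' t) (v' t)"
  shows "norm (v t - v' t) \<le> N * decay \<tau> t"
    and "norm (rate (\<phi> t) (v t) - rate (\<phi>' t) (v' t)) \<le> \<alpha> / 8 * N * decay \<tau> t"
    and "norm (\<epsilon> *\<^sub>R F (y t, p t) - \<epsilon> *\<^sub>R F (y' t, p' t)) \<le> \<mu> / 8 * N * decay \<tau> t"
    and "norm ((sitewise g (y t) + \<epsilon> *\<^sub>R G (y t, p t)) - (sitewise g (y' t) + \<epsilon> *\<^sub>R G (y' t, p' t)))
      \<le> \<alpha> / 8 * \<nu> * N * decay \<tau> t"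
proof -
  define E where "E = N * decay \<tau> t"
  have E0: "E \<ge> 0" using order_trans[OF norm_ge_zero N(1)[of t]] by (simp add: E_def)
  then have N0: "N \<ge> 0" using decay_pos[of \<tau> t] by (simp add: E_def zero_le_mult_iff)
  have "norm (v t - v' t) \<le> 4 * C * ((\<kappa> * B + 2 * M * B\<^sup>2 * d) * N + \<mu> * N) * decay \<tau> t"
    by (rule configuration_comparison[OF c c' N(1,2)])
  also have "\<dots> = 4 * C * ((\<kappa> * B + 2 * M * B\<^sup>2 * d) + \<mu>) * E" by (simp add: E_def algebra_simps)
  also have "\<dots> \<le> 4 * C * (\<alpha> / (128 * C * M) + \<alpha> / (128 * C * M)) * E"
    using small_\<beta> E0 constants by (intro mult_right_mono mult_left_mono add_mono) (auto simp: \<mu>_def)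
  also have "\<dots> = \<alpha> / (16 * M) * E" using constants by (simp add: field_simps)
  finally have v: "norm (v t - v' t) \<le> \<alpha> / (16 * M) * E" .
  have \<alpha>1: "\<alpha> \<le> 1" using \<alpha>(2) constants(3) order_trans[of \<alpha> "1 / (16 * C)" 1] by simp
  have "\<alpha> / (16 * M) \<le> 1" using \<alpha>1 \<alpha>(1) constants by (simp add: field_simps)
  then have "\<alpha> / (16 * M) * E \<le> 1 * E" using E0 by (intro mult_right_mono) auto
  with v have v1: "norm (v t - v' t) \<le> E" by simp
  then show "norm (v t - v' t) \<le> N * decay \<tau> t" by (simp add: E_def)
  have \<phi>: "norm (\<phi> t - \<phi>' t) \<le> E" using N(1)[of t] by (simp add: E_def)
  have p: "norm (p t - p' t) \<le> \<nu> * E" using N(3)[of t] by (simp add: E_def mult.assoc)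
  have "norm (rate (\<phi> t) (v t) - rate (\<phi>' t) (v' t)) \<le> M * norm (v t - v' t) + M * B * d * norm (\<phi> t - \<phi>' t)"
    by (rule rate_diff[OF configuration_norm_v[OF c']])
  also have "\<dots> \<le> M * (\<alpha> / (16 * M) * E) + \<alpha> / 16 * E"
    using v \<phi> small_d(1) constants E0 \<alpha>(1) by (intro add_mono mult_left_mono mult_mono) auto
  also have "\<dots> = \<alpha> / 8 * E" using constants by (simp add: field_simps)
  finally show "norm (rate (\<phi> t) (v t) - rate (\<phi>' t) (v' t)) \<le> \<alpha> / 8 * N * decay \<tau> t"
    by (simp add: E_def mult.assoc)
  have "norm (y t - y' t) \<le> B * norm (\<phi> t - \<phi>' t) + norm (v t - v' t)"
    unfolding y_def y'_def by (rule pos_Lipschitz)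
  also have "\<dots> \<le> B * E + B * E"
    using v1 \<phi> constants(1) E0 mult_right_mono[OF constants(1) E0] by (intro add_mono mult_left_mono) auto
  finally have y: "norm (y t - y' t) \<le> 2 * B * E" by simp
  have yp: "norm ((y t, p t) - (y' t, p' t)) \<le> (2 * B + \<nu>) * E"
    using norm_Pair_le[of "y t - y' t" "p t - p' t"] y p by (simp add: algebra_simps)
  have eps: "\<bar>\<epsilon>\<bar> * (B * ((2 * B + \<nu>) * E)) \<le> \<mu> / 8 * E"
    using mult_right_mono[OF small_\<epsilon>(1) E0] by (simp add: algebra_simps)
  have "norm (\<epsilon> *\<^sub>R F (y t, p t) - \<epsilon> *\<^sub>R F (y' t, p' t)) \<le> \<bar>\<epsilon>\<bar> * (B * ((2 * B + \<nu>) * E))"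
    unfolding scaleR_diff_right[symmetric] norm_scaleR using yp constants
    by (intro mult_left_mono order_trans[OF F_Lipschitz]) auto
  with eps show "norm (\<epsilon> *\<^sub>R F (y t, p t) - \<epsilon> *\<^sub>R F (y' t, p' t)) \<le> \<mu> / 8 * N * decay \<tau> t"
    by (simp add: E_def mult.assoc)
  have "norm (\<epsilon> *\<^sub>R G (y t, p t) - \<epsilon> *\<^sub>R G (y' t, p' t)) \<le> \<bar>\<epsilon>\<bar> * (B * ((2 * B + \<nu>) * E))"
    unfolding scaleR_diff_right[symmetric] norm_scaleR using yp constants
    by (intro mult_left_mono order_trans[OF G_Lipschitz]) auto
  moreover have "\<mu> \<le> 1"
  proof -
    have "128 * C * M \<ge> 1" using constants mult_ge1_I[of C M] by simp
    then show ?thesis using \<alpha>1 \<alpha>(1) by (simp add: \<mu>_def divide_le_eq)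
  qed
  then have "\<mu> / 8 * E \<le> 1 * E" using E0 by (intro mult_right_mono) auto
  moreover have "1 * E \<le> B\<^sup>2 * E" using constants(1) E0 by (intro mult_right_mono) auto
  moreover have "norm (sitewise g (y t) - sitewise g (y' t)) \<le> 2 * B\<^sup>2 * E"
  proof -
    have "norm (sitewise g (y t) - sitewise g (y' t)) \<le> B * norm (y t - y' t)"
      by (rule sitewise_Lipschitz[OF g_bound g_Lipschitz]) (use constants(1) in simp)
    also have "\<dots> \<le> B * (2 * B * E)" using y constants(1) by (intro mult_left_mono) auto
    finally show ?thesis by (simp add: power2_eq_square mult_ac)
  qed
  ultimately have "norm ((sitewise g (y t) - sitewise g (y' t)) + (\<epsilon> *\<^sub>R G (y t, p t) - \<epsilon> *\<^sub>R G (y' t, p' t))) \<le> 3 * B\<^sup>2 * E"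
    using eps by (intro norm_triangle_le) linarith
  then show "norm ((sitewise g (y t) + \<epsilon> *\<^sub>R G (y t, p t)) - (sitewise g (y' t) + \<epsilon> *\<^sub>R G (y' t, p' t)))
      \<le> \<alpha> / 8 * \<nu> * N * decay \<tau> t"
    using \<alpha>(1) by (simp add: \<nu>_def E_def algebra_simps)
qed

end

text \<open>The library instance requires a metric domain, and \<open>int\<close> carries no metric.\<close>

instance bcontfun :: (topological_space, complete_space) complete_space
proof
  fix h :: "nat \<Rightarrow> ('a, 'b) bcontfun"
  assume "Cauchy h"
  then have "uniformly_Cauchy_on UNIV (\<lambda>n. apply_bcontfun (h n))"
    unfolding Cauchy_def uniformly_Cauchy_on_def by (meson dist_fun_lt_imp_dist_val_lt)
  then obtain l where "uniform_limit UNIV (\<lambda>n. apply_bcontfun (h n)) l sequentially"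
    using Cauchy_uniformly_convergent unfolding uniformly_convergent_on_def by blast
  from uniform_limit_bcontfunE[OF this sequentially_bot] show "convergent h"
    by (auto simp: convergent_def)
qed

instance bcontfun :: (topological_space, banach) banach ..

section \<open>Regularity, existence and uniqueness of configurations\<close>

context coupled_lattice
begin

text \<open>A configuration solves its equations site by site, which by itself gives no continuity
  in the sup norm. Derivative bounds common to all sites give Lipschitz continuity there.\<close>

lemma configuration_continuous:
  assumes c: "configuration \<phi> a e v" and e: "\<And>t k. norm (e t k) \<le> E"
  shows "continuous_on S \<phi>" and "continuous_on S v"
    and "continuous_on S (\<lambda>t. rate (\<phi> t) (v t))" and "continuous_on S (\<lambda>t. pos (\<phi> t) (v t))"
proof -
  have "C * M * B \<ge> 1" using constants by (simp add: mult_ge1_I)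
  then have "1 / (32 * C * M * B) \<le> 1" by (simp add: field_simps)
  then have a: "\<bar>1 + a t k\<bar> \<le> 2" for t k
    using c order_trans[of "\<bar>a t k\<bar>" "1 / (32 * C * M * B)" 1]
    unfolding configuration_def by (smt (verit))
  have \<phi>: "norm (\<phi> s k - \<phi> t k) \<le> 2 * \<bar>s - t\<bar>" for s t k
    by (rule vector_derivative_Lipschitz[where f' = "\<lambda>t. 1 + a t k"])
       (use c a in \<open>auto simp: configuration_def has_real_derivative_iff_has_vector_derivative\<close>)
  define K where "K = 2 * B + M * d * B + E"
  have v: "norm (v s k - v t k) \<le> K * \<bar>s - t\<bar>" for s t k
  proof (rule vector_derivative_Lipschitz)
    interpret hyperbolic_orbit_modulus "f k" "A k" "x k" "ys k" B M C \<kappa> d by (rule site)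
    show "((\<lambda>t. apply_bcontfun (v t) k) has_vector_derivative site_rhs k (\<phi> t k) (v t k) + e t k) (at t)" for t
      using c unfolding configuration_def by blast
    show "norm (site_rhs k (\<phi> t k) (v t k) + e t k) \<le> K" for t
    proof -
      have "\<bar>ys k (\<phi> t k) \<bullet> v t k\<bar> \<le> M * d"
        using c constants unfolding configuration_def
        by (intro order_trans[OF rate_component_bound] mult_left_mono) auto
      then have "\<bar>1 + ys k (\<phi> t k) \<bullet> v t k\<bar> \<le> 1 + M * d" by linarith
      then have "norm ((1 + ys k (\<phi> t k) \<bullet> v t k) *\<^sub>R f k (x k (\<phi> t k))) \<le> (1 + M * d) * B"
        unfolding norm_scaleR using f_bound constants by (intro mult_mono) auto
      then have "norm (rhs (\<phi> t k) (v t k)) \<le> B + (1 + M * d) * B"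
        unfolding rhs_def by (intro norm_triangle_le_diff add_mono f_bound)
      then have "norm (rhs (\<phi> t k) (v t k) + e t k) \<le> (B + (1 + M * d) * B) + E"
        by (intro norm_triangle_le add_mono e)
      then show ?thesis by (simp add: K_def algebra_simps)
    qed
  qed
  show \<phi>': "continuous_on S \<phi>" for S by (rule linf_Lipschitz_continuous_on[OF \<phi>])
  show v': "continuous_on S v" for S by (rule linf_Lipschitz_continuous_on[OF v])
  have \<phi>n: "norm (\<phi> s - \<phi> t) \<le> 2 * \<bar>s - t\<bar>" and vn: "norm (v s - v t) \<le> K * \<bar>s - t\<bar>" for s t
    using \<phi> v by (auto intro: norm_bound)
  have "norm (rate (\<phi> s) (v s) - rate (\<phi> t) (v t)) \<le> (M * K + M * B * d * 2) * norm (s - t)" for s t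
  proof -
    have "norm (rate (\<phi> s) (v s) - rate (\<phi> t) (v t)) \<le> M * norm (v s - v t) + M * B * d * norm (\<phi> s - \<phi> t)"
      by (rule rate_diff[OF configuration_norm_v[OF c]])
    also have "\<dots> \<le> M * (K * \<bar>s - t\<bar>) + M * B * d * (2 * \<bar>s - t\<bar>)"
      using \<phi>n vn constants by (intro add_mono mult_left_mono) auto
    finally show ?thesis by (simp add: algebra_simps)
  qed
  then show "continuous_on S (\<lambda>t. rate (\<phi> t) (v t))" for S by (rule Lipschitz_imp_continuous_on)
  have "norm (pos (\<phi> s) (v s) - pos (\<phi> t) (v t)) \<le> (B * 2 + K) * norm (s - t)" for s t
  proof -
    have "norm (pos (\<phi> s) (v s) - pos (\<phi> t) (v t)) \<le> B * norm (\<phi> s - \<phi> t) + norm (v s - v t)"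
      by (rule pos_Lipschitz)
    also have "\<dots> \<le> B * (2 * \<bar>s - t\<bar>) + K * \<bar>s - t\<bar>"
      using \<phi>n vn constants by (intro add_mono mult_left_mono) auto
    finally show ?thesis by (simp add: algebra_simps)
  qed
  then show "continuous_on S (\<lambda>t. pos (\<phi> t) (v t))" for S by (rule Lipschitz_imp_continuous_on)
qed

lemma continuous_on_sitewise_g: "continuous_on S y \<Longrightarrow> continuous_on S (\<lambda>t. sitewise g (y t))"
  using continuous_on_compose2[OF Lipschitz_imp_continuous_on[where S = UNIV and f = "sitewise g" and D = B]]
    sitewise_Lipschitz[OF g_bound g_Lipschitz] constants(1) by fastforce

lemma continuous_on_sitewise_f: "continuous_on S y \<Longrightarrow> continuous_on S (\<lambda>t. sitewise f (y t))"
  using continuous_on_compose2[OF Lipschitz_imp_continuous_on[where S = UNIV and f = "sitewise f" and D = B]]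
    sitewise_Lipschitz[OF f_bound f_Lipschitz] constants(1) by fastforce

lemma continuous_on_F: "continuous_on S u \<Longrightarrow> continuous_on S (\<lambda>t. F (u t))"
  using continuous_on_compose2[OF Lipschitz_imp_continuous_on[where S = UNIV, OF F_Lipschitz]] by blast

lemma continuous_on_G: "continuous_on S u \<Longrightarrow> continuous_on S (\<lambda>t. G (u t))"
  using continuous_on_compose2[OF Lipschitz_imp_continuous_on[where S = UNIV, OF G_Lipschitz]] by blast

lemma configuration_exists:
  fixes \<phi> a :: "real \<Rightarrow> real linf" and e :: "real \<Rightarrow> 'a linf"
  assumes a: "continuous_on UNIV a" "\<And>t k. \<bar>a t k\<bar> \<le> 1 / (32 * C * M * B)"
    and e: "continuous_on UNIV e" "\<And>t k. norm (e t k) \<le> d / (4 * C)"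
    and \<phi>: "\<And>t. (\<phi> has_vector_derivative const_bcontfun 1 + a t) (at t)"
  shows "\<exists>v. configuration \<phi> a e v"
proof -
  have \<phi>': "((\<lambda>t. apply_bcontfun (\<phi> t) k) has_real_derivative 1 + a t k) (at t)" for t k
    using apply_linf_has_vector_derivative[OF \<phi>[of t], of k]
    by (simp add: has_real_derivative_iff_has_vector_derivative)
  have "\<exists>v. (\<forall>t. (v has_vector_derivative site_rhs k (\<phi> t k) (v t) + e t k) (at t)) \<and> (\<forall>t. norm (v t) \<le> d)" for k
  proof -
    interpret hyperbolic_orbit_modulus "f k" "A k" "x k" "ys k" B M C \<kappa> d by (rule site)
    show ?thesis
      by (rule forced_solution_exists[where \<phi> = "\<lambda>t. \<phi> t k" and a = "\<lambda>t. a t k" and e = "\<lambda>t. e t k" and E = "d / (4 * C)"])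
         (use \<phi>' a e constants in \<open>auto intro: continuous_on_apply_linf\<close>)
  qed
  then obtain v where v: "\<And>k t. (v k has_vector_derivative site_rhs k (\<phi> t k) (v k t) + e t k) (at t)"
    "\<And>k t. norm (v k t) \<le> d" by metis
  define V where "V t = Bcontfun (\<lambda>k. v k t)" for t
  have "V t k = v k t" for t k unfolding V_def by (rule apply_Bcontfun_int[OF v(2)])
  then have "configuration \<phi> a e V" using a e(1) v \<phi>' by (simp add: configuration_def)
  then show ?thesis by blast
qed

lemma configuration_unique:
  assumes "configuration \<phi> a e v" "configuration \<phi> a' e v'"
  shows "v = v'"
proof
  fix t
  have "norm (v t - v' t) \<le> 4 * C * ((\<kappa> * B + 2 * M * B\<^sup>2 * d) * 0 + 0) * decay 0 t"
    by (rule configuration_comparison[OF assms]) auto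
  then show "v t = v' t" by simp
qed

text \<open>With the drift equal to the rate prescribed by \<open>v\<close>, the velocity of the
  orbit point cancels the phase-speed term subtracted in \<open>rhs\<close>, and the original
  equation with force \<open>e\<close> remains.\<close>

lemma configuration_solution:
  assumes c: "configuration \<phi> a e v" and e: "\<And>t k. norm (e t k) \<le> E"
    and a: "\<And>t. a t = rate (\<phi> t) (v t)"
  shows "((\<lambda>t. pos (\<phi> t) (v t)) has_vector_derivative sitewise f (pos (\<phi> t) (v t)) + e t) (at t)"
proof (rule linf_has_vector_derivative)
  note sitewise_f = apply_sitewise_bounded[where h = f, OF f_bound]
  show "((\<lambda>t. apply_bcontfun (pos (\<phi> t) (v t)) k) has_vector_derivative
      apply_bcontfun (sitewise f (pos (\<phi> t) (v t)) + e t) k) (at t)" for t k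
  proof -
    interpret hyperbolic_orbit_modulus "f k" "A k" "x k" "ys k" B M C \<kappa> d by (rule site)
    have "((\<lambda>t. apply_bcontfun (\<phi> t) k) has_vector_derivative 1 + a t k) (at t)"
      using c unfolding configuration_def has_real_derivative_iff_has_vector_derivative by blast
    from vector_diff_chain_at[OF this orbit]
    have "((\<lambda>t. x k (\<phi> t k)) has_vector_derivative (1 + a t k) *\<^sub>R f k (x k (\<phi> t k))) (at t)"
      unfolding o_def .
    moreover have "((\<lambda>t. apply_bcontfun (v t) k) has_vector_derivative rhs (\<phi> t k) (v t k) + e t k) (at t)"
      using c unfolding configuration_def by blast
    ultimately have "((\<lambda>t. x k (\<phi> t k) + v t k) has_vector_derivative
        (1 + a t k) *\<^sub>R f k (x k (\<phi> t k)) + (rhs (\<phi> t k) (v t k) + e t k)) (at t)"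
      by (rule has_vector_derivative_add)
    then show ?thesis
      by (simp add: apply_pos sitewise_f a apply_rate rhs_def algebra_simps)
  qed
  show "continuous_on UNIV (\<lambda>t. sitewise f (pos (\<phi> t) (v t)) + e t)"
    using c by (intro continuous_intros continuous_on_sitewise_f configuration_continuous[OF c e])
      (simp add: configuration_def)
qed

end

section \<open>Shadowing and uniqueness\<close>

context coupled_lattice
begin

lemma decaying_linf_drift:
  fixes z :: "real \<Rightarrow> 'c::banach"
  assumes "continuous_on UNIV z" "\<And>t. norm (z t) \<le> c" "s > 0"
  shows "\<exists>I. (\<forall>t. (I has_vector_derivative (s * decay \<tau> t) *\<^sub>R z t) (at t)) \<and>
    (\<forall>t. norm (I t) \<le> s * c / \<alpha> * decay \<tau> t)"
  using decaying_antiderivative[where w = "\<lambda>t. (s * decay \<tau> t) *\<^sub>R z t" and c = "s * c" and \<tau> = \<tau>, OF \<alpha>(1)]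
    assms decay_pos[of \<tau>]
  unfolding decay_def by (force intro!: continuous_intros mult_left_mono simp: mult_ac)

lemma norm_triple_le: "norm (a, b, c) \<le> norm a + norm b + norm c"
  using norm_Pair_le[of a "(b, c)"] norm_Pair_le[of b c] by linarith

text \<open>\<open>2 / \<alpha>\<close> times the defect of the reference curve before \<tau>: a
  force defect of at most \<open>B + d\<close>, rescaled by \<open>\<alpha> / \<mu>\<close>, and a
  defect of \<open>p'\<close> of at most \<open>4 * B\<close>, rescaled by \<open>1 / \<nu>\<close>.
  The factor 2 comes from the contraction, \<open>1 / \<alpha>\<close> from integration.\<close>

definition shadow_const :: real where
  "shadow_const = 2 / \<alpha> * (\<alpha> / \<mu> * (B + d) + 4 * B / \<nu>)"

text \<open>The unknowns are the exponentially weighted deviations of the phase drift, of the force and of \<open>p'\<close>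
  from a reference curve that is exact from time \<open>\<tau>\<close> on; the factors \<open>\<mu>\<close> (small) and \<open>\<nu>\<close> (large) balance the three
  components so that the resulting map is a contraction.\<close>

theorem shadowing:
  fixes \<phi>r ar :: "real \<Rightarrow> real linf" and er vr :: "real \<Rightarrow> 'a linf" and pr br :: "real \<Rightarrow> 'b linf"
  assumes c: "configuration \<phi>r ar er vr" and ar: "\<And>t. ar t = rate (\<phi>r t) (vr t)"
    and er: "\<And>t k. norm (er t k) \<le> d / (4 * C)"
    and pr: "\<And>t. (pr has_vector_derivative br t) (at t)"
    and br: "continuous_on UNIV br" "\<And>t. norm (br t) \<le> 2 * B"
    and exact: "\<And>t. t \<ge> \<tau> \<Longrightarrow> er t = \<epsilon> *\<^sub>R F (pos (\<phi>r t) (vr t), pr t)"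
      "\<And>t. t \<ge> \<tau> \<Longrightarrow> br t = sitewise g (pos (\<phi>r t) (vr t)) + \<epsilon> *\<^sub>R G (pos (\<phi>r t) (vr t), pr t)"
  shows "\<exists>\<phi> v p. configuration \<phi> (\<lambda>t. rate (\<phi> t) (v t)) (\<lambda>t. \<epsilon> *\<^sub>R F (pos (\<phi> t) (v t), p t)) v \<and>
    (\<forall>t. (p has_vector_derivative sitewise g (pos (\<phi> t) (v t)) + \<epsilon> *\<^sub>R G (pos (\<phi> t) (v t), p t)) (at t)) \<and>
    (\<forall>t. norm (\<phi> t - \<phi>r t) \<le> shadow_const * decay \<tau> t) \<and>
    (\<forall>t. norm (v t - vr t) \<le> shadow_const * decay \<tau> t) \<and>
    (\<forall>t. norm (p t - pr t) \<le> \<nu> * shadow_const * decay \<tau> t)"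
proof -
  define ax where "ax x t = ar t + decay \<tau> t *\<^sub>R fst (x t)" for x :: "real \<Rightarrow>\<^sub>C (real linf \<times> 'a linf \<times> 'b linf)" and t
  define ex where "ex x t = er t + (\<mu> / \<alpha> * decay \<tau> t) *\<^sub>R fst (snd (x t))" for x :: "real \<Rightarrow>\<^sub>C (real linf \<times> 'a linf \<times> 'b linf)" and t
  \<comment> \<open>The bounds on drift and force under which \<open>configuration_exists\<close>
    supplies a displacement.\<close>
  define S where "S = {x. \<forall>t k. \<bar>ax x t k\<bar> \<le> 1 / (32 * C * M * B) \<and> norm (ex x t k) \<le> d / (4 * C)}"
  have ratios: "\<mu> / \<alpha> > 0" "\<alpha> / \<mu> > 0" using constants \<alpha> by auto
  have comp: "norm (fst z) \<le> norm z" "norm (fst (snd z)) \<le> norm z" "norm (snd (snd z)) \<le> norm z"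
    for z :: "real linf \<times> 'a linf \<times> 'b linf"
    using norm_fst_le[of "fst z" "snd z"] norm_snd_le[of "snd z" "fst z"]
      norm_fst_le[of "fst (snd z)" "snd (snd z)"] norm_snd_le[of "snd (snd z)" "fst (snd z)"] by auto
  have cont_comp: "continuous_on UNIV (\<lambda>t. fst (x t))" "continuous_on UNIV (\<lambda>t. fst (snd (x t)))"
    "continuous_on UNIV (\<lambda>t. snd (snd (x t)))" for x :: "real \<Rightarrow>\<^sub>C (real linf \<times> 'a linf \<times> 'b linf)"
    by (intro continuous_intros; simp)+
  have ar_cont: "continuous_on UNIV ar" and er_cont: "continuous_on UNIV er"
    using c by (auto simp: configuration_def)
  have ax_cont: "continuous_on UNIV (ax x)" and ex_cont: "continuous_on UNIV (ex x)" for x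
    unfolding ax_def ex_def by (intro continuous_intros ar_cont er_cont cont_comp)+
  have \<phi>r': "(\<phi>r has_vector_derivative const_bcontfun 1 + ar t) (at t)" for t
    by (rule linf_has_vector_derivative)
       (use c in \<open>auto simp: configuration_def has_real_derivative_iff_has_vector_derivative intro!: continuous_intros\<close>)
  define good where "good x \<phi> p v \<longleftrightarrow> configuration \<phi> (ax x) (ex x) v \<and>
      (\<forall>t. ((\<lambda>t. \<phi> t - \<phi>r t) has_vector_derivative decay \<tau> t *\<^sub>R fst (x t)) (at t)) \<and>
      (\<forall>t. norm (\<phi> t - \<phi>r t) \<le> norm x / \<alpha> * decay \<tau> t) \<and>
      (\<forall>t. ((\<lambda>t. p t - pr t) has_vector_derivative (\<nu> * decay \<tau> t) *\<^sub>R snd (snd (x t))) (at t)) \<and>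
      (\<forall>t. norm (p t - pr t) \<le> \<nu> * norm x / \<alpha> * decay \<tau> t)" for x \<phi> p v
  have "\<exists>\<phi> p v. good x \<phi> p v" if "x \<in> S" for x
  proof -
    have bd: "norm (fst (x t)) \<le> norm x" "norm (snd (snd (x t))) \<le> norm x" for t
      using comp[of "x t"] norm_bounded[of x t] by linarith+
    obtain I where I: "\<And>t. (I has_vector_derivative (1 * decay \<tau> t) *\<^sub>R fst (x t)) (at t)"
      "\<And>t. norm (I t) \<le> 1 * norm x / \<alpha> * decay \<tau> t"
      using decaying_linf_drift[OF cont_comp(1)[of x] bd(1) zero_less_one] by blast
    obtain J where J: "\<And>t. (J has_vector_derivative (\<nu> * decay \<tau> t) *\<^sub>R snd (snd (x t))) (at t)"
      "\<And>t. norm (J t) \<le> \<nu> * norm x / \<alpha> * decay \<tau> t"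
      using decaying_linf_drift[OF cont_comp(3)[of x] bd(2) constants(7)] by blast
    have "\<exists>v. configuration (\<lambda>t. \<phi>r t + I t) (ax x) (ex x) v"
    proof (rule configuration_exists[OF ax_cont _ ex_cont])
      show "((\<lambda>t. \<phi>r t + I t) has_vector_derivative const_bcontfun 1 + ax x t) (at t)" for t
        using has_vector_derivative_add[OF \<phi>r' I(1)] by (simp add: ax_def add.assoc)
    qed (use that in \<open>auto simp: S_def\<close>)
    then obtain v where "configuration (\<lambda>t. \<phi>r t + I t) (ax x) (ex x) v" by blast
    then have "good x (\<lambda>t. \<phi>r t + I t) (\<lambda>t. pr t + J t) v"
      using I J by (simp add: good_def)
    then show ?thesis by blast
  qed
  then obtain \<Phi> P V where PV: "\<And>x. x \<in> S \<Longrightarrow> good x (\<Phi> x) (P x) (V x)" by metis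
  have
    conf: "\<And>x. x \<in> S \<Longrightarrow> configuration (\<Phi> x) (ax x) (ex x) (V x)" and
    \<Phi>: "\<And>x t. x \<in> S \<Longrightarrow> ((\<lambda>t. \<Phi> x t - \<phi>r t) has_vector_derivative decay \<tau> t *\<^sub>R fst (x t)) (at t)"
      "\<And>x t. x \<in> S \<Longrightarrow> norm (\<Phi> x t - \<phi>r t) \<le> norm x / \<alpha> * decay \<tau> t" and
    P: "\<And>x t. x \<in> S \<Longrightarrow> ((\<lambda>t. P x t - pr t) has_vector_derivative (\<nu> * decay \<tau> t) *\<^sub>R snd (snd (x t))) (at t)"
      "\<And>x t. x \<in> S \<Longrightarrow> norm (P x t - pr t) \<le> \<nu> * norm x / \<alpha> * decay \<tau> t"
    using PV unfolding good_def by blast+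
  have P_cont: "continuous_on UNIV (P x)" if "x \<in> S" for x
  proof -
    have "continuous_on UNIV (\<lambda>t. P x t - pr t)" "continuous_on UNIV pr"
      by (intro continuous_at_imp_continuous_on ballI
          has_vector_derivative_continuous[OF P(1)[OF that]] has_vector_derivative_continuous[OF pr])+
    from continuous_on_add[OF this] show ?thesis by simp
  qed
  have ex_bd: "norm (ex x t k) \<le> d / (4 * C)" if "x \<in> S" for x t k
    using that by (simp add: S_def)
  define Y where "Y x t = pos (\<Phi> x t) (V x t)" for x t
  define Ap where "Ap x t = rate (\<Phi> x t) (V x t)" for x t
  define Ep where "Ep x t = \<epsilon> *\<^sub>R F (Y x t, P x t)" for x t
  define Bp where "Bp x t = sitewise g (Y x t) + \<epsilon> *\<^sub>R G (Y x t, P x t)" for x t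
  \<comment> \<open>Phase speed, force and \<open>p'\<close> are recomputed from the configuration
    that belongs to \<open>x\<close>, and their deviations from the reference are divided by the
    weights. A fixed point is an exact solution.\<close>
  define Tf where "Tf x t = ((1 / decay \<tau> t) *\<^sub>R (Ap x t - ar t),
    (\<alpha> / \<mu> / decay \<tau> t) *\<^sub>R (Ep x t - er t), (1 / (\<nu> * decay \<tau> t)) *\<^sub>R (Bp x t - br t))" for x t
  have step:
    "norm (V x t - V x' t) \<le> dist x x' / \<alpha> * decay \<tau> t"
    "norm (Ap x t - Ap x' t) \<le> 1 / 8 * dist x x' * decay \<tau> t"
    "norm (Ep x t - Ep x' t) \<le> \<mu> / \<alpha> / 8 * dist x x' * decay \<tau> t"
    "norm (Bp x t - Bp x' t) \<le> \<nu> / 8 * dist x x' * decay \<tau> t"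
    if x: "x \<in> S" "x' \<in> S" for x x' t
  proof -
    define N where "N = dist x x' / \<alpha>"
    have D: "norm (fst (x t) - fst (x' t)) \<le> dist x x'" "norm (fst (snd (x t)) - fst (snd (x' t))) \<le> dist x x'"
      "norm (snd (snd (x t)) - snd (snd (x' t))) \<le> dist x x'" for t
      using comp[of "x t - x' t"] dist_bounded[of x t x'] by (auto simp: dist_norm)
    have N1: "norm (\<Phi> x t - \<Phi> x' t) \<le> N * decay \<tau> t" for t
      unfolding N_def decay_def
    proof (rule decay_from_derivative[OF \<alpha>(1)])
      show "((\<lambda>t. \<Phi> x t - \<Phi> x' t) has_vector_derivative
          decay \<tau> t *\<^sub>R fst (x t) - decay \<tau> t *\<^sub>R fst (x' t)) (at t)" for t
        using has_vector_derivative_diff[OF \<Phi>(1)[OF x(1)] \<Phi>(1)[OF x(2)]] by simp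
      show "norm (decay \<tau> t *\<^sub>R fst (x t) - decay \<tau> t *\<^sub>R fst (x' t)) \<le> dist x x' * exp (- \<alpha> * (t - \<tau>))" for t
        using mult_left_mono[OF D(1)[of t], of "decay \<tau> t"] decay_pos[of \<tau> t]
        by (simp add: scaleR_diff_right[symmetric] decay_def mult.commute)
      show "((\<lambda>t. \<Phi> x t - \<Phi> x' t) \<longlongrightarrow> 0) at_top"
      proof (rule exp_decay_imp_tendsto_0[OF \<alpha>(1)])
        show "norm (\<Phi> x t - \<Phi> x' t) \<le> (norm x / \<alpha> + norm x' / \<alpha>) * exp (- \<alpha> * (t - \<tau>))" for t
          using norm_triangle_le_diff[OF add_mono[OF \<Phi>(2)[OF x(1), of t] \<Phi>(2)[OF x(2), of t]]]
          by (simp add: decay_def algebra_simps)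
      qed
    qed
    have N2: "norm (ex x t - ex x' t) \<le> \<mu> * N * decay \<tau> t" for t
      using mult_left_mono[OF D(2)[of t], of "\<mu> / \<alpha> * decay \<tau> t"] decay_pos[of \<tau> t] constants(6) \<alpha>(1)
      by (simp add: ex_def N_def scaleR_diff_right[symmetric] abs_mult mult_ac)
    have N3: "norm (P x t - P x' t) \<le> \<nu> * N * decay \<tau> t" for t
    proof -
      have "norm (P x t - P x' t) \<le> (\<nu> * dist x x') / \<alpha> * exp (- \<alpha> * (t - \<tau>))"
      proof (rule decay_from_derivative[OF \<alpha>(1)])
        show "((\<lambda>t. P x t - P x' t) has_vector_derivative
            (\<nu> * decay \<tau> t) *\<^sub>R snd (snd (x t)) - (\<nu> * decay \<tau> t) *\<^sub>R snd (snd (x' t))) (at t)" for t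
          using has_vector_derivative_diff[OF P(1)[OF x(1)] P(1)[OF x(2)]] by simp
        show "norm ((\<nu> * decay \<tau> t) *\<^sub>R snd (snd (x t)) - (\<nu> * decay \<tau> t) *\<^sub>R snd (snd (x' t)))
            \<le> (\<nu> * dist x x') * exp (- \<alpha> * (t - \<tau>))" for t
          using mult_left_mono[OF D(3)[of t], of "\<nu> * decay \<tau> t"] decay_pos[of \<tau> t] constants(7)
          by (simp add: scaleR_diff_right[symmetric] decay_def abs_mult mult_ac)
        show "((\<lambda>t. P x t - P x' t) \<longlongrightarrow> 0) at_top"
        proof (rule exp_decay_imp_tendsto_0[OF \<alpha>(1)])
          show "norm (P x t - P x' t) \<le> (\<nu> * norm x / \<alpha> + \<nu> * norm x' / \<alpha>) * exp (- \<alpha> * (t - \<tau>))" for t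
            using norm_triangle_le_diff[OF add_mono[OF P(2)[OF x(1), of t] P(2)[OF x(2), of t]]]
            by (simp add: decay_def algebra_simps)
        qed
      qed
      then show ?thesis by (simp add: N_def decay_def)
    qed
    note st = configuration_step[OF conf[OF x(1)] conf[OF x(2)] N1 N2 N3]
    show "norm (V x t - V x' t) \<le> dist x x' / \<alpha> * decay \<tau> t"
      using st(1)[of t] by (simp add: N_def)
    show "norm (Ap x t - Ap x' t) \<le> 1 / 8 * dist x x' * decay \<tau> t"
      using st(2)[of t] \<alpha>(1) by (simp add: N_def Ap_def)
    show "norm (Ep x t - Ep x' t) \<le> \<mu> / \<alpha> / 8 * dist x x' * decay \<tau> t"
      using st(3)[of t] by (simp add: N_def Ep_def Y_def mult_ac)
    show "norm (Bp x t - Bp x' t) \<le> \<nu> / 8 * dist x x' * decay \<tau> t"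
      using st(4)[of t] \<alpha>(1) by (simp add: N_def Bp_def Y_def mult_ac)
  qed
  have Tf_diff: "norm (Tf x t - Tf x' t) \<le> 3 / 8 * dist x x'" if x: "x \<in> S" "x' \<in> S" for x x' t
  proof -
    have pos: "decay \<tau> t > 0" by (rule decay_pos)
    have "norm ((1 / decay \<tau> t) *\<^sub>R (Ap x t - Ap x' t)) \<le> 1 / 8 * dist x x'"
      unfolding norm_scaleR using step(2)[OF x, of t] pos by (simp add: field_simps)
    moreover have "norm ((\<alpha> / \<mu> / decay \<tau> t) *\<^sub>R (Ep x t - Ep x' t)) \<le> 1 / 8 * dist x x'"
      unfolding norm_scaleR using step(3)[OF x, of t] pos \<alpha>(1) constants(6)
      by (simp add: field_simps abs_mult)
    moreover have "norm ((1 / (\<nu> * decay \<tau> t)) *\<^sub>R (Bp x t - Bp x' t)) \<le> 1 / 8 * dist x x'"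
      unfolding norm_scaleR using step(4)[OF x, of t] pos constants(7)
      by (simp add: field_simps abs_mult)
    moreover have eq: "Tf x t - Tf x' t = ((1 / decay \<tau> t) *\<^sub>R (Ap x t - Ap x' t),
        (\<alpha> / \<mu> / decay \<tau> t) *\<^sub>R (Ep x t - Ep x' t), (1 / (\<nu> * decay \<tau> t)) *\<^sub>R (Bp x t - Bp x' t))"
      by (simp add: Tf_def algebra_simps)
    ultimately show ?thesis
      unfolding eq by (intro order_trans[OF norm_triple_le]) linarith
  qed
  have ax0: "ax 0 = ar" and ex0: "ex 0 = er" by (auto simp: ax_def ex_def)
  have "0 \<in> S" using c er by (simp add: S_def ax0 ex0 configuration_def)
  have \<Phi>0: "\<Phi> 0 = \<phi>r" and P0: "P 0 = pr"
    using \<Phi>(2)[OF \<open>0 \<in> S\<close>] P(2)[OF \<open>0 \<in> S\<close>] by (auto simp: fun_eq_iff)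
  have V0: "V 0 = vr"
    using configuration_unique[OF conf[OF \<open>0 \<in> S\<close>, unfolded \<Phi>0 ax0 ex0] c] .
  define c1 where "c1 = \<alpha> / \<mu> * (B + d) + 4 * B / \<nu>"
  have norm_force: "norm (\<epsilon> *\<^sub>R F z) \<le> B" "norm (\<epsilon> *\<^sub>R G z) \<le> B" "norm (sitewise g w) \<le> B" for z w
    using mult_mono[OF constants(8) F_bound[of z]] mult_mono[OF constants(8) G_bound[of z]] norm_sitewise[OF g_bound]
      constants by auto
  have Tf0: "norm (Tf 0 t) \<le> c1" for t
  proof -
    have A0: "Ap 0 t - ar t = 0" by (simp add: Ap_def \<Phi>0 V0 ar)
    have "c1 \<ge> 0" using constants \<alpha>(1) by (simp add: c1_def)
    show ?thesis
    \<comment> \<open>From \<tau> on the reference is exact and its defect vanishes. Before \<tau>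
      the defect is merely bounded, and division by a weight of at least 1 does not enlarge
      it.\<close>
    proof (cases "t \<ge> \<tau>")
      case True
      then have "Ep 0 t - er t = 0" "Bp 0 t - br t = 0"
        using exact[of t] by (simp_all add: Ep_def Bp_def Y_def \<Phi>0 V0 P0)
      then show ?thesis using A0 \<open>c1 \<ge> 0\<close> by (simp add: Tf_def zero_prod_def[symmetric])
    next
      case False
      then have ge1: "decay \<tau> t \<ge> 1" by (intro decay_ge_1) simp
      have "norm (er t) \<le> d"
      proof (rule norm_bound)
        fix k
        have "d / (4 * C) \<le> d" using constants by (simp add: field_simps)
        then show "norm (er t k) \<le> d" using er[of t k] by linarith
      qed
      then have "norm (Ep 0 t - er t) \<le> B + d"
        unfolding Ep_def by (intro norm_triangle_le_diff add_mono norm_force)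
      moreover have "norm (Bp 0 t - br t) \<le> ((B + B) + 2 * B)"
        unfolding Bp_def by (intro norm_triangle_le_diff add_mono norm_triangle_le norm_force br)
      moreover have "\<bar>\<alpha> / \<mu> / decay \<tau> t\<bar> \<le> \<alpha> / \<mu>" "\<bar>1 / (\<nu> * decay \<tau> t)\<bar> \<le> 1 / \<nu>"
        using ge1 constants(6,7) \<alpha>(1) by (simp_all add: field_simps)
      ultimately have "norm ((\<alpha> / \<mu> / decay \<tau> t) *\<^sub>R (Ep 0 t - er t)) \<le> \<alpha> / \<mu> * (B + d)"
        "norm ((1 / (\<nu> * decay \<tau> t)) *\<^sub>R (Bp 0 t - br t)) \<le> 1 / \<nu> * ((B + B) + 2 * B)"
        unfolding norm_scaleR using constants(7) ratios(2) by (intro mult_mono; simp)+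
      then show ?thesis
        unfolding Tf_def A0 c1_def by (intro order_trans[OF norm_triple_le]) simp
    qed
  qed
  have Tf_bcontfun: "Tf x \<in> bcontfun" if "x \<in> S" for x
  proof (rule bcontfun_normI)
    show "continuous_on UNIV (Tf x)"
      unfolding Tf_def Ap_def Ep_def Bp_def Y_def
      using decay_pos[of \<tau>] constants
      by (intro continuous_intros continuous_on_sitewise_g continuous_on_F continuous_on_G
          configuration_continuous[OF conf[OF that] ex_bd[OF that]] P_cont[OF that] ar_cont er_cont br(1))
         (auto simp: less_imp_neq[symmetric])
    show "norm (Tf x t) \<le> 3 / 8 * dist x 0 + c1" for t
      using norm_triangle_sub[of "Tf x t" "Tf 0 t"] Tf_diff[OF that \<open>0 \<in> S\<close>, of t] Tf0[of t] by linarith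
  qed
  define T where "T x = Bcontfun (Tf x)" for x
  have T: "T x t = Tf x t" if "x \<in> S" for x t
    using Bcontfun_inverse[OF Tf_bcontfun[OF that]] by (simp add: T_def)
  have "\<exists>!x\<in>S. T x = x"
  proof (rule Banach_fix)
    have "continuous_on UNIV (\<lambda>x. apply_bcontfun (ax x t) k)" "continuous_on UNIV (\<lambda>x. apply_bcontfun (ex x t) k)" for t k
      unfolding ax_def ex_def
      by (intro continuous_on_apply_linf continuous_intros
          bounded_linear.continuous_on[OF bounded_linear_apply_bcontfun])+
    then have "closed S"
      unfolding S_def
      by (intro closed_Collect_all closed_Collect_conj closed_Collect_le continuous_intros) auto
    then show "complete S" by (simp add: complete_eq_closed)
    show "S \<noteq> {}" using \<open>0 \<in> S\<close> by auto
    show "T ` S \<subseteq> S"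
    proof safe
      fix x assume x: "x \<in> S"
      have "ax (T x) t = Ap x t" for t
        using decay_pos[of \<tau> t] by (simp add: ax_def T[OF x] Tf_def)
      moreover have "ex (T x) t = Ep x t" for t
        using decay_pos[of \<tau> t] constants \<alpha>(1) by (simp add: ex_def T[OF x] Tf_def)
      moreover have "\<bar>Ap x t k\<bar> \<le> 1 / (32 * C * M * B)" for t k
      proof -
        have "\<bar>Ap x t k\<bar> \<le> M * d"
          using conf[OF x] constants unfolding Ap_def apply_rate configuration_def
          by (intro order_trans[OF rate_component_bound] mult_left_mono) auto
        then show ?thesis using small_d(2) by linarith
      qed
      moreover have "norm (Ep x t k) \<le> d / (4 * C)" for t k
      proof -
        have "norm (Ep x t k) \<le> norm (Ep x t)" by (rule norm_bounded)
        also have "\<dots> \<le> \<bar>\<epsilon>\<bar> * B" unfolding Ep_def norm_scaleR by (intro mult_left_mono F_bound) auto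
        also have "\<dots> \<le> d / (4 * C)" using small_\<epsilon>(2) constants by (simp add: field_simps)
        finally show ?thesis .
      qed
      ultimately show "T x \<in> S" by (simp add: S_def)
    qed
    show "dist (T x) (T x') \<le> 3 / 8 * dist x x'" if "x \<in> S" "x' \<in> S" for x x'
    proof (rule dist_bound)
      show "dist (T x t) (T x' t) \<le> 3 / 8 * dist x x'" for t
        using Tf_diff[OF that, of t] by (simp add: T that dist_norm)
    qed
  qed auto
  then obtain x where x: "x \<in> S" "T x = x" by blast
  \<comment> \<open>The distance of the fixed point from 0, that is from the reference curve, is
    controlled by the defect of 0 under a map with contraction factor 3/8.\<close>
  have norm_x: "norm x \<le> 2 * c1"
  proof -
    have "norm (x t) \<le> 3 / 8 * norm x + c1" for t
    proof -
      have "norm (Tf x t) \<le> 3 / 8 * dist x 0 + c1"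
        using norm_triangle_sub[of "Tf x t" "Tf 0 t"] Tf_diff[OF x(1) \<open>0 \<in> S\<close>, of t] Tf0[of t] by linarith
      then show ?thesis using T[OF x(1), of t] by (simp add: x(2))
    qed
    then have "norm x \<le> 3 / 8 * norm x + c1" by (rule norm_bound)
    moreover have "norm x \<ge> 0" "c1 \<ge> 0" using order_trans[OF norm_ge_zero Tf0] by auto
    ultimately show ?thesis by linarith
  qed
  have const: "norm x / \<alpha> \<le> shadow_const"
    using divide_right_mono[OF norm_x, of \<alpha>] \<alpha>(1) by (simp add: shadow_const_def c1_def)
  have fx: "x t = Tf x t" for t using T[OF x(1), of t] by (simp add: x(2))
  have a_fix: "ax x = Ap x"
    using decay_pos[of \<tau>] by (auto simp: ax_def fx Tf_def fun_eq_iff less_imp_neq[symmetric])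
  have e_fix: "ex x = Ep x"
    using decay_pos[of \<tau>] constants \<alpha>(1) by (auto simp: ex_def fx Tf_def fun_eq_iff less_imp_neq[symmetric])
  have dc: "norm x / \<alpha> * decay \<tau> t \<le> shadow_const * decay \<tau> t" for t
    using const decay_pos[of \<tau> t] by (intro mult_right_mono) auto
  show ?thesis
  proof (intro exI conjI allI)
    show "configuration (\<Phi> x) (\<lambda>t. rate (\<Phi> x t) (V x t)) (\<lambda>t. \<epsilon> *\<^sub>R F (pos (\<Phi> x t) (V x t), P x t)) (V x)"
      using conf[OF x(1)] unfolding a_fix e_fix Ap_def Ep_def Y_def .
    fix t
    have "((\<lambda>t. (P x t - pr t) + pr t) has_vector_derivative (\<nu> * decay \<tau> t) *\<^sub>R snd (snd (x t)) + br t) (at t)"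
      by (rule has_vector_derivative_add[OF P(1)[OF x(1)] pr])
    moreover have "(\<nu> * decay \<tau> t) *\<^sub>R snd (snd (x t)) + br t = Bp x t"
      using decay_pos[of \<tau> t] constants by (simp add: fx[of t] Tf_def)
    ultimately show "(P x has_vector_derivative sitewise g (pos (\<Phi> x t) (V x t)) + \<epsilon> *\<^sub>R G (pos (\<Phi> x t) (V x t), P x t)) (at t)"
      by (simp add: Bp_def Y_def)
    show "norm (\<Phi> x t - \<phi>r t) \<le> shadow_const * decay \<tau> t"
      using \<Phi>(2)[OF x(1), of t] dc[of t] by linarith
    show "norm (V x t - vr t) \<le> shadow_const * decay \<tau> t"
      using step(1)[OF x(1) \<open>0 \<in> S\<close>, of t] dc[of t] by (simp add: V0)
    show "norm (P x t - pr t) \<le> \<nu> * shadow_const * decay \<tau> t"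
      using P(2)[OF x(1), of t] mult_left_mono[OF dc[of t], of \<nu>] constants by (simp add: mult.assoc)
  qed
qed

end

section \<open>Curves near given orbits as configurations, and uniqueness of solutions\<close>

context coupled_lattice
begin

lemma configuration_bound:
  assumes "configuration \<phi> a e v" "\<And>t k. norm (e t k) \<le> E"
  shows "norm (v t k) \<le> 4 * C * E"
proof -
  interpret hyperbolic_orbit_modulus "f k" "A k" "x k" "ys k" B M C \<kappa> d by (rule site)
  show ?thesis
    by (rule forced_bound[where \<phi> = "\<lambda>t. \<phi> t k" and a = "\<lambda>t. a t k" and e = "\<lambda>t. e t k" and v = "\<lambda>t. v t k"])
       (use assms in \<open>auto simp: configuration_def intro: continuous_on_apply_linf\<close>)
qed

lemma continuous_on_rate:
  assumes \<phi>: "continuous_on UNIV \<phi>" and v: "continuous_on UNIV v" and vd: "\<And>t. norm (v t) \<le> d"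
  shows "continuous_on UNIV (\<lambda>t::real. rate (\<phi> t) (v t))"
proof -
  have "((\<lambda>s. rate (\<phi> s) (v s)) \<longlongrightarrow> rate (\<phi> t) (v t)) (at t)" for t
  proof (rule LIM_zero_cancel, rule Lim_null_comparison)
    show "\<forall>\<^sub>F s in at t. norm (rate (\<phi> s) (v s) - rate (\<phi> t) (v t)) \<le> M * norm (v s - v t) + M * B * d * norm (\<phi> s - \<phi> t)"
      using rate_diff[OF vd] by simp
    have "(\<phi> \<longlongrightarrow> \<phi> t) (at t)" "(v \<longlongrightarrow> v t) (at t)"
      using \<phi> v by (auto simp: continuous_on_def)
    then have "((\<lambda>s. M * norm (v s - v t) + M * B * d * norm (\<phi> s - \<phi> t)) \<longlongrightarrow>
        M * norm (v t - v t) + M * B * d * norm (\<phi> t - \<phi> t)) (at t)"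
      by (intro tendsto_intros)
    then show "((\<lambda>s. M * norm (v s - v t) + M * B * d * norm (\<phi> s - \<phi> t)) \<longlongrightarrow> 0) (at t)" by simp
  qed
  then show ?thesis by (simp add: continuous_on_def)
qed

text \<open>The value of \<open>tracking_const\<close>, written out in \<open>B\<close> and
  \<open>M\<close> so that it is visibly common to all sites and trajectories.\<close>

definition phase_const :: real where "phase_const = 8 * M * B\<^sup>2 * (4 * M * exp (B + 1))"

text \<open>\<open>phase_exists\<close> applies at every site with the same constants. The exact
  phases differ from \<Phi> by a uniformly bounded amount, so they again form a bounded sequence,
  and the displacement is what remains of \<open>y\<close>.\<close>

lemma configuration_of_tracking:
  assumes y: "\<And>t. (y has_vector_derivative sitewise f (y t) + e t) (at t)"
    and e: "continuous_on UNIV e" "\<And>t. norm (e t) \<le> \<epsilon>'"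
    and \<Phi>: "continuous_on UNIV \<Phi>" "\<And>t. norm (y t - sitewise x (\<Phi> t)) \<le> \<delta>"
    and small: "phase_const * (\<delta> + \<epsilon>') \<le> 1 / (12 * M * B\<^sup>2)" "phase_const * (\<delta> + \<epsilon>') \<le> d"
  shows "\<exists>\<phi> v. configuration \<phi> (\<lambda>t. rate (\<phi> t) (v t)) e v \<and> (\<forall>t. y t = pos (\<phi> t) (v t)) \<and>
    (\<forall>t. norm (\<phi> t - \<Phi> t) \<le> phase_const * (\<delta> + \<epsilon>'))"
proof -
  define q where "q = phase_const * (\<delta> + \<epsilon>')"
  have y': "((\<lambda>t. apply_bcontfun (y t) k) has_vector_derivative f k (y t k) + e t k) (at t)" for t k
    using apply_linf_has_vector_derivative[OF y[of t], of k]
    by (simp add: apply_sitewise_bounded[where h = f, OF f_bound])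
  have "\<exists>\<phi>. (\<forall>t. (\<phi> has_real_derivative 1 + ys k (\<phi> t) \<bullet> (y t k - x k (\<phi> t))) (at t)) \<and>
    (\<forall>t. \<bar>\<phi> t - \<Phi> t k\<bar> \<le> q) \<and> (\<forall>t. norm (y t k - x k (\<phi> t)) \<le> q)" for k
  proof -
    have e_k: "norm (e t k) \<le> \<epsilon>'" for t using norm_bounded[of "e t" k] e(2)[of t] by linarith
    have \<Phi>_k: "norm (y t k - x k (\<Phi> t k)) \<le> \<delta>" for t
      using norm_bounded[of "y t - sitewise x (\<Phi> t)" k] \<Phi>(2)[of t]
      by (simp add: apply_sitewise_bounded[where h = x, OF x_bound])
    interpret hyperbolic_orbit_modulus "f k" "A k" "x k" "ys k" B M C \<kappa> d by (rule site)
    have tracking_const: "tracking_const = phase_const" by (simp add: tracking_const_def speed_const_def phase_const_def)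
    show ?thesis
      using phase_exists[where y = "\<lambda>t. y t k" and e = "\<lambda>t. e t k" and \<Phi> = "\<lambda>t. \<Phi> t k", OF y' e_k
          continuous_on_apply_linf[OF \<Phi>(1)] \<Phi>_k] small(1)
      unfolding tracking_const q_def H_def by blast
  qed
  then obtain \<psi> where \<psi>: "\<And>k t. (\<psi> k has_real_derivative 1 + ys k (\<psi> k t) \<bullet> (y t k - x k (\<psi> k t))) (at t)"
    "\<And>k t. \<bar>\<psi> k t - \<Phi> t k\<bar> \<le> q" "\<And>k t. norm (y t k - x k (\<psi> k t)) \<le> q" by metis
  define \<phi> where "\<phi> t = Bcontfun (\<lambda>k. \<psi> k t)" for t
  have \<phi>_k: "\<phi> t k = \<psi> k t" for t k
    unfolding \<phi>_def
  proof (rule apply_Bcontfun_int)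
    show "norm (\<psi> k t) \<le> norm (\<Phi> t) + q" for k
      using \<psi>(2)[of k t] norm_bounded[of "\<Phi> t" k] by simp
  qed
  define v where "v t = y t - sitewise x (\<phi> t)" for t
  have v_k: "v t k = y t k - x k (\<psi> k t)" for t k
    by (simp add: v_def apply_sitewise_bounded[where h = x, OF x_bound] \<phi>_k)
  have vd: "norm (v t k) \<le> d" for t k using \<psi>(3)[of t k] small(2) by (simp add: v_k q_def)
  have rate_k: "rate (\<phi> t) (v t) k = ys k (\<psi> k t) \<bullet> (y t k - x k (\<psi> k t))" for t k
    by (simp add: apply_rate \<phi>_k v_k)
  have rate_b: "\<bar>rate (\<phi> t) (v t) k\<bar> \<le> 1 / (32 * C * M * B)" for t k
  proof -
    have "\<bar>rate (\<phi> t) (v t) k\<bar> \<le> M * d"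
      unfolding apply_rate using vd constants by (intro order_trans[OF rate_component_bound] mult_left_mono) auto
    then show ?thesis using small_d(2) by linarith
  qed
  have "C * M * B \<ge> 1" using constants by (simp add: mult_ge1_I)
  then have le1: "1 / (32 * C * M * B) \<le> 1" by (simp add: field_simps)
  have cont\<phi>: "continuous_on UNIV \<phi>"
  proof (rule linf_Lipschitz_continuous_on)
    show "norm (\<phi> s k - \<phi> t k) \<le> 2 * \<bar>s - t\<bar>" for s t k
      unfolding \<phi>_k
    proof (rule vector_derivative_Lipschitz[OF \<psi>(1)[unfolded has_real_derivative_iff_has_vector_derivative]])
      show "norm (1 + ys k (\<psi> k t) \<bullet> (y t k - x k (\<psi> k t))) \<le> 2" for t
        using rate_b[of t k] le1 unfolding rate_k real_norm_def by linarith
    qed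
  qed
  have conty: "continuous_on UNIV y"
    by (intro continuous_at_imp_continuous_on ballI has_vector_derivative_continuous[OF y])
  have contv: "continuous_on UNIV v"
    unfolding v_def
  proof (intro continuous_intros conty)
    have "continuous_on UNIV (sitewise x)"
      by (rule Lipschitz_imp_continuous_on[OF sitewise_Lipschitz[where h = x, OF x_bound x_Lipschitz]])
         (use constants in simp)
    then show "continuous_on UNIV (\<lambda>t. sitewise x (\<phi> t))"
      using cont\<phi> by (rule continuous_on_compose2) simp
  qed
  have "configuration \<phi> (\<lambda>t. rate (\<phi> t) (v t)) e v"
    unfolding configuration_def
  proof (intro conjI allI)
    show "continuous_on UNIV (\<lambda>t. rate (\<phi> t) (v t))"
      by (rule continuous_on_rate[OF cont\<phi> contv norm_bound]) (rule vd)
    fix t k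
    show \<phi>': "((\<lambda>t. apply_bcontfun (\<phi> t) k) has_real_derivative 1 + rate (\<phi> t) (v t) k) (at t)"
      using \<psi>(1)[of k t] by (simp add: \<phi>_k rate_k)
    interpret hyperbolic_orbit_modulus "f k" "A k" "x k" "ys k" B M C \<kappa> d by (rule site)
    have "((\<lambda>t. x k (\<psi> k t)) has_vector_derivative
        (1 + ys k (\<psi> k t) \<bullet> (y t k - x k (\<psi> k t))) *\<^sub>R f k (x k (\<psi> k t))) (at t)"
      using vector_diff_chain_at[OF \<psi>(1)[unfolded has_real_derivative_iff_has_vector_derivative] orbit]
      by (simp add: o_def)
    from has_vector_derivative_diff[OF y'[where k = k] this]
    show "((\<lambda>t. apply_bcontfun (v t) k) has_vector_derivative rhs (\<phi> t k) (v t k) + e t k) (at t)"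
      by (simp add: v_k \<phi>_k rhs_def algebra_simps)
  qed (use e vd rate_b in auto)
  moreover have "y t = pos (\<phi> t) (v t)" for t by (simp add: pos_def v_def)
  moreover have "norm (\<phi> t - \<Phi> t) \<le> q" for t
    by (rule norm_bound) (use \<psi>(2) in \<open>simp add: \<phi>_k\<close>)
  ultimately show ?thesis unfolding q_def by blast
qed

lemma linear_le_exp: "c + K * s \<le> (c + K / \<alpha>) * exp (\<alpha> * s)" if "s \<ge> 0" "c \<ge> 0" "K \<ge> 0"
proof -
  have "c * 1 \<le> c * exp (\<alpha> * s)" using that \<alpha>(1) by (intro mult_left_mono) auto
  moreover have "K / \<alpha> * (\<alpha> * s) \<le> K / \<alpha> * exp (\<alpha> * s)"
    using that \<alpha>(1) exp_ge_add_one_self[of "\<alpha> * s"] by (intro mult_left_mono) (linarith | simp)+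
  ultimately show ?thesis using \<alpha>(1) by (simp add: distrib_right)
qed

text \<open>A bounded derivative allows at most linear growth into the past, which the exponential
  weight dominates. Thus a decay estimate on a half-line extends to the whole line with a larger
  constant.\<close>

lemma backward_growth:
  fixes h :: "real \<Rightarrow> 'c::real_normed_vector"
  assumes h: "\<And>t. (h has_vector_derivative h' t) (at t)" "\<And>t. norm (h' t) \<le> K"
    and c: "\<And>t. t \<ge> T \<Longrightarrow> norm (h t) \<le> c * decay T t"
  shows "norm (h t) \<le> (c + K / \<alpha>) * decay T t"
proof -
  have nonneg: "K \<ge> 0" "c \<ge> 0"
    using order_trans[OF norm_ge_zero h(2)] order_trans[OF norm_ge_zero c[of T]] by (auto simp: decay_def)
  show ?thesis
  proof (cases "t \<ge> T")
    case True
    have "c * decay T t \<le> (c + K / \<alpha>) * decay T t"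
      using nonneg \<alpha>(1) decay_pos[of T t] by (intro mult_right_mono) auto
    then show ?thesis using c[OF True] by linarith
  next
    case False
    have "norm (h t) \<le> norm (h T) + norm (h t - h T)" using norm_triangle_sub[of "h t" "h T"] by simp
    also have "\<dots> \<le> c + K * (T - t)"
      using c[of T] vector_derivative_Lipschitz[OF h, of t T] False by (simp add: decay_def)
    also have "\<dots> \<le> (c + K / \<alpha>) * exp (\<alpha> * (T - t))"
      using False nonneg by (intro linear_le_exp) auto
    also have "exp (\<alpha> * (T - t)) = decay T t" by (simp add: decay_def algebra_simps)
    finally show ?thesis .
  qed
qed

lemma norm_coupling: "norm (\<epsilon> *\<^sub>R F z) \<le> B" "norm (sitewise g w + \<epsilon> *\<^sub>R G z) \<le> 2 * B"
proof -
  show "norm (\<epsilon> *\<^sub>R F z) \<le> B" using mult_mono[OF constants(8) F_bound[of z]] constants by simp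
  have "norm (\<epsilon> *\<^sub>R G z) \<le> B" using mult_mono[OF constants(8) G_bound[of z]] constants by simp
  then show "norm (sitewise g w + \<epsilon> *\<^sub>R G z) \<le> 2 * B"
    using norm_sitewise[where h = g and u = w, OF g_bound] by (intro norm_triangle_le) simp
qed

lemma decay_tendsto_0:
  fixes h :: "real \<Rightarrow> 'c::real_normed_vector"
  shows "(\<And>t. norm (h t) \<le> c * decay \<tau> t) \<Longrightarrow> (h \<longlongrightarrow> 0) at_top"
  using exp_decay_imp_tendsto_0[OF \<alpha>(1), of 0 h c \<tau>] by (simp add: decay_def)

text \<open>Forward in time the phases of the two solutions approach each other because the phase equation is stable;
  backward in time the differences grow at most linearly. So all weighted differences are finite, and
  \<open>configuration_step\<close> shrinks them.\<close>

theorem asymptotic_uniqueness: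
  assumes c: "configuration \<phi> (\<lambda>t. rate (\<phi> t) (v t)) (\<lambda>t. \<epsilon> *\<^sub>R F (pos (\<phi> t) (v t), p t)) v"
    and c': "configuration \<phi>' (\<lambda>t. rate (\<phi>' t) (v' t)) (\<lambda>t. \<epsilon> *\<^sub>R F (pos (\<phi>' t) (v' t), p' t)) v'"
    and p: "\<And>t. (p has_vector_derivative sitewise g (pos (\<phi> t) (v t)) + \<epsilon> *\<^sub>R G (pos (\<phi> t) (v t), p t)) (at t)"
    and p': "\<And>t. (p' has_vector_derivative sitewise g (pos (\<phi>' t) (v' t)) + \<epsilon> *\<^sub>R G (pos (\<phi>' t) (v' t), p' t)) (at t)"
    and yT: "\<And>t. t \<ge> T \<Longrightarrow> norm (pos (\<phi> t) (v t) - pos (\<phi>' t) (v' t)) \<le> c0 * decay T t"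
    and pT: "\<And>t. t \<ge> T \<Longrightarrow> norm (p t - p' t) \<le> c0 * decay T t"
    and \<phi>T: "\<And>t. t \<ge> T \<Longrightarrow> norm (\<phi> t - \<phi>' t) \<le> l"
    and small: "M * B * d + M * B\<^sup>2 * l \<le> 1 / 2"
  shows "\<phi> = \<phi>' \<and> v = v' \<and> p = p'"
proof -
  define e where "e t = \<epsilon> *\<^sub>R F (pos (\<phi> t) (v t), p t)" for t
  define e' where "e' t = \<epsilon> *\<^sub>R F (pos (\<phi>' t) (v' t), p' t)" for t
  have c0: "c0 \<ge> 0" using order_trans[OF norm_ge_zero pT[of T]] by (simp add: decay_def)
  have \<alpha>16: "\<alpha> \<le> 1 / 16"
    using order_trans[OF \<alpha>(2), of "1 / 16"] constants by simp
  define l1 where "l1 = l + 4 * M * c0"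
  have \<phi>1: "norm (\<phi> t - \<phi>' t) \<le> l1 * decay T t" if "t \<ge> T" for t
  proof (rule norm_bound)
    fix k
    have yk: "norm (x k (\<phi> t k) + v t k - (x k (\<phi>' t k) + v' t k)) \<le> c0 * exp (- \<alpha> * (t - T))" if "T \<le> t" for t
      using norm_bounded[of "pos (\<phi> t) (v t) - pos (\<phi>' t) (v' t)" k] yT[OF that] by (simp add: apply_pos decay_def)
    have \<phi>k: "\<bar>\<phi> t k - \<phi>' t k\<bar> \<le> l" if "T \<le> t" for t
      using norm_bounded[of "\<phi> t - \<phi>' t" k] \<phi>T[OF that] by simp
    have c_k: "((\<lambda>t. apply_bcontfun (\<phi> t) k) has_real_derivative 1 + ys k (\<phi> t k) \<bullet> v t k) (at t)"
      "((\<lambda>t. apply_bcontfun (\<phi>' t) k) has_real_derivative 1 + ys k (\<phi>' t k) \<bullet> v' t k) (at t)"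
      "norm (v t k) \<le> d" for t
      using c c' unfolding configuration_def apply_rate by blast+
    interpret hyperbolic_orbit_modulus "f k" "A k" "x k" "ys k" B M C \<kappa> d by (rule site)
    have "\<bar>\<phi> t k - \<phi>' t k\<bar> \<le> (l + 4 * M * c0) * exp (- \<alpha> * (t - T))"
    proof (rule phase_decay[where y = "\<lambda>t. x k (\<phi> t k) + v t k" and y' = "\<lambda>t. x k (\<phi>' t k) + v' t k"
          and \<phi> = "\<lambda>t. \<phi> t k" and \<phi>' = "\<lambda>t. \<phi>' t k" and p = d and l = l and T = T and c = c0 and \<alpha> = \<alpha>])
    qed (use c_k yk \<phi>k small \<alpha>16 that in \<open>auto simp: H_def\<close>)
    then show "norm (apply_bcontfun (\<phi> t - \<phi>' t) k) \<le> l1 * decay T t" by (simp add: l1_def decay_def)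
  qed
  have \<phi>': "((\<lambda>t. \<phi> t - \<phi>' t) has_vector_derivative rate (\<phi> t) (v t) - rate (\<phi>' t) (v' t)) (at t)" for t
  proof (rule linf_has_vector_derivative)
    show "continuous_on UNIV (\<lambda>t. rate (\<phi> t) (v t) - rate (\<phi>' t) (v' t))"
      using c c' unfolding configuration_def by (intro continuous_intros) blast+
    show "((\<lambda>t. apply_bcontfun (\<phi> t - \<phi>' t) k) has_vector_derivative
        apply_bcontfun (rate (\<phi> t) (v t) - rate (\<phi>' t) (v' t)) k) (at t)" for t k
    proof -
      have "((\<lambda>t. apply_bcontfun (\<phi> t) k) has_vector_derivative 1 + rate (\<phi> t) (v t) k) (at t)"
        "((\<lambda>t. apply_bcontfun (\<phi>' t) k) has_vector_derivative 1 + rate (\<phi>' t) (v' t) k) (at t)"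
        using c c' unfolding configuration_def has_real_derivative_iff_has_vector_derivative by blast+
      from has_vector_derivative_diff[OF this] show ?thesis by simp
    qed
  qed
  have p'': "((\<lambda>t. p t - p' t) has_vector_derivative
      (sitewise g (pos (\<phi> t) (v t)) + \<epsilon> *\<^sub>R G (pos (\<phi> t) (v t), p t)) -
      (sitewise g (pos (\<phi>' t) (v' t)) + \<epsilon> *\<^sub>R G (pos (\<phi>' t) (v' t), p' t))) (at t)" for t
    by (rule has_vector_derivative_diff[OF p p'])
  have "C * M * B \<ge> 1" using constants by (simp add: mult_ge1_I)
  then have le1: "1 / (32 * C * M * B) \<le> 1" by (simp add: field_simps)
  have rate1: "norm (rate (\<phi> t) (v t)) \<le> 1" "norm (rate (\<phi>' t) (v' t)) \<le> 1" for t
  proof -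
    have "\<bar>rate (\<phi> t) (v t) k\<bar> \<le> 1 / (32 * C * M * B)" "\<bar>rate (\<phi>' t) (v' t) k\<bar> \<le> 1 / (32 * C * M * B)" for k
      using c c' unfolding configuration_def by blast+
    then show "norm (rate (\<phi> t) (v t)) \<le> 1" "norm (rate (\<phi>' t) (v' t)) \<le> 1"
      unfolding real_norm_def[symmetric] using le1 by (meson norm_bound order_trans)+
  qed
  define N1 where "N1 = l1 + (1 + 1) / \<alpha>"
  define N2 where "N2 = c0 + (2 * B + 2 * B) / \<alpha>"
  define N3 where "N3 = B * (2 * c0) + 2 * B"
  have \<phi>2: "norm (\<phi> t - \<phi>' t) \<le> N1 * decay T t" for t
    unfolding N1_def by (rule backward_growth[OF \<phi>' norm_triangle_le_diff[OF add_mono[OF rate1]] \<phi>1])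
  have p2: "norm (p t - p' t) \<le> N2 * decay T t" for t
    unfolding N2_def
    by (rule backward_growth[OF p'' norm_triangle_le_diff[OF add_mono[OF norm_coupling(2) norm_coupling(2)]] pT])
  have e2: "norm (e t - e' t) \<le> N3 * decay T t" for t
  proof (cases "t \<ge> T")
    case True
    have "norm ((pos (\<phi> t) (v t), p t) - (pos (\<phi>' t) (v' t), p' t)) \<le> 2 * c0 * decay T t"
      using norm_Pair_le[of "pos (\<phi> t) (v t) - pos (\<phi>' t) (v' t)" "p t - p' t"] yT[OF True] pT[OF True] by simp
    then have "norm (e t - e' t) \<le> 1 * (B * (2 * c0 * decay T t))"
      unfolding e_def e'_def scaleR_diff_right[symmetric] norm_scaleR
      using constants by (intro mult_mono order_trans[OF F_Lipschitz] mult_left_mono) auto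
    also have "\<dots> \<le> N3 * decay T t"
      using constants decay_pos[of T t] by (simp add: N3_def algebra_simps)
    finally show ?thesis .
  next
    case False
    have "norm (e t - e' t) \<le> B + B"
      unfolding e_def e'_def by (intro norm_triangle_le_diff add_mono norm_coupling)
    also have "\<dots> \<le> N3 * 1" using c0 constants by (simp add: N3_def)
    also have "\<dots> \<le> N3 * decay T t"
      using decay_ge_1[of t T] False c0 constants by (intro mult_left_mono) (auto simp: N3_def)
    finally show ?thesis .
  qed
  \<comment> \<open>One number for the three hypotheses of \<open>configuration_step\<close>:
    \<open>S t \<le> N\<close> is their conjunction at time \<open>t\<close>.\<close>
  define S where "S t = Max {norm (\<phi> t - \<phi>' t) / decay T t, norm (e t - e' t) / (\<mu> * decay T t),
    norm (p t - p' t) / (\<nu> * decay T t)}" for t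
  have S_iff: "S t \<le> N \<longleftrightarrow> norm (\<phi> t - \<phi>' t) \<le> N * decay T t \<and> norm (e t - e' t) \<le> \<mu> * N * decay T t \<and>
      norm (p t - p' t) \<le> \<nu> * N * decay T t" for t N
    using decay_pos[of T t] constants(6,7) by (simp add: S_def pos_divide_le_eq mult_ac)
  \<comment> \<open>The step has additive constant 0, so a finite supremum of \<open>S\<close>
    cannot be positive, and all three differences vanish.\<close>
  have "S t \<le> 2 * 0" for t
  proof (rule bound_by_halving[where S = S])
    show "S t \<le> max N1 (max (N3 / \<mu>) (N2 / \<nu>))" for t
    proof -
      have "norm (\<phi> t - \<phi>' t) / decay T t \<le> N1" "norm (e t - e' t) / (\<mu> * decay T t) \<le> N3 / \<mu>"
        "norm (p t - p' t) / (\<nu> * decay T t) \<le> N2 / \<nu>"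
        using \<phi>2[of t] e2[of t] p2[of t] decay_pos[of T t] constants(6,7) by (simp_all add: field_simps)
      then show ?thesis
        unfolding S_def by (subst Max_le_iff) (auto simp: le_max_iff_disj)
    qed
    fix N t assume N: "\<And>t. S t \<le> N"
    have N1: "\<And>t. norm (\<phi> t - \<phi>' t) \<le> N * decay T t"
      and N2: "\<And>t. norm (e t - e' t) \<le> \<mu> * N * decay T t"
      and N3: "\<And>t. norm (p t - p' t) \<le> \<nu> * N * decay T t"
      using N unfolding S_iff by blast+
    have "N \<ge> 0" using order_trans[OF norm_ge_zero N1[of t]] decay_pos[of T t] by (simp add: zero_le_mult_iff)
    note st = configuration_step[OF c c' N1 N2[unfolded e_def e'_def] N3]
    have "norm (\<phi> t - \<phi>' t) \<le> (\<alpha> / 8 * N) / \<alpha> * exp (- \<alpha> * (t - T))"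
      by (rule decay_from_derivative[OF \<alpha>(1) \<phi>' st(2)[unfolded decay_def] decay_tendsto_0[OF N1]])
    moreover have "norm (p t - p' t) \<le> (\<alpha> / 8 * \<nu> * N) / \<alpha> * exp (- \<alpha> * (t - T))"
      by (rule decay_from_derivative[OF \<alpha>(1) p'' st(4)[unfolded decay_def] decay_tendsto_0[OF N3]])
    moreover have "norm (e t - e' t) \<le> \<mu> / 8 * N * decay T t"
      using st(3) unfolding e_def e'_def .
    ultimately have "S t \<le> N / 8"
      unfolding S_iff decay_def using \<alpha>(1) by simp
    then show "S t \<le> N / 2 + 0" using \<open>N \<ge> 0\<close> by simp
  qed
  then have zero: "norm (\<phi> t - \<phi>' t) \<le> 0" "norm (e t - e' t) \<le> 0" "norm (p t - p' t) \<le> 0" for t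
    using S_iff[of t 0] by auto
  then have "\<phi> = \<phi>'" "e = e'" "p = p'" by (auto simp: fun_eq_iff)
  moreover have "v = v'"
    using configuration_unique[OF c[folded e_def] c'[folded e'_def, folded \<open>\<phi> = \<phi>'\<close> \<open>e = e'\<close>]] .
  ultimately show ?thesis by blast
qed

end

section \<open>Solutions of the coupled system\<close>

context coupled_lattice
begin

definition solution :: "(real \<Rightarrow> 'a linf \<times> 'b linf) \<Rightarrow> bool" where
  "solution u \<longleftrightarrow> (\<forall>t. (u has_vector_derivative
    (sitewise f (fst (u t)) + \<epsilon> *\<^sub>R F (u t), sitewise g (fst (u t)) + \<epsilon> *\<^sub>R G (u t))) (at t))"

lemma solution_fst: "solution u \<Longrightarrow>
    ((\<lambda>t. fst (u t)) has_vector_derivative sitewise f (fst (u t)) + \<epsilon> *\<^sub>R F (u t)) (at t)"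
  and solution_snd: "solution u \<Longrightarrow>
    ((\<lambda>t. snd (u t)) has_vector_derivative sitewise g (fst (u t)) + \<epsilon> *\<^sub>R G (u t)) (at t)"
  using bounded_linear.has_vector_derivative[OF bounded_linear_fst, of u]
    bounded_linear.has_vector_derivative[OF bounded_linear_snd, of u]
  unfolding solution_def by force+

lemma solution_continuous: "solution u \<Longrightarrow> continuous_on S u"
  unfolding solution_def
  by (blast intro: continuous_at_imp_continuous_on has_vector_derivative_continuous)

lemma solution_of_configuration:
  assumes c: "configuration \<phi> (\<lambda>t. rate (\<phi> t) (v t)) (\<lambda>t. \<epsilon> *\<^sub>R F (pos (\<phi> t) (v t), p t)) v"
    and p: "\<And>t. (p has_vector_derivative sitewise g (pos (\<phi> t) (v t)) + \<epsilon> *\<^sub>R G (pos (\<phi> t) (v t), p t)) (at t)"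
  shows "solution (\<lambda>t. (pos (\<phi> t) (v t), p t))"
  unfolding solution_def fst_conv
proof (intro allI has_vector_derivative_Pair p configuration_solution[OF c _ refl])
  show "norm ((\<epsilon> *\<^sub>R F (pos (\<phi> t) (v t), p t)) k) \<le> B" for t k
    by (rule order_trans[OF norm_bounded norm_coupling(1)])
qed

lemma norm_force: "norm (\<epsilon> *\<^sub>R F z) \<le> \<bar>\<epsilon>\<bar> * B"
  unfolding norm_scaleR by (intro mult_left_mono F_bound) simp

lemma solution_configuration:
  assumes u: "solution u" and \<Phi>: "continuous_on UNIV \<Phi>" "\<And>t. norm (fst (u t) - sitewise x (\<Phi> t)) \<le> \<delta>"
    and small: "phase_const * (\<delta> + \<bar>\<epsilon>\<bar> * B) \<le> 1 / (12 * M * B\<^sup>2)" "phase_const * (\<delta> + \<bar>\<epsilon>\<bar> * B) \<le> d"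
  shows "\<exists>\<phi> v. configuration \<phi> (\<lambda>t. rate (\<phi> t) (v t)) (\<lambda>t. \<epsilon> *\<^sub>R F (u t)) v \<and>
    (\<forall>t. fst (u t) = pos (\<phi> t) (v t)) \<and> (\<forall>t. norm (\<phi> t - \<Phi> t) \<le> phase_const * (\<delta> + \<bar>\<epsilon>\<bar> * B))"
  by (rule configuration_of_tracking[OF solution_fst[OF u] _ norm_force \<Phi> small])
     (intro continuous_intros continuous_on_F solution_continuous[OF u])

lemma phase_progress:
  assumes c: "configuration \<phi> a e v"
  shows "t0 \<le> t \<Longrightarrow> \<phi> t k \<ge> \<phi> t0 k + (t - t0) / 2" and "t \<le> t0 \<Longrightarrow> \<phi> t k \<ge> \<phi> t0 k - 2 * (t0 - t)"
proof -
  have "C * M * B \<ge> 1" using constants by (simp add: mult_ge1_I)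
  then have le: "1 / (32 * C * M * B) \<le> 1 / 2" by (simp add: field_simps)
  have *: "\<bar>(\<phi> t k - t) - (\<phi> s k - s)\<bar> \<le> 1 / 2 * \<bar>t - s\<bar>" for s t
  proof -
    have "norm ((\<phi> t k - t) - (\<phi> s k - s)) \<le> 1 / 2 * \<bar>t - s\<bar>"
    proof (rule vector_derivative_Lipschitz)
      show "((\<lambda>t. \<phi> t k - t) has_vector_derivative a t k) (at t)" for t
      proof -
        have "((\<lambda>t. apply_bcontfun (\<phi> t) k) has_real_derivative 1 + a t k) (at t)"
          using c unfolding configuration_def by blast
        then show ?thesis
          unfolding has_real_derivative_iff_has_vector_derivative[symmetric]
          by (auto intro!: derivative_eq_intros)
      qed
      show "norm (a t k) \<le> 1 / 2" for t
      proof -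
        have "\<bar>a t k\<bar> \<le> 1 / (32 * C * M * B)" using c unfolding configuration_def by blast
        then show ?thesis using le unfolding real_norm_def by linarith
      qed
    qed
    then show ?thesis by simp
  qed
  have lower: "\<phi> t k - t - (\<phi> t0 k - t0) \<ge> - (1 / 2 * \<bar>t - t0\<bar>)"
    using *[where s = t0 and t = t] by linarith
  show "t0 \<le> t \<Longrightarrow> \<phi> t k \<ge> \<phi> t0 k + (t - t0) / 2" using lower by (simp add: diff_divide_distrib)
  show "\<phi> t k \<ge> \<phi> t0 k - 2 * (t0 - t)" if "t \<le> t0"
  proof -
    have "\<bar>t - t0\<bar> = t0 - t" using that by simp
    then show ?thesis using lower that by argo
  qed
qed

text \<open>A solution near the orbits on \<open>[\<tau>, \<infinity>)\<close> is continued to the past as a \<open>C\<^sup>1\<close> curve that stays near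
  the orbits; \<open>sin\<close> serves as a bounded function with value \<open>0\<close> and slope \<open>1\<close> at \<open>\<tau>\<close>.\<close>

lemma extended_tracking:
  assumes u: "solution u" and \<Phi>: "continuous_on UNIV \<Phi>"
    and near: "\<And>t. t \<ge> \<tau> \<Longrightarrow> norm (fst (u t) - sitewise x (\<Phi> t)) \<le> \<delta>"
  defines "q \<equiv> \<delta> + \<bar>\<epsilon>\<bar> * B"
  shows "\<exists>y e \<Psi>. (\<forall>t. (y has_vector_derivative sitewise f (y t) + e t) (at t)) \<and>
    continuous_on UNIV e \<and> (\<forall>t. norm (e t) \<le> 3 * B\<^sup>2 * q) \<and>
    continuous_on UNIV \<Psi> \<and> (\<forall>t. norm (y t - sitewise x (\<Psi> t)) \<le> 3 * B\<^sup>2 * q) \<and>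
    (\<forall>t\<ge>\<tau>. y t = fst (u t) \<and> e t = \<epsilon> *\<^sub>R F (u t) \<and> \<Psi> t = \<Phi> t)"
proof -
  define \<Psi> where "\<Psi> t = (if t \<in> {\<tau>..} then \<Phi> t else \<Phi> \<tau> + const_bcontfun (t - \<tau>))" for t
  define X where "X t = sitewise x (\<Phi> \<tau> + const_bcontfun (t - \<tau>))" for t
  \<comment> \<open>\<open>w0\<close> and \<open>w1\<close> are the jumps of value and velocity at
    \<tau>. Both are corrected, since the force \<open>e\<close> of the glued curve has to be
    continuous.\<close>
  define w0 where "w0 = fst (u \<tau>) - X \<tau>"
  define w1 where "w1 = sitewise f (fst (u \<tau>)) + \<epsilon> *\<^sub>R F (u \<tau>) - sitewise f (X \<tau>)"
  define W where "W t = w0 + sin (t - \<tau>) *\<^sub>R w1" for t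
  define y where "y t = (if t \<in> {\<tau>..} then fst (u t) else X t + W t)" for t
  define e where "e t = (if t \<in> {\<tau>..} then \<epsilon> *\<^sub>R F (u t)
    else sitewise f (X t) + cos (t - \<tau>) *\<^sub>R w1 - sitewise f (X t + W t))" for t
  have const0: "const_bcontfun (\<tau> - \<tau>) = (0 :: real linf)" by simp
  have X\<tau>: "X \<tau> = sitewise x (\<Phi> \<tau>)" by (simp add: X_def)
  have \<delta>0: "\<delta> \<ge> 0" using order_trans[OF norm_ge_zero near[of \<tau>]] by simp
  have q: "\<delta> \<le> q" "\<bar>\<epsilon>\<bar> * B \<le> q" "q \<ge> 0" using \<delta>0 constants by (auto simp: q_def)
  have w0: "norm w0 \<le> \<delta>" using near[of \<tau>] by (simp add: w0_def X\<tau>)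
  have w1: "norm w1 \<le> B * q"
  proof -
    have "norm (sitewise f (fst (u \<tau>)) - sitewise f (X \<tau>)) \<le> B * \<delta>"
    proof (rule order_trans[OF sitewise_Lipschitz[where h = f, OF f_bound f_Lipschitz]])
      show "B * norm (fst (u \<tau>) - X \<tau>) \<le> B * \<delta>" "0 \<le> B"
        using w0 constants by (auto simp: w0_def)
    qed
    then have "norm (sitewise f (fst (u \<tau>)) - sitewise f (X \<tau>) + \<epsilon> *\<^sub>R F (u \<tau>)) \<le> B * \<delta> + \<bar>\<epsilon>\<bar> * B"
      by (intro norm_triangle_le add_mono norm_force)
    also have "\<dots> \<le> B * q"
      using mult_right_mono[OF constants(1), of "\<bar>\<epsilon>\<bar> * B"] constants by (simp add: q_def distrib_left)
    finally show ?thesis by (simp add: w1_def algebra_simps)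
  qed
  have Wb: "norm (W t) \<le> 2 * B * q" for t
  proof -
    have "norm (W t) \<le> \<delta> + 1 * (B * q)"
    proof -
      have "\<bar>sin (t - \<tau>)\<bar> * norm w1 \<le> 1 * (B * q)" using w1 by (intro mult_mono) auto
      then show ?thesis unfolding W_def using w0 by (intro norm_triangle_le) simp
    qed
    also have "\<dots> \<le> 2 * B * q" using mult_right_mono[OF constants(1) q(3)] q by simp
    finally show ?thesis .
  qed
  have B2: "B * q \<le> B\<^sup>2 * q" "q \<le> B * q"
    using mult_right_mono[OF constants(1) q(3)] mult_right_mono[of B "B\<^sup>2" q] constants(1) q(3)
    by (auto simp: power2_eq_square)
  have contL: "continuous_on S (\<lambda>t. \<Phi> \<tau> + const_bcontfun (t - \<tau>))" for S :: "real set"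
    by (rule linf_Lipschitz_continuous_on[where D = 1]) simp
  have contX: "continuous_on S X" for S :: "real set"
  proof -
    have "continuous_on UNIV (sitewise x)"
      by (rule Lipschitz_imp_continuous_on[OF sitewise_Lipschitz[where h = x, OF x_bound x_Lipschitz]])
         (use constants in simp)
    then show ?thesis unfolding X_def by (rule continuous_on_compose2[OF _ contL]) simp
  qed
  have X': "(X has_vector_derivative sitewise f (X t)) (at t)" for t
  proof (rule linf_has_vector_derivative)
    show "((\<lambda>t. apply_bcontfun (X t) k) has_vector_derivative apply_bcontfun (sitewise f (X t)) k) (at t)" for t k
    proof -
      note sf = apply_sitewise_bounded[where h = f, OF f_bound]
      interpret hyperbolic_orbit_modulus "f k" "A k" "x k" "ys k" B M C \<kappa> d by (rule site)
      have "((\<lambda>t. apply_bcontfun (\<Phi> \<tau>) k + (t - \<tau>)) has_vector_derivative 1) (at t)"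
        by (auto intro!: derivative_eq_intros)
      from vector_diff_chain_at[OF this orbit]
      show ?thesis by (simp add: X_def sf apply_sitewise_bounded[where h = x, OF x_bound] o_def)
    qed
  qed (intro continuous_on_sitewise_f contX)
  have contW: "continuous_on S W" for S :: "real set" unfolding W_def by (intro continuous_intros)
  have clos: "closure {\<tau>..} = {\<tau>..}" "closure {..<\<tau>} = {..\<tau>}" "{\<tau>..} \<inter> {..\<tau>} = {\<tau>}"
    by (auto simp: closure_lessThan)
  have y': "(y has_vector_derivative sitewise f (y t) + e t) (at t)" for t
  proof -
    have g': "((\<lambda>t. X t + W t) has_vector_derivative sitewise f (X t) + cos (t - \<tau>) *\<^sub>R w1) (at t)" for t
      unfolding W_def by (auto intro!: derivative_eq_intros X')
    have "((\<lambda>t. if t \<in> {\<tau>..} then fst (u t) else X t + W t) has_vector_derivative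
      (if t \<in> {\<tau>..} then sitewise f (fst (u t)) + \<epsilon> *\<^sub>R F (u t) else sitewise f (X t) + cos (t - \<tau>) *\<^sub>R w1))
      (at t within UNIV)"
    proof (rule has_vector_derivative_If_within_closures)
      show "UNIV = {\<tau>..} \<union> {..<\<tau>}" by auto
      show "t \<in> closure {\<tau>..} \<Longrightarrow> t \<in> closure {..<\<tau>} \<Longrightarrow> fst (u t) = X t + W t"
        by (auto simp: W_def w0_def)
      show "t \<in> closure {\<tau>..} \<Longrightarrow> t \<in> closure {..<\<tau>} \<Longrightarrow>
          sitewise f (fst (u t)) + \<epsilon> *\<^sub>R F (u t) = sitewise f (X t) + cos (t - \<tau>) *\<^sub>R w1"
        by (auto simp: w1_def)
    qed (auto intro: has_vector_derivative_at_within solution_fst[OF u] g')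
    then show ?thesis
      unfolding y_def e_def by (rule has_vector_derivative_eq_rhs) (simp add: algebra_simps)
  qed
  have "continuous_on ({\<tau>..} \<union> {..\<tau>}) e"
    unfolding e_def
  proof (rule continuous_on_If)
    show "continuous_on {\<tau>..} (\<lambda>t. \<epsilon> *\<^sub>R F (u t))"
      by (intro continuous_intros continuous_on_F solution_continuous[OF u])
    show "continuous_on {..\<tau>} (\<lambda>t. sitewise f (X t) + cos (t - \<tau>) *\<^sub>R w1 - sitewise f (X t + W t))"
      by (intro continuous_intros continuous_on_sitewise_f contX contW)
  qed (auto simp: w1_def W_def w0_def)
  moreover have un: "{\<tau>..} \<union> {..\<tau>} = UNIV" by auto
  ultimately have cont_e: "continuous_on UNIV e" by simp
  have "continuous_on ({\<tau>..} \<union> {..\<tau>}) \<Psi>"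
    unfolding \<Psi>_def
  proof (rule continuous_on_If)
    show "continuous_on {\<tau>..} \<Phi>" using \<Phi> by (rule continuous_on_subset) simp
    show "continuous_on {..\<tau>} (\<lambda>t. \<Phi> \<tau> + const_bcontfun (t - \<tau>))" by (rule contL)
  qed auto
  then have cont_\<Psi>: "continuous_on UNIV \<Psi>" by (simp add: un)
  have e_b: "norm (e t) \<le> 3 * B\<^sup>2 * q" for t
  proof (cases "t \<ge> \<tau>")
    case True
    then show ?thesis using norm_force[of "u t"] q B2 by (simp add: e_def)
  next
    case False
    have "norm (sitewise f (X t) - sitewise f (X t + W t)) \<le> B * (2 * B * q)"
    proof (rule order_trans[OF sitewise_Lipschitz[where h = f, OF f_bound f_Lipschitz]])
      show "B * norm (X t - (X t + W t)) \<le> B * (2 * B * q)" "0 \<le> B"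
        using Wb[of t] constants by auto
    qed
    moreover have "norm (cos (t - \<tau>) *\<^sub>R w1) \<le> 1 * (B * q)"
      unfolding norm_scaleR using w1 by (intro mult_mono) auto
    ultimately have "norm ((sitewise f (X t) - sitewise f (X t + W t)) + cos (t - \<tau>) *\<^sub>R w1) \<le> B * (2 * B * q) + 1 * (B * q)"
      by (intro norm_triangle_le) linarith
    also have "\<dots> \<le> 3 * B\<^sup>2 * q" using B2 by (simp add: power2_eq_square)
    finally show ?thesis using False by (simp add: e_def algebra_simps)
  qed
  have y_b: "norm (y t - sitewise x (\<Psi> t)) \<le> 3 * B\<^sup>2 * q" for t
  proof (cases "t \<ge> \<tau>")
    case True
    then show ?thesis using near[OF True] q B2 by (simp add: y_def \<Psi>_def)
  next
    case False
    then show ?thesis using Wb[of t] B2 q by (simp add: y_def \<Psi>_def X_def)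
  qed
  show ?thesis
    using y' cont_e e_b cont_\<Psi> y_b
    by (intro exI[of _ y] exI[of _ e] exI[of _ \<Psi>]) (auto simp: y_def e_def \<Psi>_def)
qed

text \<open>The reference curve follows \<open>u\<close> from \<tau> on; before \<tau> its
  \<open>y\<close> part moves along the orbits of \<open>x\<close>, while its \<open>p\<close> part
  is that of \<open>u\<close> throughout. Shadowing turns it into a solution. The bound on
  \<open>v\<close> is not taken from the contraction but from \<open>configuration_bound\<close>,
  and it holds for all times.\<close>

theorem asymptotic_existence:
  assumes u: "solution u" and \<Phi>: "continuous_on UNIV \<Phi>"
    and near: "\<And>t. t \<ge> \<tau> \<Longrightarrow> norm (fst (u t) - sitewise x (\<Phi> t)) \<le> \<delta>"
  defines "q \<equiv> \<delta> + \<bar>\<epsilon>\<bar> * B"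
  assumes small: "phase_const * (6 * B\<^sup>2 * q) \<le> 1 / (12 * M * B\<^sup>2)" "phase_const * (6 * B\<^sup>2 * q) \<le> d"
      "3 * B\<^sup>2 * q \<le> d / (4 * C)"
  shows "\<exists>\<phi> v p. continuous_on UNIV \<phi> \<and> solution (\<lambda>t. (pos (\<phi> t) (v t), p t)) \<and>
    (\<forall>t. norm (v t) \<le> 4 * C * (\<bar>\<epsilon>\<bar> * B)) \<and>
    (\<forall>t\<ge>\<tau>. norm (fst (u t) - pos (\<phi> t) (v t)) \<le> (B + 1) * shadow_const * decay \<tau> t) \<and>
    (\<forall>t. norm (snd (u t) - p t) \<le> \<nu> * shadow_const * decay \<tau> t) \<and>
    (\<forall>t\<ge>\<tau>. norm (\<Phi> t - \<phi> t) \<le> phase_const * (6 * B\<^sup>2 * q) + shadow_const * decay \<tau> t)"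
proof -
  obtain y e \<Psi> where ext: "\<And>t. (y has_vector_derivative sitewise f (y t) + e t) (at t)"
    "continuous_on UNIV e" "\<And>t. norm (e t) \<le> 3 * B\<^sup>2 * q"
    "continuous_on UNIV \<Psi>" "\<And>t. norm (y t - sitewise x (\<Psi> t)) \<le> 3 * B\<^sup>2 * q"
    "\<And>t. t \<ge> \<tau> \<Longrightarrow> y t = fst (u t) \<and> e t = \<epsilon> *\<^sub>R F (u t) \<and> \<Psi> t = \<Phi> t"
    using extended_tracking[OF u \<Phi> near] unfolding q_def by blast
  have six: "3 * B\<^sup>2 * q + 3 * B\<^sup>2 * q = 6 * B\<^sup>2 * q" by simp
  obtain \<phi>r vr where r: "configuration \<phi>r (\<lambda>t. rate (\<phi>r t) (vr t)) e vr"
    "\<And>t. y t = pos (\<phi>r t) (vr t)" "\<And>t. norm (\<phi>r t - \<Psi> t) \<le> phase_const * (6 * B\<^sup>2 * q)"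
    using configuration_of_tracking[OF ext(1-5), unfolded six, OF small(1,2)] by blast
  have ek: "norm (e t k) \<le> d / (4 * C)" for t k
    using norm_bounded[of "e t" k] ext(3)[of t] small(3) by linarith
  obtain \<phi> v p where s:
    "configuration \<phi> (\<lambda>t. rate (\<phi> t) (v t)) (\<lambda>t. \<epsilon> *\<^sub>R F (pos (\<phi> t) (v t), p t)) v"
    "\<And>t. (p has_vector_derivative sitewise g (pos (\<phi> t) (v t)) + \<epsilon> *\<^sub>R G (pos (\<phi> t) (v t), p t)) (at t)"
    "\<And>t. norm (\<phi> t - \<phi>r t) \<le> shadow_const * decay \<tau> t"
    "\<And>t. norm (v t - vr t) \<le> shadow_const * decay \<tau> t"
    "\<And>t. norm (p t - snd (u t)) \<le> \<nu> * shadow_const * decay \<tau> t"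
  proof -
    have "\<exists>\<phi> v p. configuration \<phi> (\<lambda>t. rate (\<phi> t) (v t)) (\<lambda>t. \<epsilon> *\<^sub>R F (pos (\<phi> t) (v t), p t)) v \<and>
      (\<forall>t. (p has_vector_derivative sitewise g (pos (\<phi> t) (v t)) + \<epsilon> *\<^sub>R G (pos (\<phi> t) (v t), p t)) (at t)) \<and>
      (\<forall>t. norm (\<phi> t - \<phi>r t) \<le> shadow_const * decay \<tau> t) \<and>
      (\<forall>t. norm (v t - vr t) \<le> shadow_const * decay \<tau> t) \<and>
      (\<forall>t. norm (p t - snd (u t)) \<le> \<nu> * shadow_const * decay \<tau> t)"
    proof (rule shadowing[OF r(1) refl ek solution_snd[OF u]])
      show "continuous_on UNIV (\<lambda>t. sitewise g (fst (u t)) + \<epsilon> *\<^sub>R G (u t))"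
        by (intro continuous_intros continuous_on_sitewise_g continuous_on_G solution_continuous[OF u])
      show "norm (sitewise g (fst (u t)) + \<epsilon> *\<^sub>R G (u t)) \<le> 2 * B" for t by (rule norm_coupling)
      show "e t = \<epsilon> *\<^sub>R F (pos (\<phi>r t) (vr t), snd (u t))" if "\<tau> \<le> t" for t
        using ext(6)[OF that] r(2)[of t] by simp
      show "sitewise g (fst (u t)) + \<epsilon> *\<^sub>R G (u t) =
          sitewise g (pos (\<phi>r t) (vr t)) + \<epsilon> *\<^sub>R G (pos (\<phi>r t) (vr t), snd (u t))" if "\<tau> \<le> t" for t
        using ext(6)[OF that] r(2)[of t] by simp
    qed
    then show thesis using that by blast
  qed
  show ?thesis
  proof (intro exI conjI allI impI)
    have force: "norm ((\<epsilon> *\<^sub>R F z) k) \<le> \<bar>\<epsilon>\<bar> * B" for z k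
      by (rule order_trans[OF norm_bounded norm_force])
    show "continuous_on UNIV \<phi>" by (rule configuration_continuous(1)[OF s(1) force])
    show "solution (\<lambda>t. (pos (\<phi> t) (v t), p t))" by (rule solution_of_configuration[OF s(1,2)])
    show "norm (v t) \<le> 4 * C * (\<bar>\<epsilon>\<bar> * B)" for t
      by (rule norm_bound) (rule configuration_bound[OF s(1) force])
    show "norm (snd (u t) - p t) \<le> \<nu> * shadow_const * decay \<tau> t" for t
      using s(5)[of t] by (simp add: norm_minus_commute)
    fix t assume t: "\<tau> \<le> t"
    have "norm (fst (u t) - pos (\<phi> t) (v t)) \<le> B * norm (\<phi>r t - \<phi> t) + norm (vr t - v t)"
      using pos_Lipschitz[of "\<phi>r t" "vr t" "\<phi> t" "v t"] ext(6)[OF t] r(2)[of t] by simp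
    also have "\<dots> \<le> B * (shadow_const * decay \<tau> t) + shadow_const * decay \<tau> t"
      using s(3,4)[of t] constants by (intro add_mono mult_left_mono) (auto simp: norm_minus_commute)
    finally show "norm (fst (u t) - pos (\<phi> t) (v t)) \<le> (B + 1) * shadow_const * decay \<tau> t"
      by (simp add: algebra_simps)
    show "norm (\<Phi> t - \<phi> t) \<le> phase_const * (6 * B\<^sup>2 * q) + shadow_const * decay \<tau> t"
      using r(3)[of t] s(3)[of t] ext(6)[OF t]
      by (intro norm_diff_triangle_le[of _ "\<phi>r t"]) (auto simp: norm_minus_commute)
  qed
qed

text \<open>Both solutions become configurations over the same orbits, whose exact phases are
  eventually within \<open>l\<close> plus two tracking errors. The uniqueness argument is started at
  a time \<open>T\<close> from which this holds; moving the origin of the weight from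
  \<open>t0\<close> to \<open>T\<close> only rescales the constant.\<close>

theorem solution_uniqueness:
  assumes u: "solution u" and u': "solution u'"
    and \<Phi>: "continuous_on UNIV \<Phi>" "\<And>t. norm (fst (u t) - sitewise x (\<Phi> t)) \<le> \<delta>"
    and \<Phi>': "continuous_on UNIV \<Phi>'" "\<And>t. norm (fst (u' t) - sitewise x (\<Phi>' t)) \<le> \<delta>"
    and small: "phase_const * (\<delta> + \<bar>\<epsilon>\<bar> * B) \<le> 1 / (12 * M * B\<^sup>2)" "phase_const * (\<delta> + \<bar>\<epsilon>\<bar> * B) \<le> d"
      "M * B * d + M * B\<^sup>2 * (l + 2 * (phase_const * (\<delta> + \<bar>\<epsilon>\<bar> * B))) \<le> 1 / 2"
    and ev: "\<forall>\<^sub>F t in at_top. dist (\<Phi> t) (\<Phi>' t) \<le> l"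
    and dec: "\<And>t. t \<ge> t0 \<Longrightarrow> norm (fst (u t) - fst (u' t)) + norm (snd (u t) - snd (u' t)) \<le> c * decay t0 t"
  shows "u = u'"
proof -
  obtain \<phi> v where c: "configuration \<phi> (\<lambda>t. rate (\<phi> t) (v t)) (\<lambda>t. \<epsilon> *\<^sub>R F (u t)) v"
    "\<And>t. fst (u t) = pos (\<phi> t) (v t)" "\<And>t. norm (\<phi> t - \<Phi> t) \<le> phase_const * (\<delta> + \<bar>\<epsilon>\<bar> * B)"
    using solution_configuration[OF u \<Phi> small(1,2)] by blast
  obtain \<phi>' v' where c': "configuration \<phi>' (\<lambda>t. rate (\<phi>' t) (v' t)) (\<lambda>t. \<epsilon> *\<^sub>R F (u' t)) v'"
    "\<And>t. fst (u' t) = pos (\<phi>' t) (v' t)" "\<And>t. norm (\<phi>' t - \<Phi>' t) \<le> phase_const * (\<delta> + \<bar>\<epsilon>\<bar> * B)"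
    using solution_configuration[OF u' \<Phi>' small(1,2)] by blast
  have ueq: "u t = (pos (\<phi> t) (v t), snd (u t))" "u' t = (pos (\<phi>' t) (v' t), snd (u' t))" for t
    by (simp_all add: c(2)[symmetric] c'(2)[symmetric])
  obtain T0 where T0: "\<And>t. t \<ge> T0 \<Longrightarrow> dist (\<Phi> t) (\<Phi>' t) \<le> l"
    using ev by (auto simp: eventually_at_top_linorder)
  define T where "T = max T0 t0"
  have dec': "norm (fst (u t) - fst (u' t)) + norm (snd (u t) - snd (u' t)) \<le> (c * decay t0 T) * decay T t"
    if "t \<ge> T" for t
  proof -
    have "decay t0 t = decay t0 T * decay T t"
      by (simp add: decay_def exp_add[symmetric] algebra_simps)
    then show ?thesis using dec[of t] that by (simp add: T_def mult.assoc)
  qed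
  have "\<phi> = \<phi>' \<and> v = v' \<and> (\<lambda>t. snd (u t)) = (\<lambda>t. snd (u' t))"
  proof (rule asymptotic_uniqueness[where T = T and l = "l + 2 * (phase_const * (\<delta> + \<bar>\<epsilon>\<bar> * B))" and ?c0.0 = "c * decay t0 T"])
    show "configuration \<phi> (\<lambda>t. rate (\<phi> t) (v t)) (\<lambda>t. \<epsilon> *\<^sub>R F (pos (\<phi> t) (v t), snd (u t))) v"
      using c(1) by (simp flip: ueq)
    show "configuration \<phi>' (\<lambda>t. rate (\<phi>' t) (v' t)) (\<lambda>t. \<epsilon> *\<^sub>R F (pos (\<phi>' t) (v' t), snd (u' t))) v'"
      using c'(1) by (simp flip: ueq)
    show "((\<lambda>t. snd (u t)) has_vector_derivative sitewise g (pos (\<phi> t) (v t)) + \<epsilon> *\<^sub>R G (pos (\<phi> t) (v t), snd (u t))) (at t)" for t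
      using solution_snd[OF u, of t] by (simp add: c(2) flip: ueq)
    show "((\<lambda>t. snd (u' t)) has_vector_derivative sitewise g (pos (\<phi>' t) (v' t)) + \<epsilon> *\<^sub>R G (pos (\<phi>' t) (v' t), snd (u' t))) (at t)" for t
      using solution_snd[OF u', of t] by (simp add: c'(2) flip: ueq)
    fix t assume t: "T \<le> t"
    show "norm (pos (\<phi> t) (v t) - pos (\<phi>' t) (v' t)) \<le> c * decay t0 T * decay T t"
      "norm (snd (u t) - snd (u' t)) \<le> c * decay t0 T * decay T t"
      using dec'[OF t] norm_ge_zero[of "fst (u t) - fst (u' t)"] norm_ge_zero[of "snd (u t) - snd (u' t)"]
      unfolding c(2) c'(2) by linarith+
    show "norm (\<phi> t - \<phi>' t) \<le> l + 2 * (phase_const * (\<delta> + \<bar>\<epsilon>\<bar> * B))"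
      using c(3)[of t] c'(3)[of t] T0[of t] t
        norm_triangle_ineq[of "\<phi> t - \<Phi> t" "\<Phi> t - \<phi>' t"] norm_triangle_ineq[of "\<Phi> t - \<Phi>' t" "\<Phi>' t - \<phi>' t"]
      by (simp add: T_def dist_norm norm_minus_commute[of "\<phi>' t"])
  qed (rule small(3))
  then show ?thesis using ueq by (metis ext)
qed

end

section \<open>Asymptotic phase\<close>

lemma Cr_norm_le_bounds:
  assumes "Cr_norm_le r B h" "r \<ge> 1"
  shows "norm (h y) \<le> B" and "norm (frechet_derivative h (at y) v) \<le> B * norm v"
  using assms(1)[unfolded Cr_norm_le_def, rule_format, of "[]" y]
    assms(1)[unfolded Cr_norm_le_def, rule_format, of "[v]" y] assms(2) by auto

lemma uniformly_Cr_has_derivative: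
  assumes "uniformly_Cr r I h" "r \<ge> 1" "i \<in> I"
  shows "(h i has_derivative frechet_derivative (h i) (at y)) (at y)"
proof -
  have "frechet_iter (h i) [] differentiable at y"
    using assms unfolding uniformly_Cr_def by (metis list.size(3) less_le_trans zero_less_one)
  then show ?thesis by (simp add: frechet_derivative_works)
qed

lemma uniformly_Cr_modulus:
  assumes "uniformly_Cr r I h" "r \<ge> 1" "e > 0"
  shows "\<exists>d>0. \<forall>i\<in>I. \<forall>y z v. dist y z < d \<longrightarrow>
    norm (frechet_derivative (h i) (at y) v - frechet_derivative (h i) (at z) v) \<le> e * norm v"
proof -
  obtain d where d: "d > 0" "\<And>i y z vs. i \<in> I \<Longrightarrow> dist y z < d \<Longrightarrow> length vs \<le> r \<Longrightarrow>
      norm (frechet_iter (h i) vs y - frechet_iter (h i) vs z) \<le> e * prod_list (map norm vs)"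
    using assms(1,3) unfolding uniformly_Cr_def by meson
  have "norm (frechet_derivative (h i) (at y) v - frechet_derivative (h i) (at z) v) \<le> e * norm v"
    if "i \<in> I" "dist y z < d" for i y z v
    using d(2)[OF that, of "[v]"] assms(2) by simp
  with d(1) show ?thesis by blast
qed

text \<open>The adjoint is tested against its own value and one factor of its norm is
  cancelled.\<close>

lemma norm_adjoint_le:
  fixes T :: "'a::euclidean_space \<Rightarrow> 'a"
  assumes "linear T" and T: "\<And>v. norm (T v) \<le> B * norm v"
  shows "norm (adjoint T y) \<le> B * norm y"
proof (cases "adjoint T y = 0")
  case True
  then show ?thesis using order_trans[OF norm_ge_zero T[of y]] by simp
next
  case False
  have "norm (adjoint T y) * norm (adjoint T y) = T (adjoint T y) \<bullet> y"
    using adjoint_works[OF assms(1), of "adjoint T y" y]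
    unfolding power2_eq_square[symmetric] power2_norm_eq_inner by simp
  also have "\<dots> \<le> norm (T (adjoint T y)) * norm y" by (rule norm_cauchy_schwarz)
  also have "\<dots> \<le> (B * norm (adjoint T y)) * norm y" by (intro mult_right_mono T) simp
  finally show ?thesis using False by (simp add: mult.commute mult.left_commute)
qed

text \<open>The passage from the sup-norm formulation with bounded continuous functions to the
  pointwise one of the locale. Lipschitz continuity of \<open>ys\<close> is read off the adjoint
  equation, whose operator obeys the same bound \<open>B\<close>.\<close>

lemma hyperbolic_orbit_modulusI:
  fixes f :: "'a::euclidean_space \<Rightarrow> 'a"
  defines "A \<equiv> \<lambda>y. frechet_derivative f (at y)"
  assumes f: "\<And>y. (f has_derivative A y) (at y)" "\<And>y. norm (f y) \<le> B" "\<And>y v. norm (A y v) \<le> B * norm v"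
    and A_cont: "\<And>y e. e > 0 \<Longrightarrow> \<exists>d>0. \<forall>z. dist z y < d \<longrightarrow> (\<forall>v. norm (A z v - A y v) \<le> e * norm v)"
    and orbit: "orbit_in f L x" and lin: "linearization_bounds f x M0 C0"
    and constants: "B \<ge> 1" "M \<ge> 1" "M0 \<le> M" "C \<ge> 1" "C0 \<le> C"
      "\<kappa> \<ge> 0" "\<kappa> \<le> 1 / (8 * C)" "d > 0"
    and A_modulus: "\<And>y z v. norm (y - z) \<le> d \<Longrightarrow> norm (A y v - A z v) \<le> \<kappa> * norm v"
  shows "\<exists>ys. hyperbolic_orbit_modulus f A x ys B M C \<kappa> d"
proof -
  have A': "frechet_derivative f (at y) = A y" for y by (simp add: A_def)
  obtain ys :: "real \<Rightarrow>\<^sub>C 'a" where ys: "norm ys \<le> M0"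
    "\<And>t. (apply_bcontfun ys has_vector_derivative - adjoint (A (x t)) (ys t)) (at t)"
    "\<And>t. ys t \<bullet> f (x t) = 1"
    and ex: "\<And>h :: real \<Rightarrow>\<^sub>C 'a. \<exists>v :: real \<Rightarrow>\<^sub>C 'a. \<forall>t. (apply_bcontfun v has_vector_derivative
        A (x t) (apply_bcontfun v t) - (ys t \<bullet> apply_bcontfun v t) *\<^sub>R f (x t) + apply_bcontfun h t) (at t)"
    and est: "\<And>(h :: real \<Rightarrow>\<^sub>C 'a) (v :: real \<Rightarrow>\<^sub>C 'a). (\<forall>t. (apply_bcontfun v has_vector_derivative
        A (x t) (apply_bcontfun v t) - (ys t \<bullet> apply_bcontfun v t) *\<^sub>R f (x t) + apply_bcontfun h t) (at t))
        \<Longrightarrow> norm v \<le> C0 * norm h"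
  proof -
    from lin obtain ys :: "real \<Rightarrow>\<^sub>C 'a" where ys: "norm ys \<le> M0"
      "\<forall>t. (apply_bcontfun ys has_vector_derivative - adjoint (A (x t)) (ys t)) (at t)"
      "\<forall>t. ys t \<bullet> f (x t) = 1"
      and h: "\<forall>h :: real \<Rightarrow>\<^sub>C 'a. let solves = (\<lambda>v :: real \<Rightarrow>\<^sub>C 'a. \<forall>t. (apply_bcontfun v has_vector_derivative
        A (x t) (apply_bcontfun v t) - (ys t \<bullet> apply_bcontfun v t) *\<^sub>R f (x t) + apply_bcontfun h t) (at t))
        in (\<exists>!v. solves v) \<and> (\<forall>v. solves v \<longrightarrow> norm v \<le> C0 * norm h)"
      unfolding linearization_bounds_def A' by (elim exE conjE) (rule that; assumption)
    show thesis
    proof (rule that[OF ys(1) spec[OF ys(2)] spec[OF ys(3)]])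
      fix h :: "real \<Rightarrow>\<^sub>C 'a"
      note hh = h[rule_format, of h, unfolded Let_def]
      show "\<exists>v :: real \<Rightarrow>\<^sub>C 'a. \<forall>t. (apply_bcontfun v has_vector_derivative
          A (x t) (apply_bcontfun v t) - (ys t \<bullet> apply_bcontfun v t) *\<^sub>R f (x t) + apply_bcontfun h t) (at t)"
        using conjunct1[OF hh] by (rule ex1_implies_ex)
      fix v :: "real \<Rightarrow>\<^sub>C 'a"
      assume "\<forall>t. (apply_bcontfun v has_vector_derivative
          A (x t) (apply_bcontfun v t) - (ys t \<bullet> apply_bcontfun v t) *\<^sub>R f (x t) + apply_bcontfun h t) (at t)"
      then show "norm v \<le> C0 * norm h" using conjunct2[OF hh] by blast
    qed
  qed
  have ysM: "norm (ys t) \<le> M" for t using norm_bounded[of ys t] ys(1) constants by linarith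
  have "hyperbolic_orbit_modulus f A x ys B M C \<kappa> d"
  proof
    show "norm (ys s - ys t) \<le> M * B * \<bar>s - t\<bar>" for s t
    proof (rule vector_derivative_Lipschitz[OF ys(2)])
      fix t
      have "norm (- adjoint (A (x t)) (ys t)) \<le> B * norm (ys t)"
        using norm_adjoint_le[OF bounded_linear.linear[OF has_derivative_bounded_linear[OF f(1)]] f(3)] by simp
      also have "\<dots> \<le> M * B" using ysM[of t] constants by simp
      finally show "norm (- adjoint (A (x t)) (ys t)) \<le> M * B" .
    qed
    show "(x has_vector_derivative f (x t)) (at t)" for t using orbit by (simp add: orbit_in_def)
  next
    fix h :: "real \<Rightarrow> 'a" and c
    assume h: "continuous_on UNIV h" "\<And>t. norm (h t) \<le> c"
    then obtain hb where hb: "h = apply_bcontfun hb"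
      using bcontfunE[OF bcontfun_normI[OF h]] by blast
    then show "\<exists>v. bounded (range v) \<and>
        (\<forall>t. (v has_vector_derivative A (x t) (v t) - (ys t \<bullet> v t) *\<^sub>R f (x t) + h t) (at t))"
      using ex[of hb] by (blast intro: bounded_apply_bcontfun)
    fix v t
    assume v: "bounded (range v)"
      "\<And>t. (v has_vector_derivative A (x t) (v t) - (ys t \<bullet> v t) *\<^sub>R f (x t) + h t) (at t)"
    then have "v \<in> bcontfun"
      by (auto simp: bcontfun_def intro: has_vector_derivative_continuous continuous_at_imp_continuous_on)
    then obtain vb where vb: "v = apply_bcontfun vb" by (rule bcontfunE)
    have "norm vb \<le> C0 * norm hb" using est[of vb hb] v(2) by (simp add: vb hb)
    also have "\<dots> \<le> C * norm hb" using constants by (intro mult_right_mono) auto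
    also have "\<dots> \<le> C * c"
      using h(2) constants by (intro mult_left_mono norm_bound) (auto simp: hb)
    finally show "norm (v t) \<le> C * c" using norm_bounded[of vb t] by (simp add: vb)
  qed (use assms ysM ys(3) in auto)
  then show ?thesis by blast
qed

text \<open>Gronwall after reversing time. The loss is exponential in \<open>T\<close>, so closeness
  \<gamma> pays for a backward time proportional to \<open>ln (1 / \<gamma>)\<close>.\<close>

lemma orbits_close_backward:
  fixes x y :: "real \<Rightarrow> 'a::euclidean_space"
  assumes x: "\<And>t. (x has_vector_derivative f (x t)) (at t)" and y: "\<And>t. (y has_vector_derivative f (y t)) (at t)"
    and f: "\<And>u v. norm (f u - f v) \<le> B * norm (u - v)" "B \<ge> 0"
    and close: "\<And>t. t \<ge> t0 \<Longrightarrow> norm (x t - y t) \<le> \<gamma>"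
    and s: "s \<ge> t0 - T" "T \<ge> 0"
  shows "norm (x s - y s) \<le> exp ((B + 1) * T) * \<gamma>"
proof -
  have \<gamma>: "\<gamma> \<ge> 0" using order_trans[OF norm_ge_zero close[of t0]] by simp
  have mono: "exp ((B + 1) * r) * \<gamma> \<le> exp ((B + 1) * T) * \<gamma>" if "r \<le> T" for r
    using that f(2) \<gamma> by (intro mult_right_mono) (auto intro: mult_left_mono)
  show ?thesis
  proof (cases "s \<ge> t0")
    case True
    then show ?thesis using close[OF True] mono[of 0] s(2) by simp
  next
    case False
    have "norm (x (t0 - (t0 - s)) - y (t0 - (t0 - s)))
        \<le> exp ((B + 1) * ((t0 - s) - 0)) * (norm (x (t0 - 0) - y (t0 - 0)) + 0)"
    proof (rule Gronwall_norm)
      fix u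
      have d: "((\<lambda>u. t0 - u) has_vector_derivative - 1) (at u)" by (auto intro!: derivative_eq_intros)
      show "((\<lambda>u. x (t0 - u) - y (t0 - u)) has_vector_derivative
          (- 1) *\<^sub>R f (x (t0 - u)) - (- 1) *\<^sub>R f (y (t0 - u))) (at u)"
        using has_vector_derivative_diff[OF vector_diff_chain_at[OF d x] vector_diff_chain_at[OF d y]]
        by (simp add: o_def)
      show "norm ((- 1) *\<^sub>R f (x (t0 - u)) - (- 1) *\<^sub>R f (y (t0 - u))) \<le> B * norm (x (t0 - u) - y (t0 - u)) + 0"
        using f(1)[of "y (t0 - u)" "x (t0 - u)"] by (simp add: norm_minus_commute)
    qed (use False f(2) in auto)
    then have "norm (x s - y s) \<le> exp ((B + 1) * (t0 - s)) * norm (x t0 - y t0)" by simp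
    also have "\<dots> \<le> exp ((B + 1) * (t0 - s)) * \<gamma>" using close[of t0] by (intro mult_left_mono) auto
    also have "\<dots> \<le> exp ((B + 1) * T) * \<gamma>" using s by (intro mono) simp
    finally show ?thesis .
  qed
qed

lemma dist_fst_Pair: "dist u (z, snd u) = norm (fst u - z)"
  by (cases u) (simp add: dist_Pair_Pair dist_norm)

lemma (in coupled_lattice) coupled_solution_iff:
  assumes "F = F' \<epsilon>" "G = G' \<epsilon>"
  shows "coupled_solution f g F' G' \<epsilon> u \<longleftrightarrow> solution u"
  unfolding coupled_solution_def solution_def assms[symmetric] ..

text \<open>The exponent by which the starting time \<open>\<tau>\<close> of the shadowing argument is moved away from \<open>t0\<close>:
  a phase moves at least with speed \<open>1/2\<close> forward and at most with speed \<open>2\<close> backward.\<close>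

definition time_shift :: "real \<Rightarrow> real" where
  "time_shift X = max (2 * X) (X / 2)"

lemma time_shift_tendsto: "filterlim X at_bot F \<Longrightarrow> filterlim (\<lambda>\<gamma>. time_shift (X \<gamma>)) at_bot F"
  unfolding filterlim_at_bot
proof safe
  fix Z assume "\<forall>Z. \<forall>\<^sub>F \<gamma> in F. X \<gamma> \<le> Z"
  then have "\<forall>\<^sub>F \<gamma> in F. X \<gamma> \<le> min (2 * Z) (Z / 2)" by blast
  then show "\<forall>\<^sub>F \<gamma> in F. time_shift (X \<gamma>) \<le> Z"
    by eventually_elim (auto simp: time_shift_def)
qed

text \<open>\<open>q0\<close> is a tracking radius for which all smallness conditions hold. It is
  spent in thirds: on \<delta>, on the force, and on the distance of the two trajectories. The last
  may grow from \<gamma> to \<open>q0 / 3\<close> backward from \<open>t0\<close>, which takes the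
  time \<open>ln ((q0 / 3) / \<gamma>) / (B + 1)\<close>. In the exponent of \<open>CK\<close>,
  \<open>K\<close> is the lag of the phases at \<open>t0\<close>, and the summand 1 pays for passing
  twice between \<open>\<Phi>1\<close> and the exact phase, each time with error at most 1/2. The
  exponential factor converts the weight based at \<tau> into one based at
  \<open>t0\<close>.\<close>

theorem asymptotic_solution:
  fixes f :: "int \<Rightarrow> 'a::euclidean_space \<Rightarrow> 'a" and g :: "int \<Rightarrow> 'a \<Rightarrow> 'b::banach"
    and F :: "real \<Rightarrow> 'a linf \<times> 'b linf \<Rightarrow> 'a linf" and G :: "real \<Rightarrow> 'a linf \<times> 'b linf \<Rightarrow> 'b linf"
  assumes l1: "coupled_lattice f A y01 ys1 B M C \<kappa> d g (F \<epsilon>) (G \<epsilon>) \<epsilon> R \<alpha> \<mu> \<nu>"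
    and l2: "coupled_lattice f A y02 ys2 B M C \<kappa> d g (F \<epsilon>) (G \<epsilon>) \<epsilon> R \<alpha> \<mu> \<nu>"
    and P: "P = coupled_lattice.phase_const B M" and K0: "K0 = coupled_lattice.shadow_const B d \<alpha> \<mu> \<nu>"
    and \<rho>: "\<rho> = 1 / (16 * M * B\<^sup>2)" and m: "m = min (1 / (32 * M * B\<^sup>2)) d"
    and q0: "q0 = m / (6 * B\<^sup>2 * P + 12 * C * B\<^sup>2)" and Md: "M * B * d \<le> 1 / 4"
    and \<delta>: "0 < \<delta>" "\<delta> \<le> q0 / 3" and \<epsilon>: "\<bar>\<epsilon>\<bar> * (4 * C * B) \<le> min \<delta> (q0 / 3)"
    and \<gamma>: "0 < \<gamma>" "\<gamma> < q0 / 3"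
    and close: "\<And>t. t \<ge> t0 \<Longrightarrow> norm (traj_at y01 t - traj_at y02 t) \<le> \<gamma>"
    and u1: "manifold_solution f g F G \<epsilon> \<delta> y01 \<Phi>1 u1" and \<Phi>1: "\<And>k. \<Phi>1 t0 k \<ge> t0 - K"
    and c: "c \<ge> (B + 1 + \<nu>) * K0 + 2 * R + q0 + d"
    and CK: "CK = c * exp (\<alpha> * time_shift (K + 1 - ln ((q0 / 3) / \<gamma>) / (B + 1)))"
  shows "\<exists>!u2. (\<exists>\<Phi>2. manifold_solution f g F G \<epsilon> \<delta> y02 \<Phi>2 u2 \<and>
      (\<forall>\<^sub>F t in at_top. dist (\<Phi>1 t) (\<Phi>2 t) \<le> \<rho>)) \<and>
    (\<forall>t\<ge>t0. norm (fst (u1 t) - fst (u2 t)) + norm (snd (u1 t) - snd (u2 t)) \<le> CK * exp (- \<alpha> * (t - t0)))"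
proof -
  interpret l1: coupled_lattice f A y01 ys1 B M C \<kappa> d g "F \<epsilon>" "G \<epsilon>" \<epsilon> R \<alpha> \<mu> \<nu> by (rule l1)
  interpret l2: coupled_lattice f A y02 ys2 B M C \<kappa> d g "F \<epsilon>" "G \<epsilon>" \<epsilon> R \<alpha> \<mu> \<nu> by (rule l2)
  note cs = l1.constants
  have Ppos: "P > 0" using cs by (simp add: P l1.phase_const_def)
  have mpos: "m > 0" using cs by (simp add: m)
  have den: "6 * B\<^sup>2 * P + 12 * C * B\<^sup>2 > 0" using cs Ppos by (intro add_pos_pos mult_pos_pos) auto
  have q0pos: "q0 > 0" using mpos den by (simp add: q0)
  have K0pos: "K0 \<ge> 0" using cs l1.\<alpha>(1) by (simp add: K0 l1.shadow_const_def)
  have R0: "R \<ge> 0" using order_trans[OF norm_ge_zero l1.x_bound] .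
  have q: "P * (6 * B\<^sup>2 * r) \<le> m" "3 * B\<^sup>2 * r \<le> d / (4 * C)" "P * r \<le> m" if r: "r \<ge> 0" "r \<le> q0" for r
  proof -
    have le: "(6 * B\<^sup>2 * P + 12 * C * B\<^sup>2) * r \<le> m"
      using r(2) den by (simp add: q0 pos_le_divide_eq mult.commute)
    have nn: "6 * B\<^sup>2 * P * r \<ge> 0" "12 * C * B\<^sup>2 * r \<ge> 0" using r(1) Ppos cs by auto
    show 1: "P * (6 * B\<^sup>2 * r) \<le> m" using le nn by (simp add: algebra_simps)
    have "12 * C * B\<^sup>2 * r \<le> d" using le nn by (simp add: m algebra_simps)
    then show "3 * B\<^sup>2 * r \<le> d / (4 * C)" using cs by (simp add: field_simps)
    have "1 * r \<le> 6 * B\<^sup>2 * r"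
      using r(1) one_le_power[OF cs(1), of 2] by (intro mult_right_mono) linarith+
    then have "P * r \<le> P * (6 * B\<^sup>2 * r)" using Ppos by (intro mult_left_mono) auto
    with 1 show "P * r \<le> m" by linarith
  qed
  have MB: "M * B\<^sup>2 \<ge> 1" using cs by (simp add: mult_ge1_I)
  have m_le: "m \<le> 1 / (12 * M * B\<^sup>2)" "m \<le> d" "M * B\<^sup>2 * m \<le> 1 / 32" "m \<le> 1 / 2" "m \<le> \<rho> / 2"
  proof -
    have mm: "m \<le> 1 / (32 * M * B\<^sup>2)" by (simp add: m)
    also have "\<dots> \<le> 1 / (12 * M * B\<^sup>2)" using cs by (intro divide_left_mono mult_pos_pos) auto
    finally show "m \<le> 1 / (12 * M * B\<^sup>2)" .
    show "m \<le> d" by (simp add: m)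
    show "m \<le> \<rho> / 2" using mm by (simp add: \<rho>)
    have "0 < 32 * M * B\<^sup>2" using MB by simp
    then have "m * (32 * M * B\<^sup>2) \<le> 1" using mm by (simp add: pos_le_divide_eq)
    then show 32: "M * B\<^sup>2 * m \<le> 1 / 32" by (simp add: mult_ac)
    then show "m \<le> 1 / 2" using mult_right_mono[OF MB, of m] mpos by linarith
  qed
  have \<epsilon>B: "\<bar>\<epsilon>\<bar> * B \<le> q0 / 3" "4 * C * (\<bar>\<epsilon>\<bar> * B) \<le> \<delta>"
  proof -
    have "1 * (\<bar>\<epsilon>\<bar> * B) \<le> (4 * C) * (\<bar>\<epsilon>\<bar> * B)" using cs by (intro mult_right_mono) auto
    then show "\<bar>\<epsilon>\<bar> * B \<le> q0 / 3" "4 * C * (\<bar>\<epsilon>\<bar> * B) \<le> \<delta>" using \<epsilon> by (auto simp: algebra_simps)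
  qed
  have r1: "\<delta> + \<bar>\<epsilon>\<bar> * B \<ge> 0" "\<delta> + \<bar>\<epsilon>\<bar> * B \<le> q0" using \<delta> \<epsilon>B cs q0pos by auto
  note P' = P[unfolded l1.phase_const_def, folded l2.phase_const_def]
  have sol: "coupled_solution f g F G \<epsilon> u \<longleftrightarrow> l1.solution u" "coupled_solution f g F G \<epsilon> u \<longleftrightarrow> l2.solution u" for u
    by (rule l1.coupled_solution_iff l2.coupled_solution_iff; rule refl)+
  have mf: "manifold_solution f g F G \<epsilon> \<delta> y0 \<Phi> u \<longleftrightarrow> coupled_solution f g F G \<epsilon> u \<and> continuous_on UNIV \<Phi> \<and>
      (\<forall>t. norm (fst (u t) - sitewise y0 (\<Phi> t)) \<le> \<delta>)" for y0 \<Phi> u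
    by (simp add: manifold_solution_def dist_fst_Pair)
  have u1': "l1.solution u1" "l2.solution u1" "continuous_on UNIV \<Phi>1"
    "\<And>t. norm (fst (u1 t) - sitewise y01 (\<Phi>1 t)) \<le> \<delta>"
    using u1 unfolding mf sol[symmetric] by auto
  have sml: "P * (\<delta> + \<bar>\<epsilon>\<bar> * B) \<le> 1 / (12 * M * B\<^sup>2)" "P * (\<delta> + \<bar>\<epsilon>\<bar> * B) \<le> d" "P * (\<delta> + \<bar>\<epsilon>\<bar> * B) \<le> 1 / 2"
    "P * (\<delta> + \<bar>\<epsilon>\<bar> * B) \<le> m"
    using q(3)[OF r1] m_le by linarith+
  obtain \<phi>1 v1 where \<phi>1: "l1.configuration \<phi>1 (\<lambda>t. l1.rate (\<phi>1 t) (v1 t)) (\<lambda>t. \<epsilon> *\<^sub>R F \<epsilon> (u1 t)) v1"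
    "\<And>t. norm (\<phi>1 t - \<Phi>1 t) \<le> P * (\<delta> + \<bar>\<epsilon>\<bar> * B)"
    using l1.solution_configuration[OF u1'(1,3,4), folded P, OF sml(1,2)] by blast
  have \<phi>1k: "\<bar>\<phi>1 t k - \<Phi>1 t k\<bar> \<le> 1 / 2" for t k
    using norm_bounded[of "\<phi>1 t - \<Phi>1 t" k] \<phi>1(2)[of t] sml(3) by simp
  define T where "T = ln ((q0 / 3) / \<gamma>) / (B + 1)"
  define X where "X = K + 1 - T"
  define \<tau> where "\<tau> = t0 + time_shift X"
  have T: "T \<ge> 0" "exp ((B + 1) * T) * \<gamma> = q0 / 3"
    using \<gamma> cs q0pos by (simp_all add: T_def)
  \<comment> \<open>From \<tau> on every phase of \<open>u1\<close> lies where the two trajectories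
    are still within \<open>q0 / 3\<close> of each other.\<close>
  have late: "\<Phi>1 t k \<ge> t0 - T" if "t \<ge> \<tau>" for t k
  proof -
    have b: "\<phi>1 t0 k \<ge> t0 - K - 1 / 2" "\<Phi>1 t k \<ge> \<phi>1 t k - 1 / 2"
      using \<phi>1k[of t0 k] \<phi>1k[of t k] \<Phi>1[of k] unfolding abs_le_iff by linarith+
    have shift: "2 * X \<le> t - t0" "X / 2 \<le> t - t0" using that by (auto simp: \<tau>_def time_shift_def)
    show ?thesis
    proof (cases "t0 \<le> t")
      case True
      then show ?thesis
        using l1.phase_progress(1)[OF \<phi>1(1) True, of k] b shift unfolding X_def by argo
    next
      case False
      then have "t \<le> t0" by simp
      from l1.phase_progress(2)[OF \<phi>1(1) this, of k] b shift show ?thesis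
        unfolding X_def by argo
    qed
  qed
  have near: "norm (fst (u1 t) - sitewise y02 (\<Phi>1 t)) \<le> \<delta> + q0 / 3" if "t \<ge> \<tau>" for t
  proof (rule norm_bound)
    fix k
    have a1: "norm (fst (u1 t) k - y01 k (\<Phi>1 t k)) \<le> \<delta>"
      using norm_bounded[of "fst (u1 t) - sitewise y01 (\<Phi>1 t)" k] u1'(4)[of t]
      by (simp add: apply_sitewise_bounded[where h = y01, OF l1.x_bound])
    have a2: "norm (y01 k (\<Phi>1 t k) - y02 k (\<Phi>1 t k)) \<le> exp ((B + 1) * T) * \<gamma>"
    proof (rule orbits_close_backward[where f = "f k" and ?t0.0 = t0])
      show "norm (y01 k t - y02 k t) \<le> \<gamma>" if "t0 \<le> t" for t
        using norm_bounded[of "traj_at y01 t - traj_at y02 t" k] close[OF that]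
        by (simp add: apply_sitewise_bounded[where h = y01, OF l1.x_bound]
            apply_sitewise_bounded[where h = y02, OF l2.x_bound])
      show "(y01 k has_vector_derivative f k (y01 k t)) (at t)" "(y02 k has_vector_derivative f k (y02 k t)) (at t)" for t
        by (rule hyperbolic_orbit.orbit[OF hyperbolic_orbit_modulus.axioms(1)[OF l1.site]]
            hyperbolic_orbit.orbit[OF hyperbolic_orbit_modulus.axioms(1)[OF l2.site]])+
      show "norm (f k u - f k v) \<le> B * norm (u - v)" for u v by (rule l1.f_Lipschitz)
    qed (use late[OF that] T cs in auto)
    show "norm (apply_bcontfun (fst (u1 t) - sitewise y02 (\<Phi>1 t)) k) \<le> \<delta> + q0 / 3"
      using norm_diff_triangle_le[OF a1 a2]
      by (simp add: T(2) apply_sitewise_bounded[where h = y02, OF l2.x_bound])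
  qed
  define r2 where "r2 = \<delta> + q0 / 3 + \<bar>\<epsilon>\<bar> * B"
  have r2: "r2 \<ge> 0" "r2 \<le> q0" using \<delta> \<epsilon>B cs q0pos by (auto simp: r2_def)
  have ex_small: "P * (6 * B\<^sup>2 * r2) \<le> 1 / (12 * M * B\<^sup>2)" "P * (6 * B\<^sup>2 * r2) \<le> d"
    "P * (6 * B\<^sup>2 * r2) \<le> \<rho> / 2" "3 * B\<^sup>2 * r2 \<le> d / (4 * C)"
    using q[OF r2] m_le by linarith+
  obtain \<phi> v p where s: "continuous_on UNIV \<phi>" "l2.solution (\<lambda>t. (l2.pos (\<phi> t) (v t), p t))"
    "\<And>t. norm (v t) \<le> 4 * C * (\<bar>\<epsilon>\<bar> * B)"
    "\<And>t. t \<ge> \<tau> \<Longrightarrow> norm (fst (u1 t) - l2.pos (\<phi> t) (v t)) \<le> (B + 1) * K0 * l2.decay \<tau> t"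
    "\<And>t. norm (snd (u1 t) - p t) \<le> \<nu> * K0 * l2.decay \<tau> t"
    "\<And>t. t \<ge> \<tau> \<Longrightarrow> norm (\<Phi>1 t - \<phi> t) \<le> P * (6 * B\<^sup>2 * r2) + K0 * l2.decay \<tau> t"
    using l2.asymptotic_existence[OF u1'(2,3) near, folded r2_def, folded P K0, OF _ ex_small(1,2,4)] by blast
  define u2 where "u2 t = (l2.pos (\<phi> t) (v t), p t)" for t
  have decay: "c * l2.decay \<tau> t = CK * exp (- \<alpha> * (t - t0))" for t
    by (simp add: CK l2.decay_def \<tau>_def X_def T_def exp_add[symmetric] algebra_simps)
  have man: "manifold_solution f g F G \<epsilon> \<delta> y02 \<phi> u2"
    unfolding mf sol(2)
  proof (intro conjI allI)
    show "l2.solution u2" using s(2) by (simp add: u2_def[abs_def])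
    show "norm (fst (u2 t) - sitewise y02 (\<phi> t)) \<le> \<delta>" for t
      using s(3)[of t] \<epsilon>B(2) by (simp add: u2_def l2.pos_def)
  qed (rule s(1))
  have ev: "\<forall>\<^sub>F t in at_top. dist (\<Phi>1 t) (\<phi> t) \<le> \<rho>"
  proof -
    have "((\<lambda>t. K0 * l2.decay \<tau> t) \<longlongrightarrow> 0) at_top"
      unfolding l2.decay_def by (rule exp_decay_tendsto_0[OF l2.\<alpha>(1)])
    moreover have "\<rho> / 2 > 0" using cs by (simp add: \<rho>)
    ultimately have "\<forall>\<^sub>F t in at_top. K0 * l2.decay \<tau> t < \<rho> / 2" by (rule order_tendstoD)
    then show ?thesis
      using eventually_ge_at_top[of \<tau>]
    proof eventually_elim
      case (elim t)
      then show ?case using s(6)[of t] ex_small(3) by (simp add: dist_norm)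
    qed
  qed
  have bound: "norm (fst (u1 t) - fst (u2 t)) + norm (snd (u1 t) - snd (u2 t)) \<le> CK * exp (- \<alpha> * (t - t0))" for t
  proof -
    have "norm (fst (u1 t) - l2.pos (\<phi> t) (v t)) \<le> ((B + 1) * K0 + 2 * R + q0 + d) * l2.decay \<tau> t"
    \<comment> \<open>If \<tau> is later than \<open>t0\<close>, shadowing does not control the
      \<open>y\<close> component in between. Both points then lie within \<open>R + \<delta>\<close>
      of the origin, which suffices because the weight is at least 1.\<close>
    proof (cases "t \<ge> \<tau>")
      case True
      have "((B + 1) * K0) * l2.decay \<tau> t \<le> ((B + 1) * K0 + 2 * R + q0 + d) * l2.decay \<tau> t"
        using R0 q0pos cs l2.decay_pos[of \<tau> t] by (intro mult_right_mono) auto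
      then show ?thesis using s(4)[OF True] by linarith
    next
      case False
      have "norm (fst (u1 t)) \<le> R + \<delta>"
        using norm_triangle_sub[of "fst (u1 t)" "sitewise y01 (\<Phi>1 t)"] u1'(4)[of t]
          norm_bound[of "sitewise y01 (\<Phi>1 t)" R] l1.x_bound
        by (simp add: apply_sitewise_bounded[where h = y01, OF l1.x_bound])
      moreover have "norm (l2.pos (\<phi> t) (v t)) \<le> R + \<delta>"
        using norm_triangle_ineq[of "sitewise y02 (\<phi> t)" "v t"] s(3)[of t] \<epsilon>B(2)
          norm_bound[of "sitewise y02 (\<phi> t)" R] l2.x_bound
        by (simp add: apply_sitewise_bounded[where h = y02, OF l2.x_bound] l2.pos_def)
      ultimately have "norm (fst (u1 t) - l2.pos (\<phi> t) (v t)) \<le> (R + \<delta>) + (R + \<delta>)"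
        by (rule norm_triangle_le_diff[OF add_mono])
      also have "\<dots> \<le> ((B + 1) * K0 + 2 * R + q0 + d) * 1"
      proof -
        have "(B + 1) * K0 \<ge> 0" using cs K0pos by simp
        then show ?thesis using \<delta> q0pos cs(5) unfolding mult_1_right by linarith
      qed
      also have "\<dots> \<le> ((B + 1) * K0 + 2 * R + q0 + d) * l2.decay \<tau> t"
        using l2.decay_ge_1[of t \<tau>] False R0 q0pos cs K0pos by (intro mult_left_mono) auto
      finally show ?thesis .
    qed
    then have "norm (fst (u1 t) - l2.pos (\<phi> t) (v t)) + norm (snd (u1 t) - p t)
        \<le> ((B + 1 + \<nu>) * K0 + 2 * R + q0 + d) * l2.decay \<tau> t"
      using s(5)[of t] by (simp add: algebra_simps)
    also have "\<dots> \<le> c * l2.decay \<tau> t"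
      using c l2.decay_pos[of \<tau> t] by (intro mult_right_mono) auto
    finally show ?thesis unfolding decay by (simp add: u2_def)
  qed
  show ?thesis
  proof (rule ex1I[of _ u2], intro conjI exI allI impI)
    show "manifold_solution f g F G \<epsilon> \<delta> y02 \<phi> u2" "\<forall>\<^sub>F t in at_top. dist (\<Phi>1 t) (\<phi> t) \<le> \<rho>"
      by (fact man ev)+
    show "norm (fst (u1 t) - fst (u2 t)) + norm (snd (u1 t) - snd (u2 t)) \<le> CK * exp (- \<alpha> * (t - t0))" for t
      by (rule bound)
  next
    fix u3
    assume "(\<exists>\<Phi>2. manifold_solution f g F G \<epsilon> \<delta> y02 \<Phi>2 u3 \<and> (\<forall>\<^sub>F t in at_top. dist (\<Phi>1 t) (\<Phi>2 t) \<le> \<rho>)) \<and>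
      (\<forall>t\<ge>t0. norm (fst (u1 t) - fst (u3 t)) + norm (snd (u1 t) - snd (u3 t)) \<le> CK * exp (- \<alpha> * (t - t0)))"
    then obtain \<Phi>3 where u3: "manifold_solution f g F G \<epsilon> \<delta> y02 \<Phi>3 u3"
      "\<forall>\<^sub>F t in at_top. dist (\<Phi>1 t) (\<Phi>3 t) \<le> \<rho>"
      "\<And>t. t \<ge> t0 \<Longrightarrow> norm (fst (u1 t) - fst (u3 t)) + norm (snd (u1 t) - snd (u3 t)) \<le> CK * exp (- \<alpha> * (t - t0))"
      by blast
    show "u3 = u2"
    \<comment> \<open>Both candidates have phases eventually within \<rho> of
      \<open>\<Phi>1\<close>, hence within \<rho> + \<rho> of each other. In the smallness condition
      the three contributions are at most 1/4, 1/8 and 1/16.\<close>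
    proof (rule l2.solution_uniqueness[where \<Phi> = \<Phi>3 and \<Phi>' = \<phi> and \<delta> = \<delta> and l = "\<rho> + \<rho>" and ?t0.0 = t0 and c = "CK + CK", folded P])
      show "l2.solution u3" "l2.solution u2" "continuous_on UNIV \<Phi>3" "continuous_on UNIV \<phi>"
        "norm (fst (u3 t) - sitewise y02 (\<Phi>3 t)) \<le> \<delta>" "norm (fst (u2 t) - sitewise y02 (\<phi> t)) \<le> \<delta>" for t
        using u3(1) man unfolding mf sol(2) by blast+
      show "P * (\<delta> + \<bar>\<epsilon>\<bar> * B) \<le> 1 / (12 * M * B\<^sup>2)" "P * (\<delta> + \<bar>\<epsilon>\<bar> * B) \<le> d" by (fact sml)+
      have "M * B\<^sup>2 * (\<rho> + \<rho>) = 1 / 8" using cs by (simp add: \<rho> field_simps)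
      moreover have "M * B\<^sup>2 * (P * (\<delta> + \<bar>\<epsilon>\<bar> * B)) \<le> 1 / 32"
        using mult_left_mono[OF sml(4), of "M * B\<^sup>2"] m_le(3) MB by linarith
      ultimately show "M * B * d + M * B\<^sup>2 * ((\<rho> + \<rho>) + 2 * (P * (\<delta> + \<bar>\<epsilon>\<bar> * B))) \<le> 1 / 2"
        using Md by (simp add: distrib_left)
      show "\<forall>\<^sub>F t in at_top. dist (\<Phi>3 t) (\<phi> t) \<le> \<rho> + \<rho>"
        using u3(2) ev
      proof eventually_elim
        case (elim t)
        then show ?case using dist_triangle3[of "\<Phi>3 t" "\<phi> t" "\<Phi>1 t"] by linarith
      qed
      fix t assume t: "t0 \<le> t"
      have "norm (fst (u3 t) - fst (u2 t)) \<le> norm (fst (u1 t) - fst (u3 t)) + norm (fst (u1 t) - fst (u2 t))"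
        "norm (snd (u3 t) - snd (u2 t)) \<le> norm (snd (u1 t) - snd (u3 t)) + norm (snd (u1 t) - snd (u2 t))"
        using dist_triangle3[of "fst (u3 t)" "fst (u2 t)" "fst (u1 t)"]
          dist_triangle3[of "snd (u3 t)" "snd (u2 t)" "snd (u1 t)"] by (simp_all add: dist_norm)
      then show "norm (fst (u3 t) - fst (u2 t)) + norm (snd (u3 t) - snd (u2 t)) \<le> (CK + CK) * l2.decay t0 t"
        using u3(3)[OF t] bound[of t] unfolding l2.decay_def by (simp add: algebra_simps)
    qed
  qed
qed

text \<open>The closeness hypothesis compares the orbits at equal times from \<open>t0\<close> on,
  whereas \<open>u1\<close> sits at its own phases. \<open>K\<close> bounds how far these lag behind
  \<open>t0\<close>, and the constant depends on it. The condition with \<rho> selects the phase of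
  \<open>u2\<close>: an orbit asymptotic to a periodic one is also asymptotic to its own translate
  by the period, so decay alone would not single out a solution. The range of \<epsilon> depends on
  \<delta> because the displacement of \<open>u2\<close>, of order \<epsilon>, has to fit into
  \<delta>.\<close>

theorem theorem5p3:
  fixes f :: "int \<Rightarrow> real ^ 'n \<Rightarrow> real ^ 'n"
    and g :: "int \<Rightarrow> real ^ 'n \<Rightarrow> real ^ 'm"
    and F :: "real \<Rightarrow> (real ^ 'n) linf \<times> (real ^ 'm) linf \<Rightarrow> (real ^ 'n) linf"
    and G :: "real \<Rightarrow> (real ^ 'n) linf \<times> (real ^ 'm) linf \<Rightarrow> (real ^ 'm) linf"
    and \<Lambda> :: "int \<Rightarrow> (real ^ 'n) set"
    and r :: nat and \<epsilon>1 :: real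
  assumes "r \<ge> 1"
    and "uniformly_Cr r UNIV f"
    and "uniformly_Cr r UNIV g"
    and "uniformly_hyperbolic f \<Lambda>"
    and "\<epsilon>1 > 0"
    and "Cr_perturbation r \<epsilon>1 F"
    and "Cr_perturbation r \<epsilon>1 G"
  shows "\<exists>\<alpha>>0. \<exists>\<gamma>bar>0. \<exists>\<rho>>0. \<exists>C :: real \<Rightarrow> real \<Rightarrow> real.
    (\<forall>K. (C K \<longlongrightarrow> 0) (at_right 0)) \<and>
    (\<exists>\<delta>0>0. \<forall>\<delta>. 0 < \<delta> \<and> \<delta> \<le> \<delta>0 \<longrightarrow> (\<exists>\<epsilon>0>0. \<forall>\<epsilon> \<gamma>. \<bar>\<epsilon>\<bar> < \<epsilon>0 \<and> 0 < \<gamma> \<and> \<gamma> < \<gamma>bar \<longrightarrow>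
      (\<forall>y01\<in>trajectories f \<Lambda>. \<forall>y02\<in>trajectories f \<Lambda>. \<forall>t0.
        (\<forall>t\<ge>t0. norm (traj_at y01 t - traj_at y02 t) \<le> \<gamma>) \<longrightarrow>
        (\<forall>u1 \<Phi>1 K.
          manifold_solution f g F G \<epsilon> \<delta> y01 \<Phi>1 u1 \<and>
          (\<forall>k. apply_bcontfun (\<Phi>1 t0) k \<ge> t0 - K) \<longrightarrow>
          (\<exists>!u2.
            (\<exists>\<Phi>2. manifold_solution f g F G \<epsilon> \<delta> y02 \<Phi>2 u2 \<and>
                  (\<forall>\<^sub>F t in at_top. dist (\<Phi>1 t) (\<Phi>2 t) \<le> \<rho>)) \<and>
            (\<forall>t\<ge>t0. norm (fst (u1 t) - fst (u2 t)) + norm (snd (u1 t) - snd (u2 t))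
                      \<le> C K \<gamma> * exp (- \<alpha> * (t - t0))))))))"
proof -
  note r = assms(1) and f_Cr = assms(2) and g_Cr = assms(3) and hyp = assms(4)
    and F_Cr = assms(6) and G_Cr = assms(7)
  obtain Bf Bg CF CG where Cr: "\<And>k. Cr_norm_le r Bf (f k)" "\<And>k. Cr_norm_le r Bg (g k)"
    "\<And>\<epsilon>. \<bar>\<epsilon>\<bar> < \<epsilon>1 \<Longrightarrow> Cr_norm_le r CF (F \<epsilon>)" "\<And>\<epsilon>. \<bar>\<epsilon>\<bar> < \<epsilon>1 \<Longrightarrow> Cr_norm_le r CG (G \<epsilon>)"
  proof -
    obtain Bf where "\<And>k. Cr_norm_le r Bf (f k)" using f_Cr unfolding uniformly_Cr_def by blast
    moreover obtain Bg where "\<And>k. Cr_norm_le r Bg (g k)" using g_Cr unfolding uniformly_Cr_def by blast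
    moreover obtain CF where "\<And>\<epsilon>. \<bar>\<epsilon>\<bar> < \<epsilon>1 \<Longrightarrow> Cr_norm_le r CF (F \<epsilon>)"
      using F_Cr unfolding Cr_perturbation_def by blast
    moreover obtain CG where "\<And>\<epsilon>. \<bar>\<epsilon>\<bar> < \<epsilon>1 \<Longrightarrow> Cr_norm_le r CG (G \<epsilon>)"
      using G_Cr unfolding Cr_perturbation_def by blast
    ultimately show thesis by (rule that)
  qed
  define B where "B = max 1 (max (max Bf Bg) (max CF CG))"
  have B: "B \<ge> 1" "Bf \<le> B" "Bg \<le> B" "CF \<le> B" "CG \<le> B" by (auto simp: B_def)
  define A where "A k y = frechet_derivative (f k) (at y)" for k y
  have le: "b * norm v \<le> B * norm v" if "b \<le> B" for b and v :: "'c::real_normed_vector"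
    using that by (intro mult_right_mono) auto
  have f_deriv: "(f k has_derivative A k y) (at y)" for k y
    unfolding A_def by (rule uniformly_Cr_has_derivative[OF f_Cr r]) simp
  have f_bounds: "norm (f k y) \<le> B" "norm (A k y v) \<le> B * norm v" for k y v
    unfolding A_def using order_trans[OF Cr_norm_le_bounds(1)[OF Cr(1) r] B(2)]
      order_trans[OF Cr_norm_le_bounds(2)[OF Cr(1) r] le[OF B(2)]] by auto
  have g_bound: "norm (g k y) \<le> B" for k y
    by (rule order_trans[OF Cr_norm_le_bounds(1)[OF Cr(2) r] B(3)])
  have g_Lip: "norm (g k y - g k z) \<le> B * norm (y - z)" for k y z
    by (rule norm_diff_le_of_has_derivative[OF uniformly_Cr_has_derivative[OF g_Cr r UNIV_I]
          order_trans[OF Cr_norm_le_bounds(2)[OF Cr(2) r] le[OF B(3)]]]) (use B(1) in simp)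
  have F_bound: "norm (F \<epsilon> u) \<le> B" and F_Lip: "norm (F \<epsilon> u - F \<epsilon> w) \<le> B * norm (u - w)" if \<epsilon>: "\<bar>\<epsilon>\<bar> < \<epsilon>1" for \<epsilon> u w
  proof -
    show "norm (F \<epsilon> u) \<le> B" by (rule order_trans[OF Cr_norm_le_bounds(1)[OF Cr(3)[OF \<epsilon>] r] B(4)])
    have C1: "uniformly_Cr r {\<epsilon>} F" using F_Cr \<epsilon> unfolding Cr_perturbation_def by blast
    show "norm (F \<epsilon> u - F \<epsilon> w) \<le> B * norm (u - w)"
      by (rule norm_diff_le_of_has_derivative[OF uniformly_Cr_has_derivative[OF C1 r singletonI]
            order_trans[OF Cr_norm_le_bounds(2)[OF Cr(3)[OF \<epsilon>] r] le[OF B(4)]]]) (use B(1) in simp)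
  qed
  have G_bound: "norm (G \<epsilon> u) \<le> B" and G_Lip: "norm (G \<epsilon> u - G \<epsilon> w) \<le> B * norm (u - w)" if \<epsilon>: "\<bar>\<epsilon>\<bar> < \<epsilon>1" for \<epsilon> u w
  proof -
    show "norm (G \<epsilon> u) \<le> B" by (rule order_trans[OF Cr_norm_le_bounds(1)[OF Cr(4)[OF \<epsilon>] r] B(5)])
    have C1: "uniformly_Cr r {\<epsilon>} G" using G_Cr \<epsilon> unfolding Cr_perturbation_def by blast
    show "norm (G \<epsilon> u - G \<epsilon> w) \<le> B * norm (u - w)"
      by (rule norm_diff_le_of_has_derivative[OF uniformly_Cr_has_derivative[OF C1 r singletonI]
            order_trans[OF Cr_norm_le_bounds(2)[OF Cr(4)[OF \<epsilon>] r] le[OF B(5)]]]) (use B(1) in simp)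
  qed
  obtain R M0 C0 where R: "\<And>k y. y \<in> \<Lambda> k \<Longrightarrow> norm y \<le> R"
    and lin: "\<And>k x. orbit_in (f k) (\<Lambda> k) x \<Longrightarrow> linearization_bounds (f k) x M0 C0"
    using hyp unfolding uniformly_hyperbolic_def by blast
  define M where "M = max 1 M0"
  define C where "C = max 1 C0"
  have MC: "M \<ge> 1" "M0 \<le> M" "C \<ge> 1" "C0 \<le> C" by (auto simp: M_def C_def)
  \<comment> \<open>The largest rate that \<open>weighted_linear_estimate\<close> admits for the
    weight.\<close>
  define \<alpha> where "\<alpha> = 1 / (16 * C)"
  define \<mu> where "\<mu> = \<alpha> / (128 * C * M)"
  define \<nu> where "\<nu> = 24 * B\<^sup>2 / \<alpha>"
  \<comment> \<open>The second entry spends one half of \<open>small_\<beta>\<close> on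
    \<open>\<kappa> * B\<close>; the choice of \<open>d\<close> spends the other half. The first
    entry serves the absorption in the nonlinear comparison.\<close>
  define \<kappa> where "\<kappa> = min (1 / (8 * C)) (\<mu> / (2 * B))"
  have pos: "\<alpha> > 0" "\<mu> > 0" "\<nu> > 0" "\<kappa> > 0" "B > 0" "M > 0" "C > 0"
    using MC B(1) by (auto simp: \<alpha>_def \<mu>_def \<nu>_def \<kappa>_def)
  obtain dm where dm: "dm > 0" "\<And>k y z v. dist y z < dm \<Longrightarrow> norm (A k y v - A k z v) \<le> \<kappa> * norm v"
    using uniformly_Cr_modulus[OF f_Cr r pos(4)] unfolding A_def by auto
  have A_cont: "\<exists>d>0. \<forall>z. dist z y < d \<longrightarrow> (\<forall>v. norm (A k z v - A k y v) \<le> e * norm v)" if "e > 0" for k y e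
    using uniformly_Cr_modulus[OF f_Cr r that] unfolding A_def by (meson UNIV_I)
  \<comment> \<open>One entry for each demand on the radius: the modulus of continuity, with a half
    because its inequality is strict, then \<open>small_\<beta>\<close>, the two parts of
    \<open>small_d\<close>, and the uniqueness argument.\<close>
  define ds where "ds = {dm / 2, \<mu> / 2 / (2 * M * B\<^sup>2), \<alpha> / 16 / (M * B), 1 / (32 * C * M * B) / M, 1 / 4 / (M * B)}"
  define d where "d = Min ds"
  have d_le: "d \<le> s" if "s \<in> ds" for s using that unfolding d_def by (intro Min_le) (auto simp: ds_def)
  have dpos: "d > 0" unfolding d_def ds_def using pos dm(1) by (subst Min_gr_iff) auto
  have d: "d \<le> dm / 2" "2 * M * B\<^sup>2 * d \<le> \<mu> / 2" "M * B * d \<le> \<alpha> / 16" "M * d \<le> 1 / (32 * C * M * B)" "M * B * d \<le> 1 / 4"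
  proof -
    show "d \<le> dm / 2" by (rule d_le) (simp add: ds_def)
    have "d \<le> \<mu> / 2 / (2 * M * B\<^sup>2)" by (rule d_le) (simp add: ds_def)
    then show "2 * M * B\<^sup>2 * d \<le> \<mu> / 2" using pos by (simp add: pos_le_divide_eq mult_ac)
    have "d \<le> \<alpha> / 16 / (M * B)" by (rule d_le) (simp add: ds_def)
    then show "M * B * d \<le> \<alpha> / 16" using pos by (simp add: pos_le_divide_eq mult_ac)
    have "d \<le> 1 / (32 * C * M * B) / M" by (rule d_le) (simp add: ds_def)
    then show "M * d \<le> 1 / (32 * C * M * B)" using pos by (subst (asm) pos_le_divide_eq) (simp_all add: mult.commute)
    have "d \<le> 1 / 4 / (M * B)" by (rule d_le) (simp add: ds_def)
    then show "M * B * d \<le> 1 / 4" using pos by (simp add: pos_le_divide_eq mult_ac)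
  qed
  have small_\<beta>: "\<kappa> * B + 2 * M * B\<^sup>2 * d \<le> \<alpha> / (128 * C * M)"
  proof -
    have "\<kappa> \<le> \<mu> / (2 * B)" by (simp add: \<kappa>_def)
    then have "\<kappa> * B \<le> \<mu> / 2" using pos by (simp add: pos_le_divide_eq mult_ac)
    with d(2) show ?thesis unfolding \<mu>_def by linarith
  qed
  have lat: "\<exists>ys. coupled_lattice f A y0 ys B M C \<kappa> d g (F \<epsilon>) (G \<epsilon>) \<epsilon> R \<alpha> \<mu> \<nu>"
    if y0: "y0 \<in> trajectories f \<Lambda>" and \<epsilon>: "\<bar>\<epsilon>\<bar> < \<epsilon>1" "\<bar>\<epsilon>\<bar> * (8 * B * (2 * B + \<nu>)) \<le> \<mu>" "\<bar>\<epsilon>\<bar> * (B * (4 * C)) \<le> d"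
    for y0 \<epsilon>
  proof -
    have orb: "orbit_in (f k) (\<Lambda> k) (y0 k)" for k using y0 by (simp add: trajectories_def)
    have "\<exists>ys. hyperbolic_orbit_modulus (f k) (A k) (y0 k) ys B M C \<kappa> d" for k
      unfolding A_def
    proof (rule hyperbolic_orbit_modulusI[OF _ _ _ _ orb lin[OF orb] B(1) MC])
      show "norm (frechet_derivative (f k) (at y) v - frechet_derivative (f k) (at z) v) \<le> \<kappa> * norm v"
        if "norm (y - z) \<le> d" for y z v
        using dm(2)[of y z k v] that d(1) dm(1) unfolding A_def by (simp add: dist_norm)
    qed (use f_deriv f_bounds A_cont pos dpos in \<open>auto simp: A_def \<kappa>_def\<close>)
    then obtain ys where ys: "\<And>k. hyperbolic_orbit_modulus (f k) (A k) (y0 k) (ys k) B M C \<kappa> d" by metis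
    have "coupled_lattice f A y0 ys B M C \<kappa> d g (F \<epsilon>) (G \<epsilon>) \<epsilon> R \<alpha> \<mu> \<nu>"
    proof (rule coupled_lattice.intro)
      show "norm (y0 k t) \<le> R" for k t using orb[of k] R unfolding orbit_in_def by blast
      show "\<alpha> \<le> 1 / (16 * C)" by (simp add: \<alpha>_def)
    qed (fact ys g_bound g_Lip F_bound[OF \<epsilon>(1)] G_bound[OF \<epsilon>(1)] F_Lip[OF \<epsilon>(1)] G_Lip[OF \<epsilon>(1)]
        pos(1) \<mu>_def \<nu>_def small_\<beta> d(3,4) \<epsilon>(2,3))+
    then show ?thesis by blast
  qed
  define P where "P = coupled_lattice.phase_const B M"
  define K0 where "K0 = coupled_lattice.shadow_const B d \<alpha> \<mu> \<nu>"
  define \<rho> where "\<rho> = 1 / (16 * M * B\<^sup>2)"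
  define m where "m = min (1 / (32 * M * B\<^sup>2)) d"
  define q0 where "q0 = m / (6 * B\<^sup>2 * P + 12 * C * B\<^sup>2)"
  define c where "c = (B + 1 + \<nu>) * K0 + 2 * R + q0 + d"
  define CK where "CK K \<gamma> = c * exp (\<alpha> * time_shift (K + 1 - ln ((q0 / 3) / \<gamma>) / (B + 1)))" for K \<gamma>
  show ?thesis
  \<comment> \<open>Without trajectories the claim is vacuous for any constants. Otherwise the
    lattice at \<epsilon> = 0 exists, and it is what permits unfolding \<open>phase_const\<close>
    outside the locale to see that \<open>q0\<close> is positive.\<close>
  proof (cases "trajectories f \<Lambda> = {}")
    case True
    then show ?thesis
      by (intro exI[of _ 1] conjI exI[of _ "\<lambda>_ _. 0"]) (auto intro!: exI[of _ 1])
  next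
    case False
    then obtain y00 where y00: "y00 \<in> trajectories f \<Lambda>" by blast
    have q0pos: "q0 > 0"
    proof -
      obtain ys where "coupled_lattice f A y00 ys B M C \<kappa> d g (F 0) (G 0) 0 R \<alpha> \<mu> \<nu>"
        using lat[OF y00, of 0] assms(5) pos dpos by auto
      then have "P = 8 * M * B\<^sup>2 * (4 * M * exp (B + 1))"
        unfolding P_def by (rule coupled_lattice.phase_const_def)
      then have "P > 0" using pos by simp
      moreover have "m > 0" using pos dpos by (simp add: m_def)
      ultimately show ?thesis using pos unfolding q0_def by (intro divide_pos_pos add_pos_pos mult_pos_pos) auto
    qed
    \<comment> \<open>For fixed \<open>K\<close> the logarithm drives the argument of
      \<open>time_shift\<close>, and with it the exponent, to -\<infinity> as \<gamma> tends to
      0.\<close>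
    have lim: "(CK K \<longlongrightarrow> 0) (at_right 0)" for K
    proof -
      have "filterlim (\<lambda>\<gamma>. (q0 / 3) * inverse \<gamma>) at_top (at_right 0)"
        using q0pos by (intro filterlim_tendsto_pos_mult_at_top[OF tendsto_const] filterlim_inverse_at_top_right) auto
      from filterlim_compose[OF ln_at_top this]
      have "filterlim (\<lambda>\<gamma>. ln ((q0 / 3) / \<gamma>)) at_top (at_right 0)"
        unfolding divide_inverse[of "q0 / 3"] .
      then have "filterlim (\<lambda>\<gamma>. (1 / (B + 1)) * ln ((q0 / 3) / \<gamma>)) at_top (at_right 0)"
        using pos by (intro filterlim_tendsto_pos_mult_at_top[OF tendsto_const]) auto
      then have "filterlim (\<lambda>\<gamma>. - (K + 1) + (1 / (B + 1)) * ln ((q0 / 3) / \<gamma>)) at_top (at_right 0)"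
        by (intro filterlim_tendsto_add_at_top[OF tendsto_const])
      then have "filterlim (\<lambda>\<gamma>. - (- (K + 1) + (1 / (B + 1)) * ln ((q0 / 3) / \<gamma>))) at_bot (at_right 0)"
        by (rule filterlim_uminus_at_top[THEN iffD1])
      moreover have "(\<lambda>\<gamma>. - (- (K + 1) + (1 / (B + 1)) * ln ((q0 / 3) / \<gamma>)))
          = (\<lambda>\<gamma>. K + 1 - ln ((q0 / 3) / \<gamma>) / (B + 1))"
        by (simp add: fun_eq_iff)
      ultimately have "filterlim (\<lambda>\<gamma>. K + 1 - ln ((q0 / 3) / \<gamma>) / (B + 1)) at_bot (at_right 0)"
        by (simp only:)
      from time_shift_tendsto[OF this]
      have "filterlim (\<lambda>\<gamma>. \<alpha> * time_shift (K + 1 - ln ((q0 / 3) / \<gamma>) / (B + 1))) at_bot (at_right 0)"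
        using filterlim_tendsto_pos_mult_at_bot[OF tendsto_const pos(1)] by blast
      then show ?thesis
        unfolding CK_def using tendsto_mult_right_zero[OF filterlim_compose[OF exp_at_bot]] by blast
    qed
    show ?thesis
    proof (rule exI[of _ \<alpha>], rule conjI[OF pos(1)], rule exI[of _ "q0 / 3"], rule conjI,
        goal_cases)
      case 1
      show ?case using q0pos by simp
    next
      case 2
      show ?case
      proof (rule exI[of _ \<rho>], rule conjI, goal_cases)
        case 1
        show ?case using pos by (simp add: \<rho>_def)
      next
        case 2
        show ?case
        proof (rule exI[of _ CK], rule conjI, rule allI, rule lim, rule exI[of _ "q0 / 3"], rule conjI,
            goal_cases)
          case 1
          show ?case using q0pos by simp
        next
          case 2
          show ?case
          proof (intro allI impI, elim conjE)
            fix \<delta> :: real assume \<delta>: "0 < \<delta>" "\<delta> \<le> q0 / 3"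
            \<comment> \<open>The entries keep \<epsilon> in the range of the family, make the
              coupling weak enough for the contraction, and keep a displacement caused by the force
              below \<open>d\<close>, \<delta> and \<open>q0 / 3\<close>.\<close>
            define \<epsilon>0 where "\<epsilon>0 = min \<epsilon>1 (min (\<mu> / (8 * B * (2 * B + \<nu>))) (min d (min \<delta> (q0 / 3)) / (4 * C * B)))"
            have \<epsilon>0: "\<epsilon>0 > 0" using assms(5) pos dpos \<delta> q0pos by (simp add: \<epsilon>0_def)
            have main: "\<exists>!u2.
                (\<exists>\<Phi>2. manifold_solution f g F G \<epsilon> \<delta> y02 \<Phi>2 u2 \<and>
                      (\<forall>\<^sub>F t in at_top. dist (\<Phi>1 t) (\<Phi>2 t) \<le> \<rho>)) \<and>
                (\<forall>t\<ge>t0. norm (fst (u1 t) - fst (u2 t)) + norm (snd (u1 t) - snd (u2 t))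
                          \<le> CK K \<gamma> * exp (- \<alpha> * (t - t0)))"
              if \<epsilon>: "\<bar>\<epsilon>\<bar> < \<epsilon>0" and \<gamma>: "0 < \<gamma>" "\<gamma> < q0 / 3"
                and y0: "y01 \<in> trajectories f \<Lambda>" "y02 \<in> trajectories f \<Lambda>"
                and close: "\<forall>t\<ge>t0. norm (traj_at y01 t - traj_at y02 t) \<le> \<gamma>"
                and u1: "manifold_solution f g F G \<epsilon> \<delta> y01 \<Phi>1 u1" "\<forall>k. apply_bcontfun (\<Phi>1 t0) k \<ge> t0 - K"
              for \<epsilon> \<gamma> y01 y02 t0 u1 \<Phi>1 K
            proof -
              have \<epsilon>': "\<bar>\<epsilon>\<bar> < \<epsilon>1" "\<bar>\<epsilon>\<bar> \<le> \<mu> / (8 * B * (2 * B + \<nu>))" "\<bar>\<epsilon>\<bar> \<le> min d (min \<delta> (q0 / 3)) / (4 * C * B)"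
                using \<epsilon> by (auto simp: \<epsilon>0_def)
              have s1: "\<bar>\<epsilon>\<bar> * (8 * B * (2 * B + \<nu>)) \<le> \<mu>"
                using \<epsilon>'(2) pos by (subst (asm) pos_le_divide_eq) auto
              have s2: "\<bar>\<epsilon>\<bar> * (4 * C * B) \<le> min d (min \<delta> (q0 / 3))"
                using \<epsilon>'(3) pos by (subst (asm) pos_le_divide_eq) auto
              then have s3: "\<bar>\<epsilon>\<bar> * (B * (4 * C)) \<le> d" "\<bar>\<epsilon>\<bar> * (4 * C * B) \<le> min \<delta> (q0 / 3)"
                by (simp_all add: mult_ac)
              obtain ys1 where l1: "coupled_lattice f A y01 ys1 B M C \<kappa> d g (F \<epsilon>) (G \<epsilon>) \<epsilon> R \<alpha> \<mu> \<nu>"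
                using lat[OF y0(1) \<epsilon>'(1) s1 s3(1)] by blast
              obtain ys2 where l2: "coupled_lattice f A y02 ys2 B M C \<kappa> d g (F \<epsilon>) (G \<epsilon>) \<epsilon> R \<alpha> \<mu> \<nu>"
                using lat[OF y0(2) \<epsilon>'(1) s1 s3(1)] by blast
              show ?thesis
                by (rule asymptotic_solution[OF l1 l2 P_def K0_def \<rho>_def m_def q0_def d(5) \<delta> s3(2) \<gamma>
                      close[rule_format] u1(1) u1(2)[rule_format] _ CK_def]) (simp_all add: c_def)
            qed
            show "\<exists>\<epsilon>0>0. \<forall>\<epsilon> \<gamma>. \<bar>\<epsilon>\<bar> < \<epsilon>0 \<and> 0 < \<gamma> \<and> \<gamma> < q0 / 3 \<longrightarrow>
              (\<forall>y01\<in>trajectories f \<Lambda>. \<forall>y02\<in>trajectories f \<Lambda>. \<forall>t0.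
                (\<forall>t\<ge>t0. norm (traj_at y01 t - traj_at y02 t) \<le> \<gamma>) \<longrightarrow>
                (\<forall>u1 \<Phi>1 K.
                  manifold_solution f g F G \<epsilon> \<delta> y01 \<Phi>1 u1 \<and>
                  (\<forall>k. apply_bcontfun (\<Phi>1 t0) k \<ge> t0 - K) \<longrightarrow>
                  (\<exists>!u2.
                    (\<exists>\<Phi>2. manifold_solution f g F G \<epsilon> \<delta> y02 \<Phi>2 u2 \<and>
                          (\<forall>\<^sub>F t in at_top. dist (\<Phi>1 t) (\<Phi>2 t) \<le> \<rho>)) \<and>
                    (\<forall>t\<ge>t0. norm (fst (u1 t) - fst (u2 t)) + norm (snd (u1 t) - snd (u2 t))
                              \<le> CK K \<gamma> * exp (- \<alpha> * (t - t0))))))"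
              by (intro exI[of _ \<epsilon>0] conjI[OF \<epsilon>0] allI ballI impI; elim conjE; rule main; assumption)
          qed
        qed
      qed
    qed
  qed
qed

end
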